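(* Let $n\ge 3$. Let $U\subset \mathcal S^{n\times n}$ be an open set such that $O^{-1}UO=U$ for all $O\in O(n)$, and such that $U\cap\{M+tN \mid 0<t<\infty\}$ is convex for all $M\in\mathcal S^{n\times n}$ and all $N\in\mathcal S^{n\times n}_+$. Let $F\in C^1(U)$ satisfy: (a) $F(O^{-1}MO)=F(M)$ for all $M\in U$, $O\in O(n)$; (b) the matrix $\left(\frac{\partial F}{\partial M_{ij}}(M)\right)$ is positive definite for all $M\in U$; (c) for some $\delta>0$, $F(M)\ne 1$ for all $M\in U$ with $\|M\|<\delta$. Assume that $u\in C^2(\mathbb R^n\setminus B_{1/2})$ satisfies $$u>0,\quad \Delta u\le 0,\quad A^u\in U,\quad F(A^u)=1\qquad\text{in } \mathbb R^n\setminus B_{1/2}.$$ Then $$\limsup_{|x|\to\infty}|x|^{\frac{n-2}{2}}u(x)<\infty .$$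
   Context: $\mathcal S^{n\times n}$ is the set of real symmetric $n\times n$ matrices, $\mathcal S^{n\times n}_+$ the subset of positive definite ones, $O(n)$ the real orthogonal $n\times n$ matrices, $\|M\|=(\sum_{i,j}M_{ij}^2)^{1/2}$. $B_a(x)\subset\mathbb R^n$ is the ball of radius $a$ centered at $x$, $B_a=B_a(0)$. For a positive $C^2$ function $u$, $$A^u=-\frac{2}{n-2}u^{-\frac{n+2}{n-2}}\nabla^2u+\frac{2n}{(n-2)^2}u^{-\frac{2n}{n-2}}\nabla u\otimes\nabla u-\frac{2}{(n-2)^2}u^{-\frac{2n}{n-2}}|\nabla u|^2 I,$$ where $\nabla u$ is the gradient, $\nabla^2u$ the Hessian of $u$ and $I$ the identity matrix. *)

theory Defs
  imports "HOL-Analysis.Analysis"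
begin

text \<open>The library norm on \<^typ>\<open>real ^ 'n ^ 'n\<close> is the Euclidean norm of the Euclidean norms of
  the rows, i.e. the Frobenius norm \<open>(\<Sum>i j. (M $ i $ j)\<^sup>2) powr (1/2)\<close>.\<close>

definition sym_matrices :: "(real ^ 'n ^ 'n) set" where
  "sym_matrices = {M. transpose M = M}"

definition pos_def :: "real ^ 'n ^ 'n \<Rightarrow> bool" where
  "pos_def M \<longleftrightarrow> M \<in> sym_matrices \<and> (\<forall>v. v \<noteq> 0 \<longrightarrow> 0 < v \<bullet> (M *v v))"

definition outer :: "real ^ 'n \<Rightarrow> real ^ 'n \<Rightarrow> real ^ 'n ^ 'n" where
  "outer v w = (\<chi> i j. v $ i * w $ j)"

subsection \<open>Functions of a symmetric matrix\<close>

text \<open>A function \<open>F\<close> on a (relatively open) set of symmetric matrices has partial derivatives with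
  respect to the entries in the usual sense: extend \<open>F\<close> to non-symmetric arguments by
  \<open>M \<mapsto> F ((M + transpose M) / 2)\<close> and differentiate with respect to the entry \<open>(i, j)\<close>.
  Thus the direction is the symmetric part of the matrix unit, \<open>(\<partial>F/\<partial>M\<^sub>i\<^sub>j)\<close> is a symmetric
  matrix, and \<open>dF(H) = (\<Sum>i j. (\<partial>F/\<partial>M\<^sub>i\<^sub>j) * H\<^sub>i\<^sub>j)\<close> for symmetric \<open>H\<close>.\<close>

definition sym_unit :: "'n \<Rightarrow> 'n \<Rightarrow> real ^ 'n ^ 'n" where
  "sym_unit i j = (1/2) *\<^sub>R (outer (axis i 1) (axis j 1) + outer (axis j 1) (axis i 1))"

definition matrix_grad :: "(real ^ 'n ^ 'n \<Rightarrow> real) \<Rightarrow> real ^ 'n ^ 'n \<Rightarrow> real ^ 'n ^ 'n" where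
  "matrix_grad F M = (\<chi> i j. deriv (\<lambda>t. F (M + t *\<^sub>R sym_unit i j)) 0)"

text \<open>Meant for \<open>U\<close> relatively open in \<^const>\<open>sym_matrices\<close>; differentiability within \<open>U\<close> is then
  differentiability on the vector space of symmetric matrices.\<close>

definition C1_on_sym :: "(real ^ 'n ^ 'n) set \<Rightarrow> (real ^ 'n ^ 'n \<Rightarrow> real) \<Rightarrow> bool" where
  "C1_on_sym U F \<longleftrightarrow> F differentiable_on U \<and> continuous_on U (matrix_grad F)"

subsection \<open>Functions on (the closure of) a domain\<close>

text \<open>Derivatives are taken relative to \<open>S\<close>, so that they make sense (one-sidedly) at boundary
  points. They are the ordinary derivatives at interior points, and they are uniquely determined
  at every point of the complement of an open ball.\<close>

definition gradient :: "(real ^ 'n) set \<Rightarrow> (real ^ 'n \<Rightarrow> real) \<Rightarrow> real ^ 'n \<Rightarrow> real ^ 'n" where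
  "gradient S u x = (\<chi> i. frechet_derivative u (at x within S) (axis i 1))"

definition hessian :: "(real ^ 'n) set \<Rightarrow> (real ^ 'n \<Rightarrow> real) \<Rightarrow> real ^ 'n \<Rightarrow> real ^ 'n ^ 'n" where
  "hessian S u x =
    (\<chi> i j. frechet_derivative (\<lambda>y. gradient S u y $ i) (at x within S) (axis j 1))"

definition laplacian :: "(real ^ 'n) set \<Rightarrow> (real ^ 'n \<Rightarrow> real) \<Rightarrow> real ^ 'n \<Rightarrow> real" where
  "laplacian S u x = trace (hessian S u x)"

definition C2_on :: "(real ^ 'n) set \<Rightarrow> (real ^ 'n \<Rightarrow> real) \<Rightarrow> bool" where
  "C2_on S u \<longleftrightarrow> u differentiable_on S \<and> gradient S u differentiable_on S \<and>
    continuous_on S (hessian S u)"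

definition A_conf :: "(real ^ 'n) set \<Rightarrow> (real ^ 'n \<Rightarrow> real) \<Rightarrow> real ^ 'n \<Rightarrow> real ^ 'n ^ 'n" where
  "A_conf S u x =
    (let n = real CARD('n); g = gradient S u x in
      (- (2 / (n - 2)) * u x powr (- ((n + 2) / (n - 2)))) *\<^sub>R hessian S u x
      + (2 * n / (n - 2)\<^sup>2 * u x powr (- (2 * n / (n - 2)))) *\<^sub>R outer g g
      - (2 / (n - 2)\<^sup>2 * u x powr (- (2 * n / (n - 2))) * (norm g)\<^sup>2) *\<^sub>R mat 1)"

end

theory Submission
  imports Defs
begin

text \<open>The function \<open>\<rho> = u powr (- 2 / (n - 2))\<close> turns \<open>A\<^sup>u\<close> into \<open>\<rho> \<nabla>\<^sup>2\<rho> - 1/2 |\<nabla>\<rho>|\<^sup>2 I\<close>, an expression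
  without powers and without \<open>n\<close>, and the assertion into a lower bound \<open>\<rho>(x) \<ge> c |x|\<close> near infinity.
  The inversion in the sphere of radius \<open>l\<close> about \<open>x\<close> acts on \<open>\<rho>\<close> by the Kelvin transform
  \<open>\<rho>'(y) = (|y - x| / l)\<^sup>2 \<rho>(x + l\<^sup>2 (y - x) / |y - x|\<^sup>2)\<close>, and the tensor of \<open>\<rho>'\<close> at \<open>y\<close> is that of \<open>\<rho>\<close> at
  the inverted point, conjugated by the reflection along \<open>y - x\<close> (\<open>conf_op_kelvin\<close>). So the equation is
  invariant, and the transform about 0 moves the end at infinity into a punctured ball. There \<open>\<rho>\<close> is
  bounded, because the positive superharmonic function \<open>u\<close> is at least \<open>c |x| powr (2 - n)\<close>; what has to
  be shown is \<open>\<rho>(y) \<ge> c |y|\<close> near 0 (\<open>linear_lower_bound_near_singularity\<close>).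

  If this fails, then \<open>\<rho>\<close> is somewhere much smaller than the distance to 0, and a maximality argument
  (\<open>blow_up_point\<close>) selects a point \<open>z\<close> with \<open>\<rho> \<ge> r / 2\<close>, \<open>r = \<rho>(z)\<close>, on a ball about \<open>z\<close> whose radius is as
  large a multiple of \<open>r\<close> as desired. The method of moving spheres (\<open>comparison_all_spheres\<close>) shows that
  \<open>\<rho>\<close> is at most its Kelvin transform outside every sphere whose centre and radius stay within a
  large multiple of \<open>r\<close> from \<open>z\<close>. Two points \<open>z\<close> and \<open>b\<close> at distance at most \<open>r\<close> are exchanged by the
  inversion in such a sphere, with a distant centre on their line, and the conformal factor is then
  close to 1; hence \<open>\<rho> \<le> (1 + \<eta>) r\<close> on the ball of radius \<open>r\<close> about \<open>z\<close>. A paraboloid touching \<open>\<rho>\<close> from above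
  in this ball gives a point at which the gradient of \<open>\<rho>\<close> is small and its Hessian is at most a
  small multiple of \<open>I / r\<close>; as the trace of the Hessian is nonnegative, the whole tensor is small there,
  which contradicts \<open>F \<noteq> 1\<close> near the zero matrix (\<open>no_almost_constant_solution\<close>).

  Moving spheres need three comparison principles for solutions \<open>\<rho> \<le> \<sigma>\<close>: the boundary point lemma of Hopf,
  the strong maximum principle, and the impossibility of contact at an isolated singularity of \<open>\<rho>\<close>.
  They share one mechanism (\<open>touching_contradiction\<close>). Suppose that \<open>\<rho>\<close> touches the perturbation
  \<open>\<sigma> - e h\<close> from below, up to a constant, at points tending to \<open>p\<close> as \<open>e\<close> tends to 0. At these points the
  tensor of \<open>\<rho>\<close> lies below that of \<open>\<sigma>\<close> minus \<open>e (\<sigma> \<nabla>\<^sup>2h - (\<nabla>\<sigma> \<bullet> \<nabla>h) I)\<close>, up to \<open>o(e)\<close>. Whenever the derivative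
  of \<open>F\<close> at the tensor of \<open>\<sigma>\<close> at \<open>p\<close> is positive in the direction of the last matrix, monotonicity
  of \<open>F\<close> forces \<open>F < 1\<close> at the tensor of \<open>\<rho>\<close>, which is absurd. Each principle is a choice of \<open>h\<close>.\<close>

section \<open>Symmetric matrices and quadratic forms\<close>

lemma inner_outer: "(G::real^'n^'n) \<bullet> outer v w = v \<bullet> (G *v w)"
  by (simp add: outer_def inner_vec_def matrix_vector_mult_def sum_distrib_left mult.assoc mult.left_commute)

lemma inner_mat_1: "(G::real^'n^'n) \<bullet> mat 1 = trace G"
  by (simp add: inner_vec_def mat_def trace_def if_distrib cong: if_cong)

lemma outer_mult_vec: "outer v w *v x = (w \<bullet> x) *\<^sub>R (v::real^'n)"
  by (simp add: vec_eq_iff outer_def matrix_vector_mult_def inner_vec_def sum_distrib_left sum_distrib_right mult_ac)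

lemma scaleR_mult_vec: "(c *\<^sub>R (A::real^'n^'n)) *v x = c *\<^sub>R (A *v x)"
  by (simp add: scaleR_matrix_vector_assoc)

lemmas quad_simps = matrix_vector_mult_add_rdistrib matrix_vector_mult_diff_rdistrib scaleR_mult_vec
  outer_mult_vec inner_add_left inner_add_right inner_diff_left inner_diff_right

lemma sym_matricesI: "(\<And>i j. (M::real^'n^'n)$i$j = M$j$i) \<Longrightarrow> M \<in> sym_matrices"
  by (simp add: sym_matrices_def transpose_def vec_eq_iff)

lemma sym_matricesD: "(M::real^'n^'n) \<in> sym_matrices \<Longrightarrow> M$i$j = M$j$i"
  by (simp add: sym_matrices_def transpose_def vec_eq_iff)

lemma sym_inner_swap:
  assumes "(N::real^'n^'n) \<in> sym_matrices"
  shows "v \<bullet> (N *v w) = w \<bullet> (N *v v)"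
proof -
  have "v \<bullet> (N *v w) = (N *v v) \<bullet> w"
    using assms dot_lmul_matrix[of v N w] transpose_matrix_vector[of N v] by (simp add: sym_matrices_def)
  then show ?thesis by (simp add: inner_commute)
qed

lemma mult_axis: "(N::real^'n^'n) \<in> sym_matrices \<Longrightarrow> N *v axis i 1 = N $ i"
  by (simp add: matrix_vector_mult_basis column_def vec_eq_iff sym_matricesD)

lemma sym_add: "M \<in> sym_matrices \<Longrightarrow> N \<in> sym_matrices \<Longrightarrow> (M::real^'n^'n) + N \<in> sym_matrices"
  by (rule sym_matricesI) (simp add: sym_matricesD)
lemma sym_diff: "M \<in> sym_matrices \<Longrightarrow> N \<in> sym_matrices \<Longrightarrow> (M::real^'n^'n) - N \<in> sym_matrices"
  by (rule sym_matricesI) (simp add: sym_matricesD)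
lemma sym_scaleR: "M \<in> sym_matrices \<Longrightarrow> c *\<^sub>R (M::real^'n^'n) \<in> sym_matrices"
  by (rule sym_matricesI) (simp add: sym_matricesD)
lemma sym_mat_1: "(mat 1::real^'n^'n) \<in> sym_matrices"
  by (rule sym_matricesI) (simp add: mat_def)
lemma sym_outer: "outer v v \<in> sym_matrices"
  by (rule sym_matricesI) (simp add: outer_def)
lemmas sym_intros = sym_add sym_diff sym_scaleR sym_mat_1 sym_outer

text \<open>One step of the reduction of Lagrange. The subtracted form is chosen such that the reduced form
  at \<open>v\<close> is the minimum of the form of \<open>N\<close> on the line \<open>v + t e\<^sub>i\<close>, hence nonnegative; its \<open>i\<close>-th row
  vanishes.\<close>

lemma psd_peel:
  fixes N :: "real^'n^'n"
  assumes N: "N \<in> sym_matrices" "\<And>v. 0 \<le> v \<bullet> (N *v v)" and i: "0 < N$i$i"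
  shows "0 \<le> v \<bullet> ((N - (1 / N$i$i) *\<^sub>R outer (N$i) (N$i)) *v v)"
proof -
  define c where "c = (N$i \<bullet> v) / N$i$i"
  have "0 \<le> (v - c *\<^sub>R axis i 1) \<bullet> (N *v (v - c *\<^sub>R axis i 1))" by (rule N(2))
  also have "\<dots> = v \<bullet> (N *v v) - 2 * c * (N$i \<bullet> v) + c^2 * N$i$i"
    by (simp add: matrix_vector_mult_diff_distrib matrix_vector_mult_scaleR mult_axis[OF N(1)] 
       matrix_vector_mul_component inner_diff_left inner_diff_right inner_axis' inner_commute[of v] power2_eq_square algebra_simps)
  also have "\<dots> = v \<bullet> (N *v v) - (1 / N$i$i) * (N$i \<bullet> v)^2"
    using i by (simp add: c_def field_simps power2_eq_square)
  also have "\<dots> = v \<bullet> ((N - (1 / N$i$i) *\<^sub>R outer (N$i) (N$i)) *v v)"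
    by (simp add: quad_simps power2_eq_square inner_commute)
  finally show ?thesis .
qed

text \<open>Peeling writes \<open>N\<close> as a positive combination of matrices \<open>outer v v\<close>, whose inner product with \<open>G\<close> is the
  value at \<open>v\<close> of the form of \<open>G\<close>. Every step removes a nonzero diagonal entry and creates none, and a positive
  semidefinite matrix with zero diagonal is 0. This replaces a simultaneous diagonalisation.\<close>

lemma psd_inner_nonneg:
  fixes N G :: "real^'n^'n"
  assumes G: "\<And>v. 0 \<le> v \<bullet> (G *v v)"
  assumes "N \<in> sym_matrices" "\<And>v. 0 \<le> v \<bullet> (N *v v)"
  shows "0 \<le> G \<bullet> N"
  using assms(2,3)
proof (induction "card {i. N$i$i \<noteq> 0}" arbitrary: N rule: less_induct)
  case (less N)
  have diag: "0 \<le> N$i$i" if "\<And>v. 0 \<le> v \<bullet> (N *v v)" "N \<in> sym_matrices" for N :: "real^'n^'n" and i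
    using that(1)[of "axis i 1"] by (simp add: mult_axis[OF that(2)] inner_axis')
  show ?case
  proof (cases "\<exists>i. N$i$i \<noteq> 0")
    case True
    then obtain i where i: "N$i$i \<noteq> 0" by blast
    with diag[OF less(3,2), of i] have ipos: "0 < N$i$i" by simp
    define N' where "N' = N - (1 / N$i$i) *\<^sub>R outer (N$i) (N$i)"
    have psd: "0 \<le> v \<bullet> (N' *v v)" for v
      unfolding N'_def by (rule psd_peel[OF less(2,3) ipos])
    have sym: "N' \<in> sym_matrices" unfolding N'_def by (intro sym_intros less)
    have entry: "N'$j$j = N$j$j - (N$i$j)^2 / N$i$i" for j
      by (simp add: N'_def outer_def power2_eq_square)
    have sub: "{j. N'$j$j \<noteq> 0} \<subseteq> {j. N$j$j \<noteq> 0}"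
    proof clarsimp
      fix j assume "N'$j$j \<noteq> 0" "N$j$j = 0"
      with diag[OF psd sym, of j] entry[of j] ipos show False
        by (smt (verit) divide_nonneg_pos zero_le_power2)
    qed
    have "N'$i$i = 0" using i by (simp add: entry power2_eq_square)
    with sub i have "{j. N'$j$j \<noteq> 0} \<subset> {j. N$j$j \<noteq> 0}" by auto
    then have "card {j. N'$j$j \<noteq> 0} < card {j. N$j$j \<noteq> 0}" by (simp add: psubset_card_mono)
    from less(1)[OF this sym psd] have "0 \<le> G \<bullet> N'" .
    moreover have "G \<bullet> N = G \<bullet> N' + (1 / N$i$i) * (N$i \<bullet> (G *v N$i))"
      by (simp add: N'_def inner_diff_right inner_outer)
    ultimately show ?thesis using ipos G[of "N$i"] by simp
  next
    case False
    then have d0: "N$i$i = 0" for i by blast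
    have "N$i$j = 0" for i j
    proof -
      have "0 \<le> (axis i 1 + axis j 1) \<bullet> (N *v (axis i 1 + axis j 1))"
           "0 \<le> (axis i 1 - axis j 1) \<bullet> (N *v (axis i 1 - axis j 1))" by (rule less(3))+
      then show ?thesis
        using sym_matricesD[OF less(2), of i j]
        by (simp add: matrix_vector_mult_diff_distrib matrix_vector_right_distrib mult_axis[OF less(2)]
            inner_add_left inner_diff_left inner_add_right inner_diff_right inner_axis' d0)
    qed
    then have "N = 0" by (simp add: vec_eq_iff)
    then show ?thesis by simp
  qed
qed

lemma pos_def_inner_pos:
  fixes N G :: "real^'n^'n"
  assumes G: "pos_def G" and N: "pos_def N"
  shows "0 < G \<bullet> N"
proof -
  fix i :: 'n
  have sN: "N \<in> sym_matrices" and pN: "\<And>v. v \<noteq> 0 \<Longrightarrow> 0 < v \<bullet> (N *v v)"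
    and pG: "\<And>v. v \<noteq> 0 \<Longrightarrow> 0 < v \<bullet> (G *v v)"
    using assms by (auto simp: pos_def_def)
  have ge: "0 \<le> v \<bullet> (N *v v)" "0 \<le> v \<bullet> (G *v v)" for v
    using pN[of v] pG[of v] by (cases "v = 0"; force)+
  have ipos: "0 < N$i$i"
    using pN[of "axis i 1"] by (simp add: mult_axis[OF sN] inner_axis')
  then have "N$i \<noteq> 0" by auto
  define N' where "N' = N - (1 / N$i$i) *\<^sub>R outer (N$i) (N$i)"
  have "0 \<le> G \<bullet> N'"
    unfolding N'_def by (rule psd_inner_nonneg) (intro ge sym_intros sN psd_peel[OF _ _ ipos])+
  moreover have "G \<bullet> N = G \<bullet> N' + (1 / N$i$i) * (N$i \<bullet> (G *v N$i))"
    by (simp add: N'_def inner_diff_right inner_outer)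
  ultimately show ?thesis using ipos pG[OF \<open>N$i \<noteq> 0\<close>] by (simp add: add_nonneg_pos)
qed

lemma sym_unit_sym: "sym_unit i j \<in> (sym_matrices :: (real^'n^'n) set)"
  by (rule sym_matricesI) (simp add: sym_unit_def outer_def add.commute)

lemma sym_unit_entry:
  "(sym_unit i j :: real^'n^'n) $ a $ b =
    (if j = b then if i = a then 1/2 else 0 else 0) + (if j = a then if i = b then 1/2 else 0 else 0)"
proof -
  have "axis i (1::real) $ a = (if i = a then 1 else 0)" for i a :: 'n
    by (simp add: axis_def eq_commute)
  then show ?thesis
    unfolding sym_unit_def outer_def by (simp split: if_split)
qed

text \<open>With this expansion the linear map \<open>dF\<close> on symmetric matrices is the inner product with the
  matrix of partial derivatives.\<close>

lemma sym_unit_expansion: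
  assumes "N \<in> sym_matrices"
  shows "(N::real^'n^'n) = (\<Sum>i\<in>UNIV. \<Sum>j\<in>UNIV. N$i$j *\<^sub>R sym_unit i j)"
proof -
  have "(\<Sum>i\<in>UNIV. \<Sum>j\<in>UNIV. N$i$j *\<^sub>R sym_unit i j) $ a $ b = N$a$b" for a b
  proof -
    have "(\<Sum>i\<in>UNIV. \<Sum>j\<in>UNIV. N$i$j *\<^sub>R sym_unit i j) $ a $ b
      = (\<Sum>i\<in>UNIV. \<Sum>j\<in>UNIV. (if j = b then if i = a then N$i$j/2 else 0 else 0)
          + (if j = a then if i = b then N$i$j/2 else 0 else 0))"
      unfolding sum_component vector_scaleR_component sym_unit_entry
      by (intro sum.cong refl) (simp split: if_split)
    also have "\<dots> = N$a$b/2 + N$b$a/2"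
      by (simp add: sum.distrib)
    finally show ?thesis using sym_matricesD[OF assms, of a b] by simp
  qed
  then show ?thesis by (simp add: vec_eq_iff)
qed

section \<open>Monotonicity of F\<close>

text \<open>The hypotheses on \<open>U\<close> and \<open>F\<close> alone, so that the comparison principles can speak of several solutions
  on several domains.\<close>

locale conformal_equation =
  fixes U :: "(real ^ 'n ^ 'n) set"
    and F :: "real ^ 'n ^ 'n \<Rightarrow> real"
  assumes n: "CARD('n) \<ge> 3"
    and U_open: "openin (top_of_set sym_matrices) U"
    and U_inv: "\<And>Q. orthogonal_matrix Q \<Longrightarrow> (\<lambda>M. matrix_inv Q ** M ** Q) ` U = U"
    and U_convex: "\<And>M N. M \<in> sym_matrices \<Longrightarrow> pos_def N \<Longrightarrow>
                     convex (U \<inter> {M + t *\<^sub>R N | t. 0 < t})"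
    and F_C1: "C1_on_sym U F"
    and F_inv: "\<And>M Q. M \<in> U \<Longrightarrow> orthogonal_matrix Q \<Longrightarrow> F (matrix_inv Q ** M ** Q) = F M"
    and F_elliptic: "\<And>M. M \<in> U \<Longrightarrow> pos_def (matrix_grad F M)"
    and F_ne_1: "\<exists>\<delta>>0. \<forall>M\<in>U. norm M < \<delta> \<longrightarrow> F M \<noteq> 1"
begin

lemma U_sym: "M \<in> U \<Longrightarrow> M \<in> sym_matrices"
  using U_open openin_subset by fastforce

lemma U_ball:
  assumes "A \<in> U"
  obtains d where "0 < d" "\<And>X. X \<in> sym_matrices \<Longrightarrow> norm (X - A) < d \<Longrightarrow> X \<in> U"
proof -
  obtain W where W: "open W" "U = sym_matrices \<inter> W"
    using U_open unfolding openin_open by blast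
  with assms obtain d where "0 < d" "ball A d \<subseteq> W" by (auto simp: open_contains_ball)
  moreover have "X \<in> ball A d" if "norm (X - A) < d" for X
    using that by (simp add: dist_norm norm_minus_commute)
  ultimately show ?thesis using that[of d] W by blast
qed

lemma F_derivative_line:
  assumes A: "A + t *\<^sub>R N \<in> U" and N: "A \<in> sym_matrices" "N \<in> sym_matrices"
  shows "((\<lambda>s. F (A + s *\<^sub>R N)) has_real_derivative (matrix_grad F (A + t *\<^sub>R N) \<bullet> N)) (at t)"
proof -
  define B where "B = A + t *\<^sub>R N"
  have "B \<in> U" using A by (simp add: B_def)
  then obtain D where D: "(F has_derivative D) (at B within U)"
    using F_C1 by (auto simp: C1_on_sym_def differentiable_on_def differentiable_def)
  interpret D: bounded_linear D using D by (rule has_derivative_bounded_linear)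
  obtain W where W: "open W" "U = sym_matrices \<inter> W"
    using U_open unfolding openin_open by blast
  have line: "((\<lambda>s. F (A' + s *\<^sub>R M)) has_real_derivative D M) (at t')"
    if M: "M \<in> sym_matrices" "A' \<in> sym_matrices" and B: "B = A' + t' *\<^sub>R M" for M A' t'
  proof -
    define T where "T = (\<lambda>s. A' + s *\<^sub>R M) -` W"
    have T: "open T" "t' \<in> T"
      using W \<open>B \<in> U\<close> B by (auto simp: T_def intro!: continuous_open_vimage continuous_intros)
    have im: "(\<lambda>s. A' + s *\<^sub>R M) ` T \<subseteq> U"
      using W(2) M by (auto simp: T_def intro!: sym_intros)
    have "((\<lambda>s. A' + s *\<^sub>R M) has_derivative (\<lambda>s. s *\<^sub>R M)) (at t' within T)"
      by (auto intro!: derivative_eq_intros)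
    moreover have "(F has_derivative D) (at (A' + t' *\<^sub>R M) within (\<lambda>s. A' + s *\<^sub>R M) ` T)"
      using D im B by (auto intro: has_derivative_subset)
    ultimately have "((\<lambda>s. F (A' + s *\<^sub>R M)) has_derivative (\<lambda>s. D (s *\<^sub>R M))) (at t' within T)"
      by (rule has_derivative_in_compose)
    then show ?thesis
      using T at_within_open[of t' T] by (simp add: has_field_derivative_def D.scaleR mult_commute_abs)
  qed
  have "matrix_grad F B $ i $ j = D (sym_unit i j)" for i j
    using line[OF sym_unit_sym U_sym[OF \<open>B \<in> U\<close>], of 0 i j]
    by (simp add: matrix_grad_def DERIV_imp_deriv)
  then have "matrix_grad F B \<bullet> N = (\<Sum>i\<in>UNIV. \<Sum>j\<in>UNIV. N$i$j * D (sym_unit i j))"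
    by (simp add: inner_vec_def mult.commute)
  also have "\<dots> = D (\<Sum>i\<in>UNIV. \<Sum>j\<in>UNIV. N$i$j *\<^sub>R sym_unit i j)"
    by (simp add: D.sum D.scaleR)
  also have "\<dots> = D N" using sym_unit_expansion[OF N(2)] by simp
  finally show ?thesis using line[OF N(2,1) B_def] B_def by simp
qed

text \<open>The convexity hypothesis on \<open>U\<close> keeps the segment from \<open>A\<close> to \<open>B\<close> inside \<open>U\<close>; along it the derivative of \<open>F\<close>
  is the inner product of two positive definite matrices.\<close>

lemma F_strict_mono:
  assumes A: "A \<in> U" and B: "B \<in> U" and pd: "pos_def (B - A)"
  shows "F A < F B"
proof -
  define N where "N = B - A"
  have sym: "A \<in> sym_matrices" "N \<in> sym_matrices" using A B U_sym by (auto simp: N_def intro: sym_diff)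
  \<comment> \<open>The base point \<open>A - N\<close> puts \<open>A\<close> and \<open>B\<close> at the parameters 1 and 2, inside the open half-line.\<close>
  have conv: "convex (U \<inter> {(A - N) + t *\<^sub>R N | t. 0 < t})"
    using pd by (intro U_convex sym_intros sym) (simp add: N_def)
  have "A = (A - N) + 1 *\<^sub>R N" "B = (A - N) + 2 *\<^sub>R N" by (simp_all add: N_def scaleR_2)
  then have AB: "A \<in> U \<inter> {(A - N) + t *\<^sub>R N | t. 0 < t}" "B \<in> U \<inter> {(A - N) + t *\<^sub>R N | t. 0 < t}"
    using A B zero_less_one zero_less_numeral by blast+
  have seg: "A + t *\<^sub>R N \<in> U" if "0 \<le> t" "t \<le> 1" for t
  proof -
    have "(1 - t) *\<^sub>R A + t *\<^sub>R B \<in> U \<inter> {(A - N) + t *\<^sub>R N | t. 0 < t}"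
      using convexD_alt[OF conv AB that] .
    moreover have "(1 - t) *\<^sub>R A + t *\<^sub>R B = A + t *\<^sub>R N" by (simp add: N_def algebra_simps)
    ultimately show ?thesis by simp
  qed
  have "F (A + 0 *\<^sub>R N) < F (A + 1 *\<^sub>R N)"
  proof (rule DERIV_pos_imp_increasing[where f = "\<lambda>t. F (A + t *\<^sub>R N)"])
    fix t :: real assume t: "0 \<le> t" "t \<le> 1"
    show "\<exists>y. ((\<lambda>t. F (A + t *\<^sub>R N)) has_real_derivative y) (at t) \<and> 0 < y"
      using F_derivative_line[OF seg[OF t] sym] pos_def_inner_pos[OF F_elliptic[OF seg[OF t]] pd]
      by (auto simp: N_def)
  qed simp
  then show ?thesis by (simp add: N_def)
qed

text \<open>Continuity of the partial derivatives makes the differentiability of \<open>F\<close> locally uniform. The base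
  point, the direction and the step length vary together, because in the applications the contact
  point moves with the size of the perturbation.\<close>

lemma F_decreasing_along:
  assumes A0: "A0 \<in> U" and pos: "0 < matrix_grad F A0 \<bullet> E0"
    and A: "A \<longlonglongrightarrow> A0" "\<And>k. A k \<in> sym_matrices"
    and E: "E \<longlonglongrightarrow> E0" "\<And>k. E k \<in> sym_matrices"
    and e: "e \<longlonglongrightarrow> 0" "\<And>k. 0 < (e k :: real)"
  shows "\<forall>\<^sub>F k in sequentially. A k - e k *\<^sub>R E k \<in> U \<and> F (A k - e k *\<^sub>R E k) < F (A k)"
proof -
  have mg: "continuous_on U (matrix_grad F)" using F_C1 by (simp add: C1_on_sym_def)
  have "continuous_on (U \<times> (UNIV :: (real^'n^'n) set)) (\<lambda>p. matrix_grad F (fst p))"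
    by (rule continuous_on_compose2[OF mg continuous_on_fst[OF continuous_on_id]]) auto
  then have cont: "continuous_on (U \<times> UNIV) (\<lambda>p. matrix_grad F (fst p) \<bullet> snd p)"
    by (rule continuous_on_inner) (rule continuous_on_snd[OF continuous_on_id])
  have "(A0, E0) \<in> U \<times> UNIV" using A0 by simp
  from cont[unfolded continuous_on_iff, rule_format, OF this, of "matrix_grad F A0 \<bullet> E0"] pos
  obtain d where d: "0 < d" "\<And>p. p \<in> U \<times> UNIV \<Longrightarrow> dist p (A0, E0) < d \<Longrightarrow>
      dist (matrix_grad F (fst p) \<bullet> snd p) (matrix_grad F A0 \<bullet> E0) < matrix_grad F A0 \<bullet> E0"
    by auto
  obtain d' where d': "0 < d'" "\<And>X. X \<in> sym_matrices \<Longrightarrow> norm (X - A0) < d' \<Longrightarrow> X \<in> U"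
    using U_ball[OF A0] by blast
  have inn: "0 < matrix_grad F X \<bullet> Y" if "X \<in> U" "norm (X - A0) < d/2" "norm (Y - E0) < d/2" for X Y
  proof -
    have "dist (X, Y) (A0, E0) \<le> dist X A0 + dist Y E0"
      using dist_triangle[of "(X,Y)" "(A0,E0)" "(A0,Y)"] by (simp add: dist_Pair_Pair)
    also have "\<dots> < d" using that by (simp add: dist_norm)
    finally show ?thesis using d(2)[of "(X,Y)"] that(1) by (auto simp: dist_real_def)
  qed
  define m where "m = min (d/2) d' / 2"
  have m: "0 < m" using d d' by (simp add: m_def)
  have eE: "(\<lambda>k. e k *\<^sub>R E k) \<longlonglongrightarrow> 0"
    using tendsto_scaleR[OF e(1) E(1)] by simp
  have "\<forall>\<^sub>F k in sequentially. norm (A k - A0) < m"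
    "\<forall>\<^sub>F k in sequentially. norm (E k - E0) < d/2"
    "\<forall>\<^sub>F k in sequentially. norm (e k *\<^sub>R E k) < m"
    using tendstoD[OF A(1) m] tendstoD[OF E(1), of "d/2"] tendstoD[OF eE m] d(1)
    by (simp_all add: dist_norm)
  then show ?thesis
  proof eventually_elim
    case (elim k)
    have near: "norm (A k - t *\<^sub>R (e k *\<^sub>R E k) - A0) < 2 * m" if "0 \<le> t" "t \<le> 1" for t
    proof -
      have "norm (t *\<^sub>R (e k *\<^sub>R E k)) \<le> norm (e k *\<^sub>R E k)"
        unfolding norm_scaleR[of t] using that mult_right_mono[of t 1 "norm (e k *\<^sub>R E k)"] by (simp only: abs_of_nonneg mult_1 norm_ge_zero)
      moreover have "norm (A k - t *\<^sub>R (e k *\<^sub>R E k) - A0) \<le> norm (A k - A0) + norm (t *\<^sub>R (e k *\<^sub>R E k))"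
        unfolding cancel_ab_semigroup_add_class.diff_right_commute[of "A k" _ A0] by (rule norm_triangle_ineq4)
      ultimately show ?thesis using elim by linarith
    qed
    define N where "N = - (e k *\<^sub>R E k)"
    have symN: "N \<in> sym_matrices" 
      using sym_scaleR[OF E(2)[of k], of "- e k"] by (simp add: N_def)
    have seg: "A k + t *\<^sub>R N \<in> U" if "0 \<le> t" "t \<le> 1" for t
      using near[OF that] by (intro d'(2) sym_intros A symN) (auto simp: N_def m_def)
    have "F (A k + 1 *\<^sub>R N) < F (A k + 0 *\<^sub>R N)"
    proof (rule DERIV_neg_imp_decreasing[where f = "\<lambda>t. F (A k + t *\<^sub>R N)"])
      fix t :: real assume t: "0 \<le> t" "t \<le> 1"
      have "0 < matrix_grad F (A k + t *\<^sub>R N) \<bullet> E k"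
        using near[OF t] elim by (intro inn seg t) (auto simp: N_def m_def)
      then have "matrix_grad F (A k + t *\<^sub>R N) \<bullet> N < 0" using e(2)[of k] by (simp add: N_def)
      then show "\<exists>y. ((\<lambda>t. F (A k + t *\<^sub>R N)) has_real_derivative y) (at t) \<and> y < 0"
        using F_derivative_line[OF seg[OF t] A(2) symN] by blast
    qed simp
    then show ?case using seg[of 1] by (simp add: N_def)
  qed
qed

end

section \<open>Gradients and Hessians at contact points\<close>

text \<open>Gradient and Hessian are carried along as explicit functions, because for powers and
  Kelvin transforms they are given by closed formulas.\<close>

definition jet2 ::
  "(real^'n) set \<Rightarrow> (real^'n \<Rightarrow> real) \<Rightarrow> (real^'n \<Rightarrow> real^'n) \<Rightarrow> (real^'n \<Rightarrow> real^'n^'n) \<Rightarrow> bool" where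
  "jet2 \<Omega> f g H \<longleftrightarrow> open \<Omega> \<and> continuous_on \<Omega> H \<and>
    (\<forall>x\<in>\<Omega>. (f has_derivative (\<lambda>h. g x \<bullet> h)) (at x) \<and> (g has_derivative (\<lambda>h. H x *v h)) (at x))"

lemma jet2_subset: "jet2 \<Omega> f g H \<Longrightarrow> open \<Omega>' \<Longrightarrow> \<Omega>' \<subseteq> \<Omega> \<Longrightarrow> jet2 \<Omega>' f g H"
  unfolding jet2_def using continuous_on_subset by blast

lemma jet2_D:
  assumes "jet2 \<Omega> f g H"
  shows "open \<Omega>" "continuous_on \<Omega> H" "continuous_on \<Omega> f" "continuous_on \<Omega> g"
    "x \<in> \<Omega> \<Longrightarrow> (f has_derivative (\<lambda>h. g x \<bullet> h)) (at x)"
    "x \<in> \<Omega> \<Longrightarrow> (g has_derivative (\<lambda>h. H x *v h)) (at x)"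
proof -
  show *: "open \<Omega>" "continuous_on \<Omega> H"
    "\<And>x. x \<in> \<Omega> \<Longrightarrow> (f has_derivative (\<lambda>h. g x \<bullet> h)) (at x)"
    "\<And>x. x \<in> \<Omega> \<Longrightarrow> (g has_derivative (\<lambda>h. H x *v h)) (at x)"
    using assms by (simp_all add: jet2_def)
  show "continuous_on \<Omega> f" "continuous_on \<Omega> g"
    by (auto intro!: continuous_at_imp_continuous_on has_derivative_continuous dest: *(3,4))
qed

lemma derivative_along_line:
  assumes "(f has_derivative (\<lambda>h. g \<bullet> h)) (at (x + t *\<^sub>R v))"
  shows "((\<lambda>t. f (x + t *\<^sub>R v)) has_real_derivative g \<bullet> v) (at t)"
proof -
  have "((\<lambda>t. x + t *\<^sub>R v) has_derivative (\<lambda>s. s *\<^sub>R v)) (at t)"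
    by (auto intro!: derivative_eq_intros)
  from has_derivative_compose[OF this, of f "\<lambda>h. g \<bullet> h"] assms
  show ?thesis by (simp add: has_field_derivative_def mult_commute_abs)
qed

lemma second_derivative_along_line:
  fixes g :: "real^'n \<Rightarrow> real^'n"
  assumes "(g has_derivative (\<lambda>h. H *v h)) (at (x + t *\<^sub>R v))"
  shows "((\<lambda>t. g (x + t *\<^sub>R v) \<bullet> v) has_real_derivative v \<bullet> (H *v v)) (at t)"
proof -
  have "((\<lambda>t. x + t *\<^sub>R v) has_derivative (\<lambda>s. s *\<^sub>R v)) (at t)"
    by (auto intro!: derivative_eq_intros)
  from has_derivative_compose[OF this, of g "\<lambda>h. H *v h"] assms
  have "((\<lambda>t. g (x + t *\<^sub>R v)) has_derivative (\<lambda>s. H *v (s *\<^sub>R v))) (at t)" by simp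
  then have "((\<lambda>t. g (x + t *\<^sub>R v) \<bullet> v) has_derivative (\<lambda>s. (H *v (s *\<^sub>R v)) \<bullet> v)) (at t)"
    by (rule has_derivative_inner_left)
  then show ?thesis
    by (simp add: has_field_derivative_def mult_commute_abs matrix_vector_mult_scaleR inner_commute)
qed

lemma local_max_jet:
  fixes f :: "real^'n \<Rightarrow> real"
  assumes W: "open W" "x \<in> W"
    and f: "\<And>y. y \<in> W \<Longrightarrow> (f has_derivative (\<lambda>h. g y \<bullet> h)) (at y)"
    and g: "(g has_derivative (\<lambda>h. H *v h)) (at x)"
    and max: "\<And>y. y \<in> W \<Longrightarrow> f y \<le> f x"
  shows "g x = 0" "v \<bullet> (H *v v) \<le> 0"
proof -
  have "(\<lambda>h. g x \<bullet> h) = (\<lambda>h. 0)"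
    by (rule differential_zero_maxmin[OF W(2,1) f[OF W(2)]]) (use max in blast)
  then have "g x \<bullet> g x = 0" by meson
  then show g0: "g x = 0" by simp
  show "v \<bullet> (H *v v) \<le> 0"
  proof (rule ccontr)
    assume neg: "\<not> v \<bullet> (H *v v) \<le> 0"
    have "((\<lambda>t. g (x + t *\<^sub>R v) \<bullet> v) has_real_derivative v \<bullet> (H *v v)) (at 0)"
      by (rule second_derivative_along_line) (use g in simp)
    from DERIV_pos_inc_right[OF this] neg
    obtain d where d: "0 < d" "\<And>h. 0 < h \<Longrightarrow> h < d \<Longrightarrow> 0 < g (x + h *\<^sub>R v) \<bullet> v"
      by (auto simp: g0)
    have "open ((\<lambda>t. x + t *\<^sub>R v) -` W)"
      by (intro continuous_open_vimage W continuous_intros)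
    moreover have "0 \<in> (\<lambda>t. x + t *\<^sub>R v) -` W" using W by simp
    ultimately obtain e where e: "0 < e" "ball 0 e \<subseteq> (\<lambda>t. x + t *\<^sub>R v) -` W"
      by (meson open_contains_ball)
    define t where "t = min d e / 2"
    have t: "0 < t" "t < d" "t < e" using d(1) e(1) by (auto simp: t_def)
    have inW: "x + s *\<^sub>R v \<in> W" if "0 \<le> s" "s \<le> t" for s
    proof -
      have "s \<in> ball 0 e" using that t by (simp add: dist_real_def)
      with e show ?thesis by blast
    qed
    obtain s where s: "0 < s" "s < t" "f (x + t *\<^sub>R v) - f (x + 0 *\<^sub>R v) = (t - 0) * (g (x + s *\<^sub>R v) \<bullet> v)"
      using MVT2[of 0 t "\<lambda>t. f (x + t *\<^sub>R v)" "\<lambda>s. g (x + s *\<^sub>R v) \<bullet> v"] t(1)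
        derivative_along_line[OF f[OF inW]] by blast
    have "0 < g (x + s *\<^sub>R v) \<bullet> v" using d(2)[of s] s t by simp
    then have "0 < t * (g (x + s *\<^sub>R v) \<bullet> v)" using t by simp
    then have "f (x + t *\<^sub>R v) > f x" using s(3) by simp
    moreover have "f (x + t *\<^sub>R v) \<le> f x" using max inW[of t] t by simp
    ultimately show False by simp
  qed
qed

lemma quadratic_jet:
  fixes C :: "real^'n^'n"
  assumes "C \<in> sym_matrices"
  shows "((\<lambda>y. c \<bullet> (y - p) + 1/2 * ((y - p) \<bullet> (C *v (y - p)))) has_derivative
      (\<lambda>h. (c + C *v (y - p)) \<bullet> h)) (at y)"
    and "((\<lambda>y. c + C *v (y - p)) has_derivative (\<lambda>h. C *v h)) (at y)"
proof -
  have lin: "((\<lambda>y. C *v (y - p)) has_derivative (\<lambda>h. C *v h)) (at y)"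
    by (rule has_derivative_compose[where f = "\<lambda>y. y - p" and g = "\<lambda>z. C *v z" and f' = "\<lambda>h. h" and g' = "\<lambda>h. C *v h"])
       (auto intro!: derivative_eq_intros bounded_linear_imp_has_derivative matrix_vector_mul_bounded_linear)
  then show "((\<lambda>y. c + C *v (y - p)) has_derivative (\<lambda>h. C *v h)) (at y)"
    by (auto intro!: derivative_eq_intros)
  show "((\<lambda>y. c \<bullet> (y - p) + 1/2 * ((y - p) \<bullet> (C *v (y - p)))) has_derivative
      (\<lambda>h. (c + C *v (y - p)) \<bullet> h)) (at y)"
    by (rule derivative_eq_intros lin refl ext)+
       (simp add: inner_add_left inner_commute[of "C *v (y - p)"] sym_inner_swap[OF assms, of "y - p"])
qed

section \<open>Perturbed contact of two solutions\<close>

text \<open>The tensor of the introduction in terms of \<open>\<rho> = u powr (- 2 / (n - 2))\<close>, as a function of the value, the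
  gradient and the Hessian of \<open>\<rho>\<close>.\<close>

definition conf_op :: "real \<Rightarrow> real^'n \<Rightarrow> real^'n^'n \<Rightarrow> real^'n^'n" where
  "conf_op r g H = r *\<^sub>R H - (1/2 * (g \<bullet> g)) *\<^sub>R mat 1"

text \<open>The subtracted direction includes the term of second order in \<open>e\<close>. The identity is therefore exact,
  and positive definiteness of the difference can be read off for every \<open>e > 0\<close>.\<close>

lemma conf_op_perturbation:
  "conf_op s a M - e *\<^sub>R (t *\<^sub>R M + (s - e * t) *\<^sub>R C - (a \<bullet> b) *\<^sub>R mat 1
      + (e / 2 * (b \<bullet> b)) *\<^sub>R mat 1 - \<eta> *\<^sub>R mat 1) - conf_op (s - e * t) (a - e *\<^sub>R b) N
    = (s - e * t) *\<^sub>R (M - e *\<^sub>R C - N) + (e * \<eta>) *\<^sub>R mat 1"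
proof -
  have *: "(a - e *\<^sub>R b) \<bullet> (a - e *\<^sub>R b) = a \<bullet> a - 2 * e * (a \<bullet> b) + e * e * (b \<bullet> b)"
    by (simp add: inner_diff_left inner_diff_right inner_commute[of b a] algebra_simps)
  show ?thesis
    unfolding conf_op_def * vec_eq_iff vector_add_component vector_minus_component vector_scaleR_component
      real_scaleR_def
    by (auto simp: field_simps)
qed

text \<open>Away from \<open>p\<close> compactness keeps \<open>f\<close> below a negative constant, which a small multiple of \<open>h\<close> cannot
  compensate.\<close>

lemma approach_contact_point:
  fixes f :: "'a::metric_space \<Rightarrow> real"
  assumes K: "compact K" and f: "continuous_on (K - {p}) f" "\<And>y. y \<in> K \<Longrightarrow> y \<noteq> p \<Longrightarrow> f y < 0"
    and h: "\<And>k y. y \<in> K \<Longrightarrow> h k y \<le> B"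
    and e: "e \<longlonglongrightarrow> 0" "\<And>k. 0 < e k"
    and y: "\<And>k. y k \<in> K" "\<And>k. 0 \<le> f (y k) + e k * h k (y k)"
  shows "y \<longlonglongrightarrow> p"
proof (rule tendstoI)
  fix d :: real assume d: "0 < d"
  define K' where "K' = K - ball p d"
  have K': "compact K'" unfolding K'_def using K by (intro compact_diff) auto
  have sub: "K' \<subseteq> K - {p}" using d by (auto simp: K'_def)
  have "\<exists>\<mu>>0. \<forall>z\<in>K'. f z \<le> - \<mu>"
  proof (cases "K' = {}")
    case False
    obtain z where z: "z \<in> K'" "\<And>w. w \<in> K' \<Longrightarrow> f w \<le> f z"
      using continuous_attains_sup[OF K' False continuous_on_subset[OF f(1) sub]] by blast
    then have "0 < - f z" using f(2)[of z] sub by auto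
    then show ?thesis using z by (metis minus_minus)
  qed (auto intro: exI[of _ 1])
  then obtain \<mu> where \<mu>: "0 < \<mu>" "\<And>z. z \<in> K' \<Longrightarrow> f z \<le> - \<mu>" by blast
  have "(\<lambda>k. e k * B) \<longlonglongrightarrow> 0" using tendsto_mult_right[OF e(1), of B] by simp
  then have "\<forall>\<^sub>F k in sequentially. e k * B < \<mu>" using \<mu>(1) by (rule order_tendstoD)
  then show "\<forall>\<^sub>F k in sequentially. dist (y k) p < d"
  proof eventually_elim
    case (elim k)
    have "e k * h k (y k) \<le> e k * B" using e(2)[of k] h[OF y(1)] by simp
    then have "\<not> f (y k) \<le> - \<mu>" using y(2)[of k] elim by linarith
    then have "y k \<notin> K'" using \<mu>(2) by blast
    then show ?case using y(1)[of k] by (auto simp: K'_def dist_commute)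
  qed
qed

context conformal_equation
begin

text \<open>The condition on the trace says that \<open>\<rho> powr (- (n - 2) / 2)\<close> is superharmonic. In this form it is preserved by
  Kelvin transforms, which conjugate the tensor by a reflection.\<close>

definition solution ::
  "(real^'n) set \<Rightarrow> (real^'n \<Rightarrow> real) \<Rightarrow> (real^'n \<Rightarrow> real^'n) \<Rightarrow> (real^'n \<Rightarrow> real^'n^'n) \<Rightarrow> bool" where
  "solution \<Omega> \<rho> g H \<longleftrightarrow> jet2 \<Omega> \<rho> g H \<and>
    (\<forall>x\<in>\<Omega>. 0 < \<rho> x \<and> conf_op (\<rho> x) (g x) (H x) \<in> U \<and> F (conf_op (\<rho> x) (g x) (H x)) = 1 \<and>
      0 \<le> trace (conf_op (\<rho> x) (g x) (H x)))"

lemma solution_D: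
  assumes "solution \<Omega> \<rho> g H"
  shows "jet2 \<Omega> \<rho> g H" "x \<in> \<Omega> \<Longrightarrow> 0 < \<rho> x" "x \<in> \<Omega> \<Longrightarrow> conf_op (\<rho> x) (g x) (H x) \<in> U"
    "x \<in> \<Omega> \<Longrightarrow> F (conf_op (\<rho> x) (g x) (H x)) = 1"
    "x \<in> \<Omega> \<Longrightarrow> 0 \<le> trace (conf_op (\<rho> x) (g x) (H x))"
    "x \<in> \<Omega> \<Longrightarrow> H x \<in> sym_matrices"
    "x \<in> \<Omega> \<Longrightarrow> 0 \<le> trace (H x)"
proof -
  show *: "jet2 \<Omega> \<rho> g H" "x \<in> \<Omega> \<Longrightarrow> 0 < \<rho> x" "x \<in> \<Omega> \<Longrightarrow> conf_op (\<rho> x) (g x) (H x) \<in> U"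
    "x \<in> \<Omega> \<Longrightarrow> F (conf_op (\<rho> x) (g x) (H x)) = 1"
    "x \<in> \<Omega> \<Longrightarrow> 0 \<le> trace (conf_op (\<rho> x) (g x) (H x))"
    using assms by (auto simp: solution_def)
  have "H x = (1 / \<rho> x) *\<^sub>R (conf_op (\<rho> x) (g x) (H x) + (1/2 * (g x \<bullet> g x)) *\<^sub>R mat 1)" if "x \<in> \<Omega>"
    using *(2)[OF that] by (simp add: conf_op_def)
  then show "H x \<in> sym_matrices" if "x \<in> \<Omega>"
    using that U_sym[OF *(3)[OF that]] by (metis sym_add sym_scaleR sym_mat_1)
  show "0 \<le> trace (H x)" if x: "x \<in> \<Omega>"
  proof -
    have "trace (conf_op (\<rho> x) (g x) (H x)) = \<rho> x * trace (H x) - 1/2 * (g x \<bullet> g x) * CARD('n)"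
      by (simp add: conf_op_def trace_def mat_def sum_subtractf sum_distrib_left)
    then have "0 \<le> \<rho> x * trace (H x)"
      using *(5)[OF x] by (smt (verit) inner_ge_zero mult_nonneg_nonneg of_nat_0_le_iff divide_nonneg_nonneg)
    then show ?thesis using *(2)[OF x] by (simp add: zero_le_mult_iff)
  qed
qed

lemma solution_subset: "solution \<Omega> \<rho> g H \<Longrightarrow> open \<Omega>' \<Longrightarrow> \<Omega>' \<subseteq> \<Omega> \<Longrightarrow> solution \<Omega>' \<rho> g H"
  unfolding solution_def using jet2_subset by blast

text \<open>At \<open>y k\<close> the function \<open>\<rho>\<close> has the value and the gradient of \<open>\<sigma>\<close> up to \<open>e k\<close> times \<open>t k\<close> and \<open>b k\<close>, and its Hessian
  is at most that of \<open>\<sigma>\<close> minus \<open>e k\<close> times \<open>C\<close>. So the tensor of \<open>\<rho>\<close> lies strictly below a matrix obtained from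
  the tensor of \<open>\<sigma>\<close> by a step in a direction along which \<open>F\<close> decreases to first order.\<close>

lemma touching_contradiction:
  assumes s: "solution \<Omega> \<sigma> gs Hs" "p \<in> \<Omega>" and r: "solution \<Omega>' \<rho> gr Hr"
    and y: "y \<longlonglongrightarrow> p" "\<And>k. y k \<in> \<Omega>" "\<And>k. y k \<in> \<Omega>'"
    and e: "e \<longlonglongrightarrow> 0" "\<And>k. 0 < e k"
    and val: "\<And>k. \<rho> (y k) = \<sigma> (y k) - e k * t k" "t \<longlonglongrightarrow> 0"
    and grad: "\<And>k. gr (y k) = gs (y k) - e k *\<^sub>R b k" "b \<longlonglongrightarrow> b0"
    and hess: "\<And>k v. v \<bullet> (Hr (y k) *v v) \<le> v \<bullet> ((Hs (y k) - e k *\<^sub>R C) *v v)" "C \<in> sym_matrices"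
    and pos: "0 < matrix_grad F (conf_op (\<sigma> p) (gs p) (Hs p)) \<bullet> (\<sigma> p *\<^sub>R C - (gs p \<bullet> b0) *\<^sub>R mat 1)"
  shows False
proof -
  note js = jet2_D[OF solution_D(1)[OF s(1)]]
  define A0 where "A0 = conf_op (\<sigma> p) (gs p) (Hs p)"
  define G where "G = matrix_grad F A0"
  define E0 where "E0 = \<sigma> p *\<^sub>R C - (gs p \<bullet> b0) *\<^sub>R mat 1"
  \<comment> \<open>Subtracting \<open>\<eta> I\<close> keeps the first variation positive and makes the order relation of the tensors strict.\<close>
  define \<eta> where "\<eta> = (G \<bullet> E0) / (2 * (\<bar>trace G\<bar> + 1))"
  have GE: "0 < G \<bullet> E0" using pos by (simp add: G_def E0_def A0_def)
  then have \<eta>: "0 < \<eta>" by (simp add: \<eta>_def add_nonneg_pos)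
  have "\<eta> * trace G \<le> \<eta> * (\<bar>trace G\<bar> + 1)" using \<eta> by (intro mult_left_mono) auto
  also have "\<dots> = (G \<bullet> E0) / 2"
    unfolding \<eta>_def by (simp add: field_simps add_nonneg_pos)
  finally have pos': "0 < G \<bullet> (E0 - \<eta> *\<^sub>R mat 1)"
    using GE by (simp add: inner_diff_right inner_mat_1)
  have isC: "isCont \<sigma> p" "isCont gs p" "isCont Hs p"
    using js(1-4) s(2) continuous_on_eq_continuous_at by blast+
  have lim: "(\<lambda>k. \<sigma> (y k)) \<longlonglongrightarrow> \<sigma> p" "(\<lambda>k. gs (y k)) \<longlonglongrightarrow> gs p" "(\<lambda>k. Hs (y k)) \<longlonglongrightarrow> Hs p"
    using isC y(1) by (auto intro: isCont_tendsto_compose)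
  define A where "A k = conf_op (\<sigma> (y k)) (gs (y k)) (Hs (y k))" for k
  define E where "E k = t k *\<^sub>R Hs (y k) + \<rho> (y k) *\<^sub>R C - (gs (y k) \<bullet> b k) *\<^sub>R mat 1
     + (e k / 2 * (b k \<bullet> b k)) *\<^sub>R mat 1 - \<eta> *\<^sub>R mat 1" for k
  have Alim: "A \<longlonglongrightarrow> A0"
    unfolding A_def A0_def conf_op_def by (intro tendsto_intros lim)
  have "(\<lambda>k. \<rho> (y k)) \<longlonglongrightarrow> \<sigma> p - 0 * 0"
    unfolding val(1) by (intro tendsto_intros lim e val)
  then have "E \<longlonglongrightarrow> 0 *\<^sub>R Hs p + \<sigma> p *\<^sub>R C - (gs p \<bullet> b0) *\<^sub>R mat 1
     + (0 / 2 * (b0 \<bullet> b0)) *\<^sub>R mat 1 - \<eta> *\<^sub>R mat 1"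
    unfolding E_def by (intro tendsto_intros lim e val grad) auto
  then have Elim: "E \<longlonglongrightarrow> E0 - \<eta> *\<^sub>R mat 1" by (simp add: E0_def)
  have A_sym: "A k \<in> sym_matrices" for k
    unfolding A_def using solution_D(3)[OF s(1) y(2)] U_sym by blast
  have E_sym: "E k \<in> sym_matrices" for k
    unfolding E_def by (intro sym_intros solution_D(6)[OF s(1)] y hess)
  have "\<forall>\<^sub>F k in sequentially. A k - e k *\<^sub>R E k \<in> U \<and> F (A k - e k *\<^sub>R E k) < F (A k)"
    using solution_D(3)[OF s] pos' 
    by (intro F_decreasing_along[OF _ _ Alim A_sym Elim E_sym e]) (simp_all add: A0_def G_def)
  then obtain k where k: "A k - e k *\<^sub>R E k \<in> U" "F (A k - e k *\<^sub>R E k) < F (A k)"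
    using eventually_happens'[OF sequentially_bot] by blast
  define R where "R = conf_op (\<rho> (y k)) (gr (y k)) (Hr (y k))"
  have R: "R \<in> U" "F R = 1" unfolding R_def using solution_D(3,4)[OF r] y(3) by auto
  have diff: "A k - e k *\<^sub>R E k - R = \<rho> (y k) *\<^sub>R (Hs (y k) - e k *\<^sub>R C - Hr (y k)) + (e k * \<eta>) *\<^sub>R mat 1"
    unfolding A_def E_def R_def grad(1) val(1) by (rule conf_op_perturbation)
  have "pos_def (A k - e k *\<^sub>R E k - R)"
    unfolding pos_def_def
  proof (intro conjI allI impI)
    show "A k - e k *\<^sub>R E k - R \<in> sym_matrices"
      by (rule sym_diff[OF U_sym[OF k(1)] U_sym[OF R(1)]])
    fix v :: "real^'n" assume v: "v \<noteq> 0"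
    have "v \<bullet> ((A k - e k *\<^sub>R E k - R) *v v) =
       \<rho> (y k) * (v \<bullet> ((Hs (y k) - e k *\<^sub>R C) *v v) - v \<bullet> (Hr (y k) *v v)) + e k * \<eta> * (v \<bullet> v)"
      unfolding diff by (simp add: quad_simps)
    moreover have "0 \<le> \<rho> (y k) * (v \<bullet> ((Hs (y k) - e k *\<^sub>R C) *v v) - v \<bullet> (Hr (y k) *v v))"
      using hess(1)[of v k] solution_D(2)[OF r y(3), of k] by simp
    moreover have "0 < e k * \<eta> * (v \<bullet> v)" using e(2) \<eta> v by simp
    ultimately show "0 < v \<bullet> ((A k - e k *\<^sub>R E k - R) *v v)" by linarith
  qed
  from F_strict_mono[OF R(1) k(1) this] have "1 < F (A k - e k *\<^sub>R E k)" using R(2) by simp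
  moreover have "F (A k) = 1" unfolding A_def using solution_D(4)[OF s(1) y(2)] .
  ultimately show False using k(2) by simp
qed

text \<open>The quadratic functions \<open>h k\<close> have the fixed Hessian \<open>C\<close>, but their gradients at \<open>p\<close> may vary: at an isolated singularity
  the direction of the perturbation is not known in advance. Since \<open>h k\<close> vanishes at \<open>p\<close>, the difference
  \<open>\<sigma> - \<rho>\<close> at the maximum points is of smaller order than \<open>e k\<close>.\<close>

lemma perturbed_contact_contradiction:
  assumes s: "solution \<Omega> \<sigma> gs Hs" "p \<in> \<Omega>" and r: "solution \<Omega>' \<rho> gr Hr"
    and W: "open W" "W \<subseteq> \<Omega>" "W \<subseteq> \<Omega>'"
    and y: "y \<longlonglongrightarrow> p" "\<And>k. y k \<in> W"
    and e: "e \<longlonglongrightarrow> 0" "\<And>k. 0 < e k"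
    and c: "c \<longlonglongrightarrow> c0" and C: "C \<in> sym_matrices"
    and h: "\<And>k z. h k z = c k \<bullet> (z - p) + 1/2 * ((z - p) \<bullet> (C *v (z - p)))"
    and max: "\<And>k z. z \<in> W \<Longrightarrow> \<rho> z - \<sigma> z + e k * h k z \<le> \<rho> (y k) - \<sigma> (y k) + e k * h k (y k)"
    and le: "\<And>k. \<rho> (y k) \<le> \<sigma> (y k)" "\<And>k. 0 \<le> \<rho> (y k) - \<sigma> (y k) + e k * h k (y k)"
    and pos: "0 < matrix_grad F (conf_op (\<sigma> p) (gs p) (Hs p)) \<bullet> (\<sigma> p *\<^sub>R C - (gs p \<bullet> c0) *\<^sub>R mat 1)"
  shows False
proof -
  note js = jet2_D[OF solution_D(1)[OF s(1)]] and jr = jet2_D[OF solution_D(1)[OF r]]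
  define b where "b k = c k + C *v (y k - p)" for k
  have C_bl: "bounded_linear ((*v) C)" by (rule matrix_vector_mul_bounded_linear)
  have lim0: "(\<lambda>k. C *v (y k - p)) \<longlonglongrightarrow> C *v (p - p)"
    by (intro bounded_linear.tendsto[OF C_bl] tendsto_intros y)
  have blim: "b \<longlonglongrightarrow> c0"
    unfolding b_def using tendsto_add[OF c lim0] by simp
  have "(\<lambda>k. h k (y k)) \<longlonglongrightarrow> c0 \<bullet> (p - p) + 1/2 * ((p - p) \<bullet> (C *v (p - p)))"
    unfolding h by (intro tendsto_intros c lim0 y)
  then have hlim: "(\<lambda>k. h k (y k)) \<longlonglongrightarrow> 0" by simp
  define t where "t k = (\<sigma> (y k) - \<rho> (y k)) / e k" for k
  have t: "0 \<le> t k" "t k \<le> h k (y k)" for k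
    using le[of k] e(2)[of k] by (auto simp: t_def field_simps)
  have tlim: "t \<longlonglongrightarrow> 0"
    by (rule tendsto_sandwich[OF _ _ tendsto_const hlim]) (use t in auto)
  have crit: "gr (y k) - gs (y k) + e k *\<^sub>R b k = 0 \<and>
      (\<forall>v. v \<bullet> ((Hr (y k) - Hs (y k) + e k *\<^sub>R C) *v v) \<le> 0)" for k
  proof -
    have 1: "((\<lambda>z. \<rho> z - \<sigma> z + e k * h k z) has_derivative
       (\<lambda>v. (gr z - gs z + e k *\<^sub>R (c k + C *v (z - p))) \<bullet> v)) (at z)" if "z \<in> W" for z
    proof -
      have "((\<lambda>z. \<rho> z - \<sigma> z + e k * h k z) has_derivative
         (\<lambda>v. gr z \<bullet> v - gs z \<bullet> v + e k * ((c k + C *v (z - p)) \<bullet> v))) (at z)"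
        unfolding h using W that
        by (intro has_derivative_add has_derivative_diff has_derivative_mult_right jr(5) js(5) quadratic_jet(1)[OF C]) auto
      then show ?thesis by (simp add: inner_add_left inner_diff_left)
    qed
    have 2: "((\<lambda>z. gr z - gs z + e k *\<^sub>R (c k + C *v (z - p))) has_derivative
       (\<lambda>v. (Hr (y k) - Hs (y k) + e k *\<^sub>R C) *v v)) (at (y k))"
    proof -
      have "((\<lambda>z. gr z - gs z + e k *\<^sub>R (c k + C *v (z - p))) has_derivative
         (\<lambda>v. Hr (y k) *v v - Hs (y k) *v v + e k *\<^sub>R (C *v v))) (at (y k))"
        using W y(2)[of k] by (intro has_derivative_add has_derivative_diff has_derivative_scaleR_right jr(6) js(6) quadratic_jet(2)[OF C]) auto
      then show ?thesis by (simp add: quad_simps)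
    qed
    from local_max_jet[OF W(1) y(2)[of k] 1 2 max] show ?thesis by (simp add: b_def)
  qed
  show False
  proof (rule touching_contradiction[OF s r y(1) _ _ e _ tlim _ blim _ C pos])
    fix k
    show "y k \<in> \<Omega>" "y k \<in> \<Omega>'" using y(2) W by auto
    show "\<rho> (y k) = \<sigma> (y k) - e k * t k" using e(2)[of k] by (simp add: t_def)
    show "gr (y k) = gs (y k) - e k *\<^sub>R b k" using crit[of k] by (simp add: algebra_simps)
    fix v
    show "v \<bullet> (Hr (y k) *v v) \<le> v \<bullet> ((Hs (y k) - e k *\<^sub>R C) *v v)"
      using crit[of k] by (auto simp: quad_simps dest: spec[of _ v])
  qed
qed

end

section \<open>Subharmonic functions near an isolated singularity\<close>

lemma tendsto_inverse_Suc: "(\<lambda>k. 1 / real (Suc k)) \<longlonglongrightarrow> 0"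
  using LIMSEQ_inverse_real_of_nat by (simp add: inverse_eq_divide)

lemma trace_eq_sum_axis: "trace (M::real^'n^'n) = (\<Sum>i\<in>UNIV. axis i 1 \<bullet> (M *v axis i 1))"
  by (simp add: trace_def inner_axis' matrix_vector_mult_basis column_def)

lemma trace_mat_1: "trace (mat 1 :: real^'n^'n) = real CARD('n)"
  by (simp add: trace_def mat_def)

lemma trace_scaleR: "trace (c *\<^sub>R (A::real^'n^'n)) = c * trace A"
  by (simp add: trace_def sum_distrib_left)

lemma pos_def_trace_pos:
  assumes "pos_def (G::real^'n^'n)" shows "0 < trace G"
proof -
  have "pos_def (mat 1 :: real^'n^'n)" by (simp add: pos_def_def sym_mat_1)
  from pos_def_inner_pos[OF assms this] show ?thesis by (simp add: inner_mat_1)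
qed

text \<open>The sign of the Laplacian is that of \<open>q (n + 2 (q - 1))\<close>: the power \<open>2 - n\<close> of the distance is harmonic, negative powers
  above it are strictly superharmonic, those below it strictly subharmonic.\<close>

lemma radial_power_jet:
  fixes p y :: "real^'n" and q :: real
  assumes "y \<noteq> p"
  defines "s \<equiv> \<lambda>y. (y - p) \<bullet> (y - p)"
  defines "g \<equiv> \<lambda>y. (2 * q * s y powr (q - 1)) *\<^sub>R (y - p)"
  defines "H \<equiv> \<lambda>y. (2 * q * s y powr (q - 1)) *\<^sub>R mat 1 + (4 * q * (q - 1) * s y powr (q - 2)) *\<^sub>R outer (y - p) (y - p)"
  shows "((\<lambda>y. s y powr q) has_derivative (\<lambda>h. g y \<bullet> h)) (at y)"
    and "(g has_derivative (\<lambda>h. H y *v h)) (at y)"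
    and "trace (H y) = 2 * q * s y powr (q - 1) * (CARD('n) + 2 * (q - 1))"
proof -
  have pos: "0 < s y" using assms(1) by (simp add: s_def)
  have s: "(s has_derivative (\<lambda>h. 2 * ((y - p) \<bullet> h))) (at y)"
    unfolding s_def by (auto intro!: derivative_eq_intros simp: inner_commute)
  have pw: "((\<lambda>y. s y powr a) has_derivative (\<lambda>h. a * s y powr (a - 1) * (2 * ((y - p) \<bullet> h)))) (at y)" for a
  proof -
    have "((\<lambda>t. t powr a) has_real_derivative a * s y powr (a - 1)) (at (s y))"
      using has_real_derivative_powr[OF pos] .
    then have "((\<lambda>t. t powr a) has_derivative (\<lambda>h. a * s y powr (a - 1) * h)) (at (s y))"
      by (simp add: has_field_derivative_def)
    from has_derivative_compose[OF s this] show ?thesis .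
  qed
  show "((\<lambda>y. s y powr q) has_derivative (\<lambda>h. g y \<bullet> h)) (at y)"
    using pw[of q] by (simp add: g_def mult_ac)
  have g': "(g has_derivative (\<lambda>h. (2 * q * s y powr (q - 1)) *\<^sub>R h +
     (2 * q * ((q - 1) * s y powr (q - 1 - 1) * (2 * ((y - p) \<bullet> h)))) *\<^sub>R (y - p))) (at y)"
    unfolding g_def
    by (rule derivative_eq_intros pw refl ext)+ simp
  show "(g has_derivative (\<lambda>h. H y *v h)) (at y)"
  proof -
    have "(2 * q * s y powr (q - 1)) *\<^sub>R h + (2 * q * ((q - 1) * s y powr (q - 1 - 1) * (2 * ((y - p) \<bullet> h)))) *\<^sub>R (y - p)
        = H y *v h" for h
      by (simp add: H_def matrix_vector_mult_add_rdistrib scaleR_mult_vec outer_mult_vec algebra_simps)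
    with g' show ?thesis by simp
  qed
  have "trace (outer (y - p) (y - p)) = s y"
    by (simp add: trace_def outer_def s_def inner_vec_def)
  then have "trace (H y) = 2 * q * s y powr (q - 1) * CARD('n) + 4 * q * (q - 1) * (s y powr (q - 2) * s y)"
    by (simp add: H_def trace_def sum.distrib mat_def flip: sum_distrib_left)
  also have "s y powr (q - 2) * s y = s y powr (q - 1)"
    using pos powr_add[of "s y" "q - 2" 1] by simp
  finally show "trace (H y) = 2 * q * s y powr (q - 1) * (CARD('n) + 2 * (q - 1))"
    by (simp add: algebra_simps)
qed

text \<open>For \<open>n \<ge> 3\<close> the function \<open>\<Gamma> = |y - p| powr (- 1/2)\<close> is strictly superharmonic and infinite at \<open>p\<close>. So \<open>f - e \<Gamma>\<close>
  has no interior maximum and is very negative near \<open>p\<close>, where \<open>f\<close> is bounded above; its maximum lies on the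
  outer sphere.\<close>

lemma removable_subharmonic_bound:
  fixes f :: "real^'n \<Rightarrow> real"
  assumes n: "CARD('n) \<ge> 3" and j: "jet2 \<Omega> f g H" and s: "0 < s" "cball p s - {p} \<subseteq> \<Omega>"
    and tr: "\<And>y. y \<in> cball p s - {p} \<Longrightarrow> 0 \<le> trace (H y)"
    and B: "\<And>y. y \<in> cball p s - {p} \<Longrightarrow> f y \<le> B"
    and m: "\<And>y. norm (y - p) = s \<Longrightarrow> f y \<le> m"
    and y0: "y0 \<in> cball p s - {p}"
  shows "f y0 \<le> m"
proof (rule ccontr)
  assume neg: "\<not> f y0 \<le> m"
  define q :: real where "q = - 1/4"
  define S where "S y = (y - p) \<bullet> (y - p)" for y
  define Gam where "Gam y = S y powr q" for y
  have Gpos: "0 < Gam y" if "y \<noteq> p" for y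
    using that by (simp add: Gam_def S_def)
  define e where "e = (f y0 - m) / (2 * Gam y0)"
  have e: "0 < e" using neg Gpos[of y0] y0 by (simp add: e_def)
  have v0: "f y0 - e * Gam y0 > m"
  proof -
    have "e * Gam y0 = (f y0 - m) / 2" using Gpos[of y0] y0 by (simp add: e_def)
    then show ?thesis using neg by (simp add: field_simps)
  qed
  \<comment> \<open>\<open>b\<close> is the squared distance below which the barrier alone brings \<open>f - e \<Gamma>\<close> under \<open>m\<close>.\<close>
  define X where "X = (\<bar>B\<bar> + \<bar>m\<bar> + 1) / e"
  have X: "0 < X" using e by (simp add: X_def add_nonneg_pos)
  define b where "b = X powr (- 4)"
  have large: "t powr q > (\<bar>B\<bar> + \<bar>m\<bar> + 1) / e" if "0 < t" "t < b" for t
  proof -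
    have "b powr q = X" using X by (simp add: b_def q_def powr_powr)
    moreover have "b powr q < t powr q" using that by (intro powr_less_mono2_neg) (auto simp: q_def)
    ultimately show ?thesis by (simp add: X_def)
  qed
  have b: "0 < b" using X by (simp add: b_def)
  have inner: "f y - e * Gam y < m" if "y \<in> cball p s - {p}" "S y < b" for y
  proof -
    have "0 < S y" using that by (simp add: S_def)
    then have "(\<bar>B\<bar> + \<bar>m\<bar> + 1) / e < Gam y" using large that by (simp add: Gam_def)
    then have "\<bar>B\<bar> + \<bar>m\<bar> + 1 < e * Gam y" using e by (simp add: field_simps)
    with B[OF that(1)] show ?thesis by linarith
  qed
  define K where "K = cball p s \<inter> {y. b \<le> S y}"
  have contS: "continuous_on UNIV S" unfolding S_def by (intro continuous_intros)
  have "compact K" unfolding K_def S_def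
    by (intro compact_Int_closed compact_cball closed_Collect_le continuous_intros)
  have Ksub: "K \<subseteq> cball p s - {p}" using b by (auto simp: K_def S_def)
  have y0K: "y0 \<in> K" using inner[OF y0] v0 y0 by (force simp: K_def)
  have contG: "continuous_on (- {p}) Gam"
    unfolding Gam_def
    by (intro continuous_on_powr continuous_on_subset[OF contS] continuous_intros) (auto simp: S_def)
  have "continuous_on K (\<lambda>y. f y - e * Gam y)"
    using Ksub s(2) by (intro continuous_intros continuous_on_subset[OF contG] continuous_on_subset[OF jet2_D(3)[OF j]]) auto
  then obtain y1 where y1: "y1 \<in> K" "\<And>y. y \<in> K \<Longrightarrow> f y - e * Gam y \<le> f y1 - e * Gam y1"
    using continuous_attains_sup[OF \<open>compact K\<close>] y0K by blast
  have y1': "y1 \<in> cball p s - {p}" using y1 Ksub by auto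
  have big: "m < f y1 - e * Gam y1" using y1(2)[OF y0K] v0 by linarith
  have all: "f y - e * Gam y \<le> f y1 - e * Gam y1" if "y \<in> cball p s - {p}" for y
  proof (cases "S y < b")
    case True then show ?thesis using inner[OF that] big by linarith
  next
    case False then show ?thesis using y1(2)[of y] that by (auto simp: K_def)
  qed
  have "norm (y1 - p) \<noteq> s"
  proof
    assume "norm (y1 - p) = s"
    from m[OF this] big Gpos[of y1] e y1' show False by (smt (verit) DiffD2 mult_pos_pos singletonI)
  qed
  then have y1b: "y1 \<in> ball p s - {p}" using y1' by (auto simp: dist_norm norm_minus_commute)
  define HG where "HG = (2 * q * S y1 powr (q - 1)) *\<^sub>R mat 1 + (4 * q * (q - 1) * S y1 powr (q - 2)) *\<^sub>R outer (y1 - p) (y1 - p)"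
  have "v \<bullet> ((H y1 - e *\<^sub>R HG) *v v) \<le> 0" for v
  proof (rule local_max_jet(2)[of "ball p s - {p}" y1 "\<lambda>y. f y - e * Gam y" "\<lambda>y. g y - e *\<^sub>R ((2 * q * S y powr (q - 1)) *\<^sub>R (y - p))"])
    show "open (ball p s - {p})" by (intro open_Diff) auto
    show "y1 \<in> ball p s - {p}" by (rule y1b)
    fix y assume y: "y \<in> ball p s - {p}"
    then have "y \<in> cball p s - {p}" by auto
    then show "f y - e * Gam y \<le> f y1 - e * Gam y1" by (rule all)
    have "((\<lambda>y. f y - e * Gam y) has_derivative (\<lambda>h. g y \<bullet> h - e * (((2 * q * S y powr (q - 1)) *\<^sub>R (y - p)) \<bullet> h))) (at y)"
      unfolding Gam_def S_def using y s(2)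
      by (intro has_derivative_diff has_derivative_mult_right radial_power_jet(1) jet2_D(5)[OF j]) auto
    then show "((\<lambda>y. f y - e * Gam y) has_derivative (\<lambda>h. (g y - e *\<^sub>R ((2 * q * S y powr (q - 1)) *\<^sub>R (y - p))) \<bullet> h)) (at y)"
      by (simp only: inner_diff_left inner_scaleR_left)
  next
    have "((\<lambda>y. g y - e *\<^sub>R ((2 * q * S y powr (q - 1)) *\<^sub>R (y - p))) has_derivative (\<lambda>h. H y1 *v h - e *\<^sub>R (HG *v h))) (at y1)"
      unfolding HG_def S_def using y1' s(2)
      by (intro has_derivative_diff has_derivative_scaleR_right radial_power_jet(2) jet2_D(6)[OF j]) auto
    then show "((\<lambda>y. g y - e *\<^sub>R ((2 * q * S y powr (q - 1)) *\<^sub>R (y - p))) has_derivative (\<lambda>h. (H y1 - e *\<^sub>R HG) *v h)) (at y1)"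
      by (simp add: quad_simps)
  qed
  then have "trace (H y1 - e *\<^sub>R HG) \<le> 0"
    unfolding trace_eq_sum_axis by (intro sum_nonpos)
  moreover have "trace (H y1 - e *\<^sub>R HG) = trace (H y1) - e * trace HG"
    by (simp add: trace_def sum_subtractf sum_distrib_left)
  moreover have "trace HG < 0"
  proof -
    have "trace HG = 2 * q * S y1 powr (q - 1) * (CARD('n) + 2 * (q - 1))"
      unfolding HG_def S_def by (rule radial_power_jet(3)) (use y1' in auto)
    moreover have "0 < S y1 powr (q - 1)" using y1' by (simp add: S_def)
    moreover have "0 < CARD('n) + 2 * (q - 1)" using n by (simp add: q_def)
    ultimately show ?thesis by (simp add: q_def mult_neg_pos)
  qed
  ultimately show False using tr[OF y1'] e by (smt (verit) mult_pos_neg)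
qed

context conformal_equation
begin

section \<open>Comparison principles for two solutions\<close>

text \<open>Put \<open>\<nu> = (p - z) / R\<close> and \<open>w = y - p\<close>. The barrier is \<open>h = - (\<nu> \<bullet> w) + \<beta> (\<nu> \<bullet> w)\<^sup>2 - \<gamma> |w|\<^sup>2\<close>. On the sphere \<open>|y - z| = R\<close> one has
  \<open>\<nu> \<bullet> w = - |w|\<^sup>2 / (2 R)\<close>, so that \<open>h \<le> 0\<close> there near \<open>p\<close>, and a large \<open>\<beta>\<close> makes the first variation of \<open>F\<close> positive
  because the form of the gradient of \<open>F\<close> is positive at \<open>\<nu>\<close>. Therefore \<open>\<rho> \<le> \<sigma> - e h\<close> in the ball for some
  \<open>e > 0\<close>, and the linear term of \<open>h\<close> gives the strict sign of the derivative at \<open>p\<close>.\<close>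

lemma hopf_boundary:
  assumes s: "solution \<Omega> \<sigma> gs Hs" and r: "solution \<Omega> \<rho> gr Hr"
    and R: "0 < R" "cball z R \<subseteq> \<Omega>" "norm (p - z) = R"
    and contact: "\<rho> p = \<sigma> p" and below: "\<And>y. y \<in> cball z R \<Longrightarrow> y \<noteq> p \<Longrightarrow> \<rho> y < \<sigma> y"
  shows "0 < (gs p - gr p) \<bullet> (z - p)"
proof -
  note js = jet2_D[OF solution_D(1)[OF s]] and jr = jet2_D[OF solution_D(1)[OF r]]
  have pK: "p \<in> cball z R" using R(3) by (simp add: dist_norm norm_minus_commute)
  then have p\<Omega>: "p \<in> \<Omega>" using R(2) by auto
  define G where "G = matrix_grad F (conf_op (\<sigma> p) (gs p) (Hs p))"
  have G: "pos_def G" unfolding G_def using F_elliptic solution_D(3)[OF s p\<Omega>] by blast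
  define \<nu> where "\<nu> = (1 / R) *\<^sub>R (p - z)"
  have \<nu>1: "norm \<nu> = 1" using R by (simp add: \<nu>_def)
  have pz: "p - z = R *\<^sub>R \<nu>" using R by (simp add: \<nu>_def)
  define a where "a = \<nu> \<bullet> (G *v \<nu>)"
  have "\<nu> \<noteq> 0" using \<nu>1 by force
  then have a: "0 < a" using G by (auto simp: a_def pos_def_def)
  have sp: "0 < \<sigma> p" using solution_D(2)[OF s p\<Omega>] .
  define \<gamma> where "\<gamma> = 1 / (2 * R) + 1"
  define X where "X = \<bar>2 * \<gamma> * \<sigma> p * trace G - (gs p \<bullet> \<nu>) * trace G\<bar> + 1"
  \<comment> \<open>With this \<open>\<beta>\<close> the term \<open>2 \<beta> \<sigma>(p) a\<close> exceeds all other terms of the first variation of \<open>F\<close>.\<close>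
  define \<beta> where "\<beta> = X / (2 * \<sigma> p * a)"
  have \<beta>: "0 < \<beta>" using sp a by (simp add: \<beta>_def X_def add_nonneg_pos)
  define C where "C = (2 * \<beta>) *\<^sub>R outer \<nu> \<nu> - (2 * \<gamma>) *\<^sub>R mat 1"
  have C: "C \<in> sym_matrices" unfolding C_def by (intro sym_intros)
  define h where "h y = (- \<nu>) \<bullet> (y - p) + 1/2 * ((y - p) \<bullet> (C *v (y - p)))" for y
  have h_eq: "h y = - (\<nu> \<bullet> (y - p)) + \<beta> * (\<nu> \<bullet> (y - p))^2 - \<gamma> * (norm (y - p))^2" for y
  proof -
    have "(- \<nu>) \<bullet> w + 1/2 * (w \<bullet> (C *v w)) = - (\<nu> \<bullet> w) + \<beta> * (\<nu> \<bullet> w)^2 - \<gamma> * (norm w)^2" for w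
      by (simp add: C_def quad_simps dot_square_norm power2_eq_square inner_commute[of _ \<nu>] algebra_simps)
    then show ?thesis by (simp only: h_def)
  qed
  have pos: "0 < G \<bullet> (\<sigma> p *\<^sub>R C - (gs p \<bullet> (- \<nu>)) *\<^sub>R mat 1)"
  proof -
    have "G \<bullet> (\<sigma> p *\<^sub>R C - (gs p \<bullet> (- \<nu>)) *\<^sub>R mat 1) = 2 * \<sigma> p * a * \<beta> - (2 * \<gamma> * \<sigma> p * trace G - (gs p \<bullet> \<nu>) * trace G)"
      by (simp add: C_def inner_diff_right inner_add_right inner_mat_1 inner_outer a_def algebra_simps)
    also have "2 * \<sigma> p * a * \<beta> = X" using sp a by (simp add: \<beta>_def)
    finally show ?thesis by (simp add: X_def)
  qed
  have boundary: "h y \<le> 0" if y: "norm (y - z) = R" "norm (y - p) \<le> 2 * R / sqrt \<beta>" for y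
  proof -
    define w where "w = y - p"
    have yz: "y - z = w + R *\<^sub>R \<nu>" using pz by (simp add: w_def algebra_simps)
    have "(norm (y - z))^2 = (norm w)^2 + 2 * R * (\<nu> \<bullet> w) + R^2"
    proof -
      have "\<nu> \<bullet> \<nu> = 1" using \<nu>1 by (simp add: norm_eq_1)
      then show ?thesis
        unfolding yz power2_norm_eq_inner
        by (simp add: inner_add_left inner_add_right inner_commute[of w \<nu>] power2_eq_square distrib_left)
    qed
    then have "2 * R * (\<nu> \<bullet> w) = - ((norm w)^2)" using y(1) by simp
    then have \<nu>w: "\<nu> \<bullet> w = - ((norm w)^2) / (2 * R)" using R by (simp add: field_simps)
    have "h y = (norm w)^2 * (\<beta> * (norm w)^2 / (4 * R^2) - 1)"
    proof -
      have "h y = - (- ((norm w)^2) / (2 * R)) + \<beta> * (- ((norm w)^2) / (2 * R))^2 - \<gamma> * (norm w)^2"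
        unfolding h_eq w_def[symmetric] \<nu>w ..
      also have "\<dots> = (norm w)^2 * (\<beta> * (norm w)^2 / (4 * R^2) - 1)"
        using R(1) by (simp add: \<gamma>_def power_divide power2_eq_square) (simp add: field_simps)
      finally show ?thesis .
    qed
    moreover have "\<beta> * (norm w)^2 / (4 * R^2) \<le> 1"
    proof -
      have "(norm w)^2 \<le> (2 * R / sqrt \<beta>)^2" using y(2) by (intro power_mono) (auto simp: w_def)
      also have "\<dots> = 4 * R^2 / \<beta>" using \<beta> by (simp add: power_divide power_mult_distrib)
      finally show ?thesis using \<beta> R(1) by (simp add: field_simps)
    qed
    ultimately show ?thesis by (simp add: mult_nonneg_nonpos)
  qed
  have contf: "continuous_on (cball z R) (\<lambda>y. \<rho> y - \<sigma> y)"
    by (intro continuous_intros continuous_on_subset[OF js(3)] continuous_on_subset[OF jr(3)] R)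
  have conth: "continuous_on (cball z R) h"
    unfolding h_eq by (intro continuous_intros)
  obtain B where B: "\<And>y. y \<in> cball z R \<Longrightarrow> h y \<le> B"
    using continuous_attains_sup[OF compact_cball _ conth] pK by blast
  have "\<exists>e>0. \<forall>y\<in>cball z R. \<rho> y - \<sigma> y + e * h y \<le> 0"
  proof (rule ccontr)
    assume contra: "\<not> ?thesis"
    define e where "e k = 1 / real (Suc k)" for k
    have e: "e \<longlonglongrightarrow> 0" "\<And>k. 0 < e k" using tendsto_inverse_Suc by (simp_all add: e_def[abs_def])
    have "\<exists>y. y \<in> cball z R \<and> 0 < \<rho> y - \<sigma> y + e k * h y \<and>
        (\<forall>w\<in>cball z R. \<rho> w - \<sigma> w + e k * h w \<le> \<rho> y - \<sigma> y + e k * h y)" for k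
    proof -
      obtain y' where y': "y' \<in> cball z R" "0 < \<rho> y' - \<sigma> y' + e k * h y'"
        using contra e(2)[of k] by force
      have "continuous_on (cball z R) (\<lambda>y. \<rho> y - \<sigma> y + e k * h y)"
        by (intro continuous_intros contf conth)
      then obtain y where "y \<in> cball z R" and
        y: "\<forall>w\<in>cball z R. \<rho> w - \<sigma> w + e k * h w \<le> \<rho> y - \<sigma> y + e k * h y"
        using continuous_attains_sup[OF compact_cball] y'(1) by blast
      moreover have "0 < \<rho> y - \<sigma> y + e k * h y"
        using bspec[OF y y'(1)] y'(2) by linarith
      ultimately show ?thesis by blast
    qed
    then obtain y where y: "\<And>k. y k \<in> cball z R" "\<And>k. 0 < \<rho> (y k) - \<sigma> (y k) + e k * h (y k)"
      "\<And>k w. w \<in> cball z R \<Longrightarrow> \<rho> w - \<sigma> w + e k * h w \<le> \<rho> (y k) - \<sigma> (y k) + e k * h (y k)"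
      by metis
    have le: "\<rho> w \<le> \<sigma> w" if "w \<in> cball z R" for w using below[OF that] contact by fastforce
    have ylim: "y \<longlonglongrightarrow> p"
    proof (rule approach_contact_point[where h = "\<lambda>k. h" and B = B and e = e and f = "\<lambda>y. \<rho> y - \<sigma> y" and K = "cball z R"])
      show "continuous_on (cball z R - {p}) (\<lambda>y. \<rho> y - \<sigma> y)" using contf continuous_on_subset by blast
    qed (use below B e y in \<open>auto intro: less_imp_le\<close>)
    have "0 < 2 * R / sqrt \<beta>" using R \<beta> by simp
    from tendstoD[OF ylim this] obtain N where N: "\<And>k. k \<ge> N \<Longrightarrow> dist (y k) p < 2 * R / sqrt \<beta>"
      by (auto simp: eventually_sequentially)
    have inball: "y k \<in> ball z R" if "k \<ge> N" for k
    proof (rule ccontr)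
      assume "y k \<notin> ball z R"
      then have "norm (y k - z) = R" using y(1)[of k] by (auto simp: dist_norm norm_minus_commute)
      from boundary[OF this] N[OF that] have "h (y k) \<le> 0" by (simp add: dist_norm)
      then have "e k * h (y k) \<le> 0" using e(2)[of k] by (simp add: mult_nonneg_nonpos)
      then show False using y(2)[of k] le[OF y(1)[of k]] by linarith
    qed
    show False
    proof (rule perturbed_contact_contradiction[OF s p\<Omega> r, where W = "ball z R" and y = "\<lambda>k. y (k + N)"
        and e = "\<lambda>k. e (k + N)" and c = "\<lambda>k. - \<nu>" and C = C and h = "\<lambda>k. h" and ?c0.0 = "- \<nu>"])
      show "ball z R \<subseteq> \<Omega>" "ball z R \<subseteq> \<Omega>" using R(2) ball_subset_cball by blast+
      show "(\<lambda>k. y (k + N)) \<longlonglongrightarrow> p" "(\<lambda>k. e (k + N)) \<longlonglongrightarrow> 0"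
        by (intro LIMSEQ_ignore_initial_segment ylim e)+
      show "0 < matrix_grad F (conf_op (\<sigma> p) (gs p) (Hs p)) \<bullet> (\<sigma> p *\<^sub>R C - (gs p \<bullet> (- \<nu>)) *\<^sub>R mat 1)"
        using pos by (simp add: G_def)
    qed (use inball e C h_def y le in \<open>auto intro: less_imp_le\<close>)
  qed
  then obtain e where e: "0 < e" "\<And>y. y \<in> cball z R \<Longrightarrow> \<rho> y - \<sigma> y + e * h y \<le> 0" by blast
  define D where "D = (gr p - gs p) \<bullet> (z - p) + e * ((- \<nu>) \<bullet> (z - p))"
  have "((\<lambda>y. \<rho> y - \<sigma> y + e * h y) has_derivative
     (\<lambda>v. gr p \<bullet> v - gs p \<bullet> v + e * ((- \<nu> + C *v (p - p)) \<bullet> v))) (at p)"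
    unfolding h_def
    by (intro has_derivative_add has_derivative_diff has_derivative_mult_right jr(5) js(5) p\<Omega> quadratic_jet(1)[OF C])
  then have "((\<lambda>y. \<rho> y - \<sigma> y + e * h y) has_derivative
     (\<lambda>v. (gr p - gs p + e *\<^sub>R (- \<nu>)) \<bullet> v)) (at (p + 0 *\<^sub>R (z - p)))"
    by (simp add: inner_add_left inner_diff_left)
  from derivative_along_line[OF this]
  have D: "((\<lambda>t. \<rho> (p + t *\<^sub>R (z - p)) - \<sigma> (p + t *\<^sub>R (z - p)) + e * h (p + t *\<^sub>R (z - p))) has_real_derivative D) (at 0)"
    by (simp add: D_def inner_add_left inner_diff_left)
  have "D \<le> 0"
  proof (rule ccontr)
    assume "\<not> D \<le> 0"
    with DERIV_pos_inc_right[OF D] obtain d where d: "0 < d" "\<And>t. 0 < t \<Longrightarrow> t < d \<Longrightarrow>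
      0 < \<rho> (p + t *\<^sub>R (z - p)) - \<sigma> (p + t *\<^sub>R (z - p)) + e * h (p + t *\<^sub>R (z - p))"
      using contact by (auto simp: h_def)
    define t where "t = min d 1 / 2"
    have t: "0 < t" "t < d" "t \<le> 1" using d(1) by (auto simp: t_def)
    have "p + t *\<^sub>R (z - p) = (1 - t) *\<^sub>R p + t *\<^sub>R z" by (simp add: algebra_simps)
    also have "\<dots> \<in> cball z R"
      using convexD_alt[OF convex_cball pK, of z t] t R(1) by simp
    finally show False using e(2) d(2)[OF t(1,2)] by force
  qed
  moreover have "(- \<nu>) \<bullet> (z - p) = R"
  proof -
    have "z - p = - (R *\<^sub>R \<nu>)" using pz by (metis minus_diff_eq)
    then show ?thesis using \<nu>1 by (simp add: norm_eq_1)
  qed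
  ultimately have "(gr p - gs p) \<bullet> (z - p) < 0" using e(1) R(1) unfolding D_def
    by (smt (verit) mult_pos_pos)
  then show ?thesis by (simp add: inner_diff_left)
qed

text \<open>A point \<open>y\<close> near \<open>q\<close> without contact is the centre of a largest ball free of contact, with a contact point \<open>p\<close> on
  its boundary. The gradients agree at \<open>p\<close>, contrary to the boundary point lemma. That lemma is applied to the ball
  with diameter from \<open>y\<close> to \<open>p\<close>, whose closure meets the larger sphere only in \<open>p\<close>.\<close>

lemma strong_maximum_principle:
  assumes s: "solution \<Omega> \<sigma> gs Hs" and r: "solution \<Omega> \<rho> gr Hr"
    and le: "\<And>y. y \<in> \<Omega> \<Longrightarrow> \<rho> y \<le> \<sigma> y" and q: "q \<in> \<Omega>" "\<rho> q = \<sigma> q"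
  shows "\<exists>d>0. \<forall>y\<in>ball q d. y \<in> \<Omega> \<and> \<rho> y = \<sigma> y"
proof -
  note js = jet2_D[OF solution_D(1)[OF s]] and jr = jet2_D[OF solution_D(1)[OF r]]
  obtain d0 where d0: "0 < d0" "cball q d0 \<subseteq> \<Omega>" using js(1) q(1) open_contains_cball by blast
  define d where "d = d0 / 2"
  have d: "0 < d" "cball q (2 * d) \<subseteq> \<Omega>" using d0 by (auto simp: d_def)
  have "\<rho> y = \<sigma> y" if y: "y \<in> ball q d" for y
  proof (rule ccontr)
    assume ne: "\<rho> y \<noteq> \<sigma> y"
    define Z where "Z = {w \<in> cball q (2 * d). \<rho> w - \<sigma> w = 0}"
    have "continuous_on (cball q (2 * d)) (\<lambda>w. \<rho> w - \<sigma> w)"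
      by (intro continuous_intros continuous_on_subset[OF js(3)] continuous_on_subset[OF jr(3)] d)
    then have "closed Z" unfolding Z_def
      by (intro continuous_closed_preimage_constant) auto
    moreover have qZ: "q \<in> Z" using q d by (simp add: Z_def)
    ultimately obtain p where p: "p \<in> Z" "\<And>w. w \<in> Z \<Longrightarrow> dist y p \<le> dist y w"
      using distance_attains_inf[of Z y] by blast
    define R where "R = dist y p"
    have Rd: "R < d" using p(2)[OF qZ] y by (simp add: R_def dist_commute)
    have "p \<noteq> y" using p(1) ne by (auto simp: Z_def)
    then have R0: "0 < R" by (simp add: R_def)
    have strict: "\<rho> w < \<sigma> w" if "dist y w < R" for w
    proof -
      have "dist q w \<le> 2 * d" using that Rd y dist_triangle[of q w y] by (simp add: dist_commute)
      moreover have "w \<notin> Z" using p(2)[of w] that by (auto simp: R_def)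
      ultimately have "\<rho> w \<noteq> \<sigma> w" "w \<in> \<Omega>" using d(2) by (auto simp: Z_def)
      then show ?thesis using le[of w] by simp
    qed
    define z where "z = (1/2) *\<^sub>R (y + p)"
    have zp: "norm (p - z) = R / 2" 
    proof -
      have "p - z = (1/2) *\<^sub>R (p - y)" by (simp add: z_def algebra_simps flip: scaleR_add_left)
      then show ?thesis by (simp add: R_def dist_norm norm_minus_commute)
    qed
    have yz: "dist y z = R / 2"
    proof -
      have "y - z = (1/2) *\<^sub>R (y - p)" by (simp add: z_def algebra_simps flip: scaleR_add_left)
      then show ?thesis by (simp add: R_def dist_norm)
    qed
    have sub: "cball z (R / 2) \<subseteq> cball q (2 * d)"
    proof
      fix w assume "w \<in> cball z (R / 2)"
      then show "w \<in> cball q (2 * d)"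
        using dist_triangle[of q w y] dist_triangle[of y w z] yz y Rd by (simp add: dist_commute)
    qed
    have inner: "\<rho> w < \<sigma> w" if "w \<in> cball z (R / 2)" "w \<noteq> p" for w
    proof (rule strict)
      have yzw: "y - w = (y - z) - (w - z)" and yz': "y - z = - (p - z)"
        by (simp_all add: z_def algebra_simps flip: scaleR_add_left)
      have "norm (w - z) \<le> R / 2" using that by (simp add: dist_norm norm_minus_commute)
      show "dist y w < R"
      proof (rule ccontr)
        assume "\<not> dist y w < R"
        then have "R^2 \<le> (norm (y - w))^2" using R0 by (intro power_mono) (auto simp: dist_norm)
        moreover have "(norm (y - w))^2 + (norm (w - p))^2 = 2 * (norm (w - z))^2 + 2 * (norm (p - z))^2"
        proof -
          have "y - w = - (p - z) - (w - z)" "w - p = (w - z) - (p - z)" using yzw yz' by simp_all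
          moreover have "(norm (- a - b))^2 + (norm (b - a))^2 = 2 * (norm b)^2 + 2 * (norm a)^2" for a b :: "real^'n"
            by (simp add: power2_norm_eq_inner inner_diff_left inner_diff_right inner_commute)
          ultimately show ?thesis by (simp only:)
        qed
        moreover have "(norm (w - z))^2 \<le> (R / 2)^2"
          using \<open>norm (w - z) \<le> R / 2\<close> by (intro power_mono) auto
        ultimately have "(norm (w - p))^2 \<le> 0" using zp by (simp add: power2_eq_square)
        then show False using that(2) by simp
      qed
    qed
    have p\<Omega>: "p \<in> \<Omega>" "\<rho> p = \<sigma> p" using p(1) d(2) by (auto simp: Z_def)
    have "0 < (gs p - gr p) \<bullet> (z - p)"
      by (rule hopf_boundary[OF s r _ _ zp p\<Omega>(2) inner]) (use R0 sub d(2) in auto)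
    moreover have "gr p - gs p = 0"
    proof (rule local_max_jet(1)[of \<Omega> p "\<lambda>y. \<rho> y - \<sigma> y" "\<lambda>y. gr y - gs y" "Hr p - Hs p"])
      fix w assume "w \<in> \<Omega>"
      show "((\<lambda>y. \<rho> y - \<sigma> y) has_derivative (\<lambda>h. (gr w - gs w) \<bullet> h)) (at w)"
        unfolding inner_diff_left using \<open>w \<in> \<Omega>\<close> by (intro has_derivative_diff jr(5) js(5))
      show "\<rho> w - \<sigma> w \<le> \<rho> p - \<sigma> p" using le[OF \<open>w \<in> \<Omega>\<close>] p\<Omega> by simp
    next
      show "((\<lambda>y. gr y - gs y) has_derivative (\<lambda>h. (Hr p - Hs p) *v h)) (at p)"
        unfolding matrix_vector_mult_diff_rdistrib using p\<Omega> by (intro has_derivative_diff jr(6) js(6))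
    qed (use js(1) p\<Omega> in auto)
    ultimately show False by simp
  qed
  then show ?thesis using d by (intro exI[of _ d]) auto
qed

text \<open>Here \<open>\<sigma>\<close> is a solution across \<open>p\<close> and \<open>\<rho>\<close> only around \<open>p\<close>. The first claim is \<open>\<rho> \<le> \<sigma> - e |y - p|\<close> near \<open>p\<close> for some
  \<open>e > 0\<close>. If it fails, then for small \<open>e\<close> and suitable unit vectors \<open>v\<close> the function \<open>\<rho> - \<sigma> + e (v \<bullet> w + K |w|\<^sup>2)\<close>,
  \<open>w = y - p\<close>, has a positive maximum off \<open>p\<close>, which is impossible when \<open>K\<close> is large compared with the gradient of \<open>\<sigma>\<close> at \<open>p\<close>. By
  the claim, \<open>\<rho>\<close> is smaller on a small sphere of radius \<open>t\<close> than the tangent plane of \<open>\<sigma>\<close>, by at least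
  \<open>e t / 2\<close>. As \<open>\<rho>\<close> is subharmonic and bounded above, this gap extends to the punctured ball.\<close>

lemma isolated_contact_gap:
  assumes s: "solution \<Omega> \<sigma> gs Hs" "p \<in> \<Omega>" and r: "solution (\<Omega> - {p}) \<rho> gr Hr"
    and below: "\<And>y. y \<in> \<Omega> - {p} \<Longrightarrow> \<rho> y < \<sigma> y"
  shows "\<exists>\<kappa>>0. \<exists>d>0. \<forall>y. 0 < norm (y - p) \<longrightarrow> norm (y - p) < d \<longrightarrow> \<rho> y \<le> \<sigma> y - \<kappa>"
proof -
  note js = jet2_D[OF solution_D(1)[OF s(1)]] and jr = jet2_D[OF solution_D(1)[OF r]]
  obtain r where r0: "0 < r" "cball p r \<subseteq> \<Omega>" using js(1) s(2) open_contains_cball by blast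
  define G where "G = matrix_grad F (conf_op (\<sigma> p) (gs p) (Hs p))"
  have trG: "0 < trace G" unfolding G_def using F_elliptic solution_D(3)[OF s] pos_def_trace_pos by blast
  have sp: "0 < \<sigma> p" using solution_D(2)[OF s] .
  define K where "K = (norm (gs p) + 1) / (2 * \<sigma> p)"
  have K: "0 < K" using sp by (simp add: K_def add_nonneg_pos)
  define C :: "real^'n^'n" where "C = (2 * K) *\<^sub>R mat 1"
  have C: "C \<in> sym_matrices" unfolding C_def by (intro sym_intros)
  define h where "h v y = v \<bullet> (y - p) + 1/2 * ((y - p) \<bullet> (C *v (y - p)))" for v y
  have h_eq: "h v y = v \<bullet> (y - p) + K * (norm (y - p))^2" for v y
    by (simp add: h_def C_def scaleR_mult_vec power2_norm_eq_inner)
  have h_le: "h v y \<le> norm (y - p) + K * (norm (y - p))^2" if "norm v = 1" for v y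
    using norm_cauchy_schwarz[of v "y - p"] that by (simp add: h_eq)
  have pos: "0 < G \<bullet> (\<sigma> p *\<^sub>R C - (gs p \<bullet> v) *\<^sub>R mat 1)" if "norm v = 1" for v
  proof -
    have "G \<bullet> (\<sigma> p *\<^sub>R C - (gs p \<bullet> v) *\<^sub>R mat 1) = (2 * \<sigma> p * K - gs p \<bullet> v) * trace G"
      by (simp add: C_def inner_diff_right inner_mat_1 algebra_simps)
    moreover have "2 * \<sigma> p * K = norm (gs p) + 1" using sp by (simp add: K_def)
    moreover have "gs p \<bullet> v \<le> norm (gs p)" using norm_cauchy_schwarz[of "gs p" v] that by simp
    ultimately show ?thesis using trG by simp
  qed
  have contf: "continuous_on (cball p r - {p}) (\<lambda>y. \<rho> y - \<sigma> y)"
    using r0 by (intro continuous_intros continuous_on_subset[OF js(3)] continuous_on_subset[OF jr(3)]) auto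
  have conth: "continuous_on A (h v)" for A v
    unfolding h_eq by (intro continuous_intros)
  have below': "\<rho> y < \<sigma> y" if "y \<in> cball p r - {p}" for y using below that r0 by auto
  have "\<exists>e>0. \<forall>y\<in>cball p r - {p}. \<rho> y \<le> \<sigma> y - e * norm (y - p)"
  proof (rule ccontr)
    assume contra: "\<not> ?thesis"
    define e where "e k = 1 / real (Suc k)" for k
    have e: "e \<longlonglongrightarrow> 0" "\<And>k. 0 < e k" using tendsto_inverse_Suc by (simp_all add: e_def[abs_def])
    have "\<exists>v y. norm v = 1 \<and> y \<in> cball p r - {p} \<and> 0 < \<rho> y - \<sigma> y + e k * h v y \<and>
        (\<forall>w\<in>cball p r - {p}. \<rho> w - \<sigma> w + e k * h v w \<le> \<rho> y - \<sigma> y + e k * h v y)" for k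
    proof -
      obtain y' where y': "y' \<in> cball p r - {p}" "\<sigma> y' - e k * norm (y' - p) < \<rho> y'"
        using contra e(2)[of k] by force
      define v where "v = (1 / norm (y' - p)) *\<^sub>R (y' - p)"
      have v: "norm v = 1" using y' by (simp add: v_def)
      define f where "f y = \<rho> y - \<sigma> y + e k * h v y" for y
      have "v \<bullet> (y' - p) = norm (y' - p)"
        using y' by (simp add: v_def dot_square_norm power2_eq_square)
      then have "norm (y' - p) \<le> h v y'" using K by (simp add: h_eq)
      then have "e k * norm (y' - p) \<le> e k * h v y'" using e(2)[of k] by simp
      then have m: "0 < f y'" using y'(2) by (simp add: f_def)
      have "isCont (\<lambda>y. e k * (norm (y - p) + K * (norm (y - p))^2)) p" by (intro continuous_intros)
      then have "(\<lambda>y. e k * (norm (y - p) + K * (norm (y - p))^2)) \<midarrow>p\<rightarrow> 0" by (simp add: isCont_def)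
      from order_tendstoD(2)[OF this m] obtain d where d: "0 < d"
        "\<And>y. y \<noteq> p \<Longrightarrow> dist y p < d \<Longrightarrow> e k * (norm (y - p) + K * (norm (y - p))^2) < f y'"
        by (auto simp: eventually_at)
      have near: "f y < f y'" if "y \<in> cball p r - {p}" "dist y p < d" for y
      proof -
        have "e k * h v y \<le> e k * (norm (y - p) + K * (norm (y - p))^2)"
          using h_le[OF v, of y] e(2)[of k] by simp
        then show ?thesis using d(2)[of y] that below'[OF that(1)] unfolding f_def[of y] by fastforce
      qed
      define Q where "Q = cball p r - ball p d"
      have Q: "compact Q" "y' \<in> Q" "Q \<subseteq> cball p r - {p}"
        using y' d(1) near[OF y'(1)] by (auto simp: Q_def dist_commute intro!: compact_diff)
      have "continuous_on Q f"
        unfolding f_def by (intro continuous_intros continuous_on_subset[OF contf Q(3)] conth)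
      then obtain y where y: "y \<in> Q" "\<And>w. w \<in> Q \<Longrightarrow> f w \<le> f y"
        using continuous_attains_sup[of Q f] Q by blast
      have "f w \<le> f y" if "w \<in> cball p r - {p}" for w
      proof (cases "dist w p < d")
        case True then show ?thesis using near[OF that] y(2)[OF Q(2)] by simp
      next
        case False then show ?thesis using that y(2)[of w] by (auto simp: Q_def dist_commute)
      qed
      moreover have "0 < f y" using m y(2)[OF Q(2)] by simp
      ultimately show ?thesis using v y(1) Q(3) unfolding f_def by blast
    qed
    then obtain v y where vy: "\<And>k. norm (v k) = 1" "\<And>k. y k \<in> cball p r - {p}"
      "\<And>k. 0 < \<rho> (y k) - \<sigma> (y k) + e k * h (v k) (y k)"
      "\<And>k w. w \<in> cball p r - {p} \<Longrightarrow> \<rho> w - \<sigma> w + e k * h (v k) w \<le> \<rho> (y k) - \<sigma> (y k) + e k * h (v k) (y k)"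
      by metis
    have ylim: "y \<longlonglongrightarrow> p"
    proof (rule approach_contact_point[where h = "\<lambda>k. h (v k)" and B = "r + K * r^2" and e = e and f = "\<lambda>y. \<rho> y - \<sigma> y" and K = "cball p r"])
      show "h (v k) w \<le> r + K * r^2" if "w \<in> cball p r" for k w
      proof -
        have w: "norm (w - p) \<le> r" using that by (simp add: dist_norm norm_minus_commute)
        then have "(norm (w - p))^2 \<le> r^2" by (intro power_mono) auto
        then have "K * (norm (w - p))^2 \<le> K * r^2" using K by simp
        then show ?thesis using h_le[OF vy(1), of k w] w by linarith
      qed
    qed (use vy e contf below' in \<open>auto intro: less_imp_le\<close>)
    obtain N where N: "\<And>k. k \<ge> N \<Longrightarrow> dist (y k) p < r"
      using tendstoD[OF ylim r0(1)] by (auto simp: eventually_sequentially)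
    have "compact (sphere (0::real^'n) 1)" by simp
    moreover have "\<forall>k. v (k + N) \<in> sphere 0 1" using vy(1) by simp
    ultimately obtain v0 \<phi> where \<phi>: "v0 \<in> sphere 0 1" "strict_mono \<phi>" "((\<lambda>k. v (k + N)) \<circ> \<phi>) \<longlonglongrightarrow> v0"
      unfolding compact_def by meson
    define \<psi> where "\<psi> k = \<phi> k + N" for k
    have \<psi>: "strict_mono \<psi>" using \<phi>(2) by (simp add: \<psi>_def strict_mono_def)
    show False
    proof (rule perturbed_contact_contradiction[OF s r, where W = "ball p r - {p}" and y = "y \<circ> \<psi>"
        and e = "e \<circ> \<psi>" and c = "v \<circ> \<psi>" and C = C and h = "\<lambda>k. h (v (\<psi> k))" and ?c0.0 = v0])
      show "open (ball p r - {p})" by (intro open_Diff) auto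
      show "ball p r - {p} \<subseteq> \<Omega>" "ball p r - {p} \<subseteq> \<Omega> - {p}" using r0(2) ball_subset_cball by blast+
      show "(y \<circ> \<psi>) \<longlonglongrightarrow> p" "(e \<circ> \<psi>) \<longlonglongrightarrow> 0"
        by (intro LIMSEQ_subseq_LIMSEQ \<psi> ylim e)+
      show "(v \<circ> \<psi>) \<longlonglongrightarrow> v0" using \<phi>(3) by (simp add: \<psi>_def comp_def)
      show "0 < matrix_grad F (conf_op (\<sigma> p) (gs p) (Hs p)) \<bullet> (\<sigma> p *\<^sub>R C - (gs p \<bullet> v0) *\<^sub>R mat 1)"
        using pos[of v0] \<phi>(1) by (simp add: G_def)
      fix k
      have kN: "N \<le> \<psi> k" by (simp add: \<psi>_def)
      show "(y \<circ> \<psi>) k \<in> ball p r - {p}" using N[OF kN] vy(2)[of "\<psi> k"] by (simp add: dist_commute)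
      show "0 < (e \<circ> \<psi>) k" using e by simp
      show "\<rho> ((y \<circ> \<psi>) k) \<le> \<sigma> ((y \<circ> \<psi>) k)" using below'[OF vy(2)] by (simp add: less_imp_le)
      show "0 \<le> \<rho> ((y \<circ> \<psi>) k) - \<sigma> ((y \<circ> \<psi>) k) + (e \<circ> \<psi>) k * h (v (\<psi> k)) ((y \<circ> \<psi>) k)"
        using vy(3) by (simp add: less_imp_le)
      fix z
      show "h (v (\<psi> k)) z = (v \<circ> \<psi>) k \<bullet> (z - p) + 1/2 * ((z - p) \<bullet> (C *v (z - p)))" by (simp add: h_def)
      assume "z \<in> ball p r - {p}"
      then have "z \<in> cball p r - {p}" by auto
      from vy(4)[OF this] show "\<rho> z - \<sigma> z + (e \<circ> \<psi>) k * h (v (\<psi> k)) z \<le>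
         \<rho> ((y \<circ> \<psi>) k) - \<sigma> ((y \<circ> \<psi>) k) + (e \<circ> \<psi>) k * h (v (\<psi> k)) ((y \<circ> \<psi>) k)" by simp
    qed (rule C)
  qed
  then obtain e where e: "0 < e" "\<And>y. y \<in> cball p r - {p} \<Longrightarrow> \<rho> y \<le> \<sigma> y - e * norm (y - p)" by blast
  have "\<forall>e>0. \<exists>d>0. \<forall>y. norm (y - p) < d \<longrightarrow> norm (\<sigma> y - \<sigma> p - gs p \<bullet> (y - p)) \<le> e * norm (y - p)"
    using js(5)[OF s(2)] unfolding has_derivative_at_alt by blast
  then obtain d where d: "0 < d" "\<And>y. norm (y - p) < d \<Longrightarrow> \<bar>\<sigma> y - \<sigma> p - gs p \<bullet> (y - p)\<bar> \<le> e / 2 * norm (y - p)"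
    using e(1) by (metis half_gt_zero real_norm_def)
  define t where "t = min r d / 2"
  have t: "0 < t" "t < d" "t \<le> r" using r0 d by (auto simp: t_def)
  define f where "f y = \<rho> y - (\<sigma> p + gs p \<bullet> (y - p))" for y
  have jf: "jet2 (\<Omega> - {p}) f (\<lambda>y. gr y - gs p) Hr"
  proof -
    have "(f has_derivative (\<lambda>h. (gr y - gs p) \<bullet> h)) (at y)" if "y \<in> \<Omega> - {p}" for y
      unfolding f_def inner_diff_left
      by (rule derivative_eq_intros jr(5)[OF that] refl ext)+ simp
    moreover have "((\<lambda>y. gr y - gs p) has_derivative (\<lambda>h. Hr y *v h)) (at y)" if "y \<in> \<Omega> - {p}" for y
      by (rule derivative_eq_intros jr(6)[OF that] refl ext)+ simp
    ultimately show ?thesis using jr(1,2) by (simp add: jet2_def)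
  qed
  have tsub: "cball p t - {p} \<subseteq> \<Omega> - {p}" "cball p t - {p} \<subseteq> cball p r - {p}" using t r0 by auto
  have upper: "f y \<le> e / 2 * norm (y - p) - e * norm (y - p)" if "y \<in> cball p t - {p}" for y
  proof -
    have "norm (y - p) < d" using that t by (auto simp: dist_norm norm_minus_commute)
    moreover have "\<rho> y \<le> \<sigma> y - e * norm (y - p)" using e(2) tsub(2) that by blast
    ultimately show ?thesis using abs_le_D1[OF d(2)[of y]] unfolding f_def by linarith
  qed
  have gap: "f y \<le> - (e / 2 * t)" if y: "y \<in> cball p t - {p}" for y
  proof (rule removable_subharmonic_bound[OF n jf t(1) tsub(1) _ _ _ y, where B = 0])
    fix w assume w: "w \<in> cball p t - {p}"
    show "0 \<le> trace (Hr w)" using solution_D(7)[OF r] w tsub(1) by blast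
    show "f w \<le> 0" using upper[OF w] e(1) by (smt (verit) field_sum_of_halves mult_nonneg_nonneg norm_ge_zero mult_right_mono)
  next
    fix w assume w: "norm (w - p) = t"
    then have "w \<in> cball p t - {p}" using t(1) by (auto simp: dist_norm norm_minus_commute)
    from upper[OF this] w show "f w \<le> - (e / 2 * t)" by simp
  qed
  show ?thesis
  proof (intro exI conjI allI impI)
    show "0 < e / 4 * t" "0 < t / 2" using e t by auto
    fix y assume y: "0 < norm (y - p)" "norm (y - p) < t / 2"
    then have "norm (y - p) \<le> t" using t(1) by linarith
    with y have "y \<in> cball p t - {p}" by (auto simp: dist_norm norm_minus_commute)
    from gap[OF this] have "\<rho> y \<le> \<sigma> p + gs p \<bullet> (y - p) - e / 2 * t" by (simp add: f_def)
    moreover have "\<sigma> p + gs p \<bullet> (y - p) \<le> \<sigma> y + e / 2 * norm (y - p)"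
    proof -
      have "norm (y - p) < d" using y t by linarith
      from abs_le_D2[OF d(2)[OF this]] show ?thesis by linarith
    qed
    moreover have "e / 2 * norm (y - p) \<le> e / 2 * (t / 2)" using y e(1) by simp
    ultimately show "\<rho> y \<le> \<sigma> y - e / 4 * t" by simp
  qed
qed

end

section \<open>Invariance under the Kelvin transform\<close>

lemma matrix_inv_eqI:
  fixes A :: "real^'n^'n"
  assumes "A ** B = mat 1" "B ** A = mat 1"
  shows "matrix_inv A = B"
proof -
  have "\<exists>A'. A ** A' = mat 1 \<and> A' ** A = mat 1" using assms by blast
  then have *: "A ** matrix_inv A = mat 1" "matrix_inv A ** A = mat 1"
    unfolding matrix_inv_def by (metis (mono_tags, lifting) someI_ex)+
  have "matrix_inv A = matrix_inv A ** (A ** B)" by (simp add: assms)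
  also have "\<dots> = B" by (simp add: matrix_mul_assoc *)
  finally show ?thesis .
qed

lemma continuous_on_matrix_mult:
  fixes A B :: "'a::topological_space \<Rightarrow> real^'n^'n"
  assumes "continuous_on S A" "continuous_on S B"
  shows "continuous_on S (\<lambda>x. A x ** B x)"
  unfolding matrix_matrix_mult_def
  by (intro continuous_on_vec_lambda continuous_on_sum continuous_on_mult continuous_on_component assms)

lemma continuous_on_outer:
  fixes a b :: "'a::topological_space \<Rightarrow> real^'n"
  assumes "continuous_on S a" "continuous_on S b"
  shows "continuous_on S (\<lambda>x. outer (a x) (b x))"
  unfolding outer_def
  by (intro continuous_on_vec_lambda continuous_on_mult continuous_on_component assms)

definition reflection :: "real^'n \<Rightarrow> real^'n^'n" where
  "reflection z = mat 1 - (2 / (z \<bullet> z)) *\<^sub>R outer z z"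

lemma reflection_vec: "reflection z *v v = v - (2 * (z \<bullet> v) / (z \<bullet> z)) *\<^sub>R z"
  by (simp add: reflection_def matrix_vector_mult_diff_rdistrib scaleR_mult_vec outer_mult_vec)

lemma reflection_square: "z \<noteq> 0 \<Longrightarrow> reflection z ** reflection z = mat 1"
  unfolding matrix_eq
  by (simp add: reflection_vec inner_diff_right flip: matrix_vector_mul_assoc)

lemma reflection_sym: "reflection z \<in> sym_matrices"
  unfolding reflection_def by (intro sym_intros)

lemma reflection_orthogonal: "z \<noteq> 0 \<Longrightarrow> orthogonal_matrix (reflection z)"
  using reflection_sym[of z] reflection_square[of z] by (simp add: orthogonal_matrix sym_matrices_def)

lemma reflection_inv: "z \<noteq> 0 \<Longrightarrow> matrix_inv (reflection z) = reflection z"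
  by (intro matrix_inv_eqI reflection_square)

definition inversion :: "real^'n \<Rightarrow> real \<Rightarrow> real^'n \<Rightarrow> real^'n" where
  "inversion x l y = x + (l^2 / ((y - x) \<bullet> (y - x))) *\<^sub>R (y - x)"

text \<open>In terms of \<open>u = \<rho> powr (- (n - 2) / 2)\<close> this is the classical transform
  \<open>(l / |y - x|) powr (n - 2) * u (inversion x l y)\<close>.\<close>

definition kelvin :: "real^'n \<Rightarrow> real \<Rightarrow> (real^'n \<Rightarrow> real) \<Rightarrow> real^'n \<Rightarrow> real" where
  "kelvin x l \<rho> y = ((y - x) \<bullet> (y - x)) / l^2 * \<rho> (inversion x l y)"

definition kelvin_grad :: "real^'n \<Rightarrow> real \<Rightarrow> (real^'n \<Rightarrow> real) \<Rightarrow> (real^'n \<Rightarrow> real^'n) \<Rightarrow> real^'n \<Rightarrow> real^'n" where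
  "kelvin_grad x l \<rho> g y = (2 / l^2 * \<rho> (inversion x l y)) *\<^sub>R (y - x) + reflection (y - x) *v g (inversion x l y)"

definition kelvin_hess :: "real^'n \<Rightarrow> real \<Rightarrow> (real^'n \<Rightarrow> real) \<Rightarrow> (real^'n \<Rightarrow> real^'n) \<Rightarrow> (real^'n \<Rightarrow> real^'n^'n) \<Rightarrow> real^'n \<Rightarrow> real^'n^'n" where
  "kelvin_hess x l \<rho> g H y =
    (2 / l^2 * \<rho> (inversion x l y) - 2 * ((y - x) \<bullet> g (inversion x l y)) / ((y - x) \<bullet> (y - x))) *\<^sub>R mat 1
    + (l^2 / ((y - x) \<bullet> (y - x))) *\<^sub>R (reflection (y - x) ** H (inversion x l y) ** reflection (y - x))"

lemma inversion_derivative: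
  assumes "y \<noteq> x"
  shows "(inversion x l has_derivative (\<lambda>h. (l^2 / ((y - x) \<bullet> (y - x))) *\<^sub>R (reflection (y - x) *v h))) (at y)"
proof -
  have s: "(y - x) \<bullet> (y - x) \<noteq> 0" using assms by simp
  have 1: "(inversion x l has_derivative (\<lambda>h. (l^2 / ((y - x) \<bullet> (y - x))) *\<^sub>R h
      + ((0 * ((y - x) \<bullet> (y - x)) - l^2 * ((y - x) \<bullet> h + h \<bullet> (y - x))) / (((y - x) \<bullet> (y - x)) * ((y - x) \<bullet> (y - x)))) *\<^sub>R (y - x))) (at y)"
    unfolding inversion_def using s
    by (auto intro!: derivative_eq_intros)
  have 2: "(l^2 / S) *\<^sub>R h + ((0 * S - l^2 * (z \<bullet> h + h \<bullet> z)) / (S * S)) *\<^sub>R z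
     = (l^2 / S) *\<^sub>R (reflection z *v h)" if "S = z \<bullet> z" for S z h
    using that by (simp add: reflection_vec inner_commute[of h z] scaleR_diff_right)
  show ?thesis using 1 unfolding 2[OF refl] .
qed

lemma kelvin_derivative:
  assumes y: "y \<noteq> x" and l: "l \<noteq> 0"
    and \<rho>: "(\<rho> has_derivative (\<lambda>h. g (inversion x l y) \<bullet> h)) (at (inversion x l y))"
  shows "((\<lambda>y. \<rho> (inversion x l y)) has_derivative
      (\<lambda>h. (l^2 / ((y - x) \<bullet> (y - x))) * (g (inversion x l y) \<bullet> (reflection (y - x) *v h)))) (at y)"
    and "(kelvin x l \<rho> has_derivative (\<lambda>h. kelvin_grad x l \<rho> g y \<bullet> h)) (at y)"
proof -
  define z where "z = y - x"
  define S where "S = z \<bullet> z"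
  have S: "S \<noteq> 0" using y by (simp add: S_def z_def)
  show comp: "((\<lambda>y. \<rho> (inversion x l y)) has_derivative
      (\<lambda>h. (l^2 / ((y - x) \<bullet> (y - x))) * (g (inversion x l y) \<bullet> (reflection (y - x) *v h)))) (at y)"
    using has_derivative_compose[OF inversion_derivative[OF y] \<rho>] by simp
  have "(kelvin x l \<rho> has_derivative (\<lambda>h. S / l^2 * ((l^2 / S) * (g (inversion x l y) \<bullet> (reflection z *v h)))
      + (z \<bullet> h + h \<bullet> z) / l^2 * \<rho> (inversion x l y))) (at y)"
  proof -
    have dz: "((\<lambda>y. y - x) has_derivative (\<lambda>h. h)) (at y)"
      by (auto intro!: derivative_eq_intros)
    have dS: "((\<lambda>y. (y - x) \<bullet> (y - x) / l^2) has_derivative (\<lambda>h. (z \<bullet> h + h \<bullet> z) / l^2)) (at y)"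
      using bounded_linear.has_derivative[OF bounded_linear_divide has_derivative_inner[OF dz dz], of "l^2"]
      by (simp only: z_def)
    show ?thesis
      using has_derivative_mult[OF dS comp] by (simp only: kelvin_def[abs_def] S_def z_def)
  qed
  moreover have "S / l^2 * ((l^2 / S) * (g (inversion x l y) \<bullet> (reflection z *v h))) + (z \<bullet> h + h \<bullet> z) / l^2 * \<rho> (inversion x l y)
     = kelvin_grad x l \<rho> g y \<bullet> h" for h
  proof -
    have "S / l^2 * (l^2 / S * a) = a" for a using S l by simp
    moreover have "g (inversion x l y) \<bullet> (reflection z *v h) = (reflection z *v g (inversion x l y)) \<bullet> h"
      by (subst sym_inner_swap[OF reflection_sym]) (rule inner_commute)
    moreover have "(z \<bullet> h + h \<bullet> z) / l^2 * a = (2 / l^2 * a) * (z \<bullet> h)" for a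
      by (simp add: inner_commute[of h z])
    ultimately show ?thesis
      by (simp only: kelvin_grad_def inner_add_left inner_scaleR_left z_def[symmetric] add.commute)
  qed
  ultimately show "(kelvin x l \<rho> has_derivative (\<lambda>h. kelvin_grad x l \<rho> g y \<bullet> h)) (at y)" by simp
qed

lemma kelvin_grad_derivative:
  assumes y: "y \<noteq> x" and l: "l \<noteq> 0"
    and \<rho>: "(\<rho> has_derivative (\<lambda>h. g (inversion x l y) \<bullet> h)) (at (inversion x l y))"
    and g: "(g has_derivative (\<lambda>h. H (inversion x l y) *v h)) (at (inversion x l y))"
  shows "(kelvin_grad x l \<rho> g has_derivative (\<lambda>h. kelvin_hess x l \<rho> g H y *v h)) (at y)"
proof -
  define z where "z = y - x"
  define S where "S = z \<bullet> z"
  define J where "J = inversion x l y"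
  have S: "S \<noteq> 0" using y by (simp add: S_def z_def)
  note d\<rho> = kelvin_derivative(1)[OF y l, of \<rho> g, OF \<rho>, folded z_def S_def J_def]
  have dg: "((\<lambda>y. g (inversion x l y)) has_derivative
      (\<lambda>h. (l^2 / S) *\<^sub>R (H J *v (reflection z *v h)))) (at y)"
    using has_derivative_compose[OF inversion_derivative[OF y] g]
    by (simp add: matrix_vector_mult_scaleR z_def S_def J_def)
  have dz: "((\<lambda>y. y - x) has_derivative (\<lambda>h. h)) (at y)"
    by (auto intro!: derivative_eq_intros)
  have dc: "((\<lambda>y. (y - x) \<bullet> g (inversion x l y)) has_derivative
      (\<lambda>h. z \<bullet> ((l^2 / S) *\<^sub>R (H J *v (reflection z *v h))) + h \<bullet> g J)) (at y)"
    using has_derivative_inner[OF dz dg] by (simp add: z_def J_def)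
  have dS: "((\<lambda>y. (y - x) \<bullet> (y - x)) has_derivative (\<lambda>h. z \<bullet> h + h \<bullet> z)) (at y)"
    using has_derivative_inner[OF dz dz] by (simp add: z_def)
  have dq: "((\<lambda>y. 2 * ((y - x) \<bullet> g (inversion x l y)) / ((y - x) \<bullet> (y - x))) has_derivative
      (\<lambda>h. (2 * (z \<bullet> ((l^2 / S) *\<^sub>R (H J *v (reflection z *v h))) + h \<bullet> g J) * S
          - 2 * (z \<bullet> g J) * (z \<bullet> h + h \<bullet> z)) / (S * S))) (at y)"
    using has_derivative_divide'[OF has_derivative_mult_right[OF dc, of 2] dS] S
    by (simp add: z_def[symmetric] S_def[symmetric] J_def[symmetric])
  have "((\<lambda>y. (2 / l^2 * \<rho> (inversion x l y)) *\<^sub>R (y - x) + (g (inversion x l y)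
      - (2 * ((y - x) \<bullet> g (inversion x l y)) / ((y - x) \<bullet> (y - x))) *\<^sub>R (y - x))) has_derivative
      (\<lambda>h. ((2 / l^2 * \<rho> J) *\<^sub>R h + (2 / l^2 * ((l^2 / S) * (g J \<bullet> (reflection z *v h)))) *\<^sub>R z)
       + ((l^2 / S) *\<^sub>R (H J *v (reflection z *v h)) - ((2 * (z \<bullet> g J) / S) *\<^sub>R h +
       ((2 * (z \<bullet> ((l^2 / S) *\<^sub>R (H J *v (reflection z *v h))) + h \<bullet> g J) * S
          - 2 * (z \<bullet> g J) * (z \<bullet> h + h \<bullet> z)) / (S * S)) *\<^sub>R z)))) (at y)"
    using has_derivative_add[OF has_derivative_scaleR[OF has_derivative_mult_right[OF d\<rho>, of "2 / l^2"] dz]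
        has_derivative_diff[OF dg has_derivative_scaleR[OF dq dz]]]
    by (simp only: z_def[symmetric] S_def[symmetric] J_def[symmetric])
  then have "(kelvin_grad x l \<rho> g has_derivative
      (\<lambda>h. ((2 / l^2 * \<rho> J) *\<^sub>R h + (2 / l^2 * ((l^2 / S) * (g J \<bullet> (reflection z *v h)))) *\<^sub>R z)
       + ((l^2 / S) *\<^sub>R (H J *v (reflection z *v h)) - ((2 * (z \<bullet> g J) / S) *\<^sub>R h +
       ((2 * (z \<bullet> ((l^2 / S) *\<^sub>R (H J *v (reflection z *v h))) + h \<bullet> g J) * S
          - 2 * (z \<bullet> g J) * (z \<bullet> h + h \<bullet> z)) / (S * S)) *\<^sub>R z)))) (at y)"
    by (simp only: kelvin_grad_def[abs_def] reflection_vec)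
  moreover have "((2 / l^2 * \<rho> J) *\<^sub>R h + (2 / l^2 * ((l^2 / S) * (g J \<bullet> (reflection z *v h)))) *\<^sub>R z)
       + ((l^2 / S) *\<^sub>R (H J *v (reflection z *v h)) - ((2 * (z \<bullet> g J) / S) *\<^sub>R h +
       ((2 * (z \<bullet> ((l^2 / S) *\<^sub>R (H J *v (reflection z *v h))) + h \<bullet> g J) * S
          - 2 * (z \<bullet> g J) * (z \<bullet> h + h \<bullet> z)) / (S * S)) *\<^sub>R z))
     = kelvin_hess x l \<rho> g H y *v h" for h
  proof -
    define w where "w = H J *v (reflection z *v h)"
    have rhs: "kelvin_hess x l \<rho> g H y *v h = (2 / l^2 * \<rho> J - 2 * (z \<bullet> g J) / S) *\<^sub>R h
       + (l^2 / S) *\<^sub>R (w - (2 * (z \<bullet> w) / S) *\<^sub>R z)"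
      by (simp add: kelvin_hess_def matrix_vector_mult_add_rdistrib scaleR_mult_vec w_def S_def
          flip: z_def J_def matrix_vector_mul_assoc) (simp add: reflection_vec)
    have 1: "2 / l^2 * ((l^2 / S) * (g J \<bullet> (reflection z *v h))) = 2 / S * (h \<bullet> g J) - 4 * (z \<bullet> g J) * (z \<bullet> h) / S^2"
      using l S by (simp add: reflection_vec inner_diff_right inner_commute[of "g J"] S_def[symmetric] field_simps power2_eq_square)
    have 2: "(2 * (z \<bullet> ((l^2 / S) *\<^sub>R w) + h \<bullet> g J) * S - 2 * (z \<bullet> g J) * (z \<bullet> h + h \<bullet> z)) / (S * S)
      = 2 * l^2 * (z \<bullet> w) / S^2 + 2 / S * (h \<bullet> g J) - 4 * (z \<bullet> g J) * (z \<bullet> h) / S^2"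
      using S by (simp add: inner_commute[of h z] field_simps power2_eq_square)
    show ?thesis
      unfolding w_def[symmetric] 2 rhs 1
      using S by (simp add: algebra_simps power2_eq_square)
  qed
  ultimately show ?thesis by simp
qed

text \<open>In the Hessian of the transform all terms of rank one cancel, and its scalar part cancels against
  the cross terms in the squared norm of the gradient.\<close>

lemma conf_op_kelvin:
  fixes x y :: "real^'n"
  assumes y: "y \<noteq> x" and l: "l \<noteq> 0"
  defines "J \<equiv> inversion x l y" and "R \<equiv> reflection (y - x)"
  shows "conf_op (kelvin x l \<rho> y) (kelvin_grad x l \<rho> g y) (kelvin_hess x l \<rho> g H y)
    = matrix_inv R ** conf_op (\<rho> J) (g J) (H J) ** R"
proof -
  define z where "z = y - x"
  define S where "S = z \<bullet> z"
  define a where "a = 2 / l^2 * \<rho> J"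
  define c where "c = z \<bullet> g J"
  have z: "z \<noteq> 0" and S: "S \<noteq> 0" using y by (auto simp: S_def z_def)
  have R: "R = reflection z" "matrix_inv R = R" "R ** R = mat 1"
    using reflection_inv[OF z] reflection_square[OF z] by (simp_all add: R_def z_def)
  have "(R *v g J) \<bullet> (R *v g J) = g J \<bullet> (R *v (R *v g J))"
    using sym_inner_swap[OF reflection_sym] by (simp add: R(1))
  then have Rg: "(R *v g J) \<bullet> (R *v g J) = g J \<bullet> g J"
    by (simp add: matrix_vector_mul_assoc R(3))
  have Rz: "z \<bullet> (R *v g J) = - c"
    using S by (simp add: R(1) reflection_vec inner_diff_right c_def S_def)
  have "kelvin_grad x l \<rho> g y = a *\<^sub>R z + R *v g J"
    by (simp add: kelvin_grad_def a_def J_def R(1) z_def)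
  then have gg: "kelvin_grad x l \<rho> g y \<bullet> kelvin_grad x l \<rho> g y = a^2 * S - 2 * a * c + g J \<bullet> g J"
    using Rg Rz by (simp add: inner_add_left inner_add_right inner_commute[of "R *v g J" z] S_def power2_eq_square algebra_simps)
  have hess: "kelvin_hess x l \<rho> g H y = (a - 2 * c / S) *\<^sub>R mat 1 + (l^2 / S) *\<^sub>R (R ** H J ** R)"
    by (simp add: kelvin_hess_def a_def c_def S_def z_def J_def R_def)
  have ke: "kelvin x l \<rho> y = S * a / 2"
    using l by (simp add: kelvin_def S_def a_def z_def J_def)
  have "S * a / 2 * (l^2 / S) = \<rho> J" using S l by (simp add: a_def)
  moreover have "S * a / 2 * (a - 2 * c / S) - 1/2 * (a^2 * S - 2 * a * c + g J \<bullet> g J) = - (1/2 * (g J \<bullet> g J))"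
    using S by (simp add: field_simps power2_eq_square)
  moreover have "(S * a / 2) *\<^sub>R ((a - 2 * c / S) *\<^sub>R mat 1 + (l^2 / S) *\<^sub>R (R ** H J ** R))
      - (1/2 * (a^2 * S - 2 * a * c + g J \<bullet> g J)) *\<^sub>R mat 1
    = (S * a / 2 * (l^2 / S)) *\<^sub>R (R ** H J ** R) + (S * a / 2 * (a - 2 * c / S) - 1/2 * (a^2 * S - 2 * a * c + g J \<bullet> g J)) *\<^sub>R mat 1"
  proof -
    have "p *\<^sub>R (q *\<^sub>R I + r *\<^sub>R M) - t *\<^sub>R I = (p * r) *\<^sub>R M + (p * q - t) *\<^sub>R I"
      for p q r t :: real and I M :: "real^'n^'n"
      by (simp add: scaleR_add_right scaleR_diff_left)
    then show ?thesis .
  qed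
  ultimately have "conf_op (kelvin x l \<rho> y) (kelvin_grad x l \<rho> g y) (kelvin_hess x l \<rho> g H y)
    = \<rho> J *\<^sub>R (R ** H J ** R) + (- (1/2 * (g J \<bullet> g J))) *\<^sub>R mat 1"
    unfolding conf_op_def gg hess ke by (simp only:)
  also have "\<dots> = R ** conf_op (\<rho> J) (g J) (H J) ** R"
  proof -
    have "R ** conf_op (\<rho> J) (g J) (H J) ** R = \<rho> J *\<^sub>R (R ** H J ** R) - (1/2 * (g J \<bullet> g J)) *\<^sub>R (R ** mat 1 ** R)"
      unfolding conf_op_def matrix_eq
      by (simp add: quad_simps matrix_vector_mult_diff_distrib matrix_vector_mult_scaleR flip: matrix_vector_mul_assoc)
    then show ?thesis by (simp add: R(3))
  qed
  finally show ?thesis by (simp add: R(2))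
qed

lemma trace_conjugate_reflection:
  fixes A :: "real^'n^'n"
  assumes "z \<noteq> 0"
  shows "trace (matrix_inv (reflection z) ** A ** reflection z) = trace A"
proof -
  have "trace (reflection z ** A ** reflection z) = trace (reflection z ** (reflection z ** A))"
    by (rule trace_mul_sym)
  then show ?thesis using assms by (simp add: reflection_inv matrix_mul_assoc reflection_square)
qed

lemma inversion_continuous: "continuous_on (- {x}) (inversion x l)"
  unfolding inversion_def by (intro continuous_intros) auto

context conformal_equation
begin

lemma solution_kelvin:
  assumes s: "solution \<Omega> \<rho> g H" and l: "0 < l" and W: "open W" "\<And>y. y \<in> W \<Longrightarrow> y \<noteq> x \<and> inversion x l y \<in> \<Omega>"
  shows "solution W (kelvin x l \<rho>) (kelvin_grad x l \<rho> g) (kelvin_hess x l \<rho> g H)"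
proof -
  note j = jet2_D[OF solution_D(1)[OF s]]
  have l0: "l \<noteq> 0" using l by simp
  have cont: "continuous_on W (\<lambda>y. f (inversion x l y))" if "continuous_on \<Omega> f" for f :: "_ \<Rightarrow> 'b::topological_space"
    using W(2) by (intro continuous_on_compose2[OF that] continuous_on_subset[OF inversion_continuous]) auto
  have "continuous_on W (kelvin_hess x l \<rho> g H)"
    unfolding kelvin_hess_def[abs_def] reflection_def using W(2) l0
    by (intro continuous_intros continuous_on_matrix_mult continuous_on_outer cont[OF j(2)] cont[OF j(3)] cont[OF j(4)]) auto
  then have "jet2 W (kelvin x l \<rho>) (kelvin_grad x l \<rho> g) (kelvin_hess x l \<rho> g H)"
    unfolding jet2_def
  proof (intro conjI ballI W(1))
    fix y assume "y \<in> W"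
    then have y: "y \<noteq> x" "inversion x l y \<in> \<Omega>" using W(2) by auto
    show "(kelvin x l \<rho> has_derivative (\<lambda>h. kelvin_grad x l \<rho> g y \<bullet> h)) (at y)"
      by (rule kelvin_derivative(2)[where g = g, OF y(1) l0 j(5)[OF y(2)]])
    show "(kelvin_grad x l \<rho> g has_derivative (\<lambda>h. kelvin_hess x l \<rho> g H y *v h)) (at y)"
      by (rule kelvin_grad_derivative[where g = g and H = H, OF y(1) l0 j(5)[OF y(2)] j(6)[OF y(2)]])
  qed
  moreover have "0 < kelvin x l \<rho> y" if "y \<in> W" for y
    using W(2)[OF that] solution_D(2)[OF s, of "inversion x l y"] l by (simp add: kelvin_def)
  moreover have "conf_op (kelvin x l \<rho> y) (kelvin_grad x l \<rho> g y) (kelvin_hess x l \<rho> g H y) \<in> U \<and>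
    F (conf_op (kelvin x l \<rho> y) (kelvin_grad x l \<rho> g y) (kelvin_hess x l \<rho> g H y)) = 1 \<and>
    0 \<le> trace (conf_op (kelvin x l \<rho> y) (kelvin_grad x l \<rho> g y) (kelvin_hess x l \<rho> g H y))" if "y \<in> W" for y
  proof -
    let ?J = "inversion x l y"
    let ?A = "conf_op (\<rho> ?J) (g ?J) (H ?J)"
    have J: "?J \<in> \<Omega>" and yx: "y \<noteq> x" using W(2)[OF that] by auto
    have Q: "orthogonal_matrix (reflection (y - x))" using yx by (intro reflection_orthogonal) simp
    have "matrix_inv (reflection (y - x)) ** ?A ** reflection (y - x) \<in> U"
      using U_inv[OF Q] solution_D(3)[OF s J] by blast
    then show ?thesis
      unfolding conf_op_kelvin[OF yx l0] using F_inv[OF solution_D(3)[OF s J] Q] solution_D(4,5)[OF s J] yx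
      by (simp add: trace_conjugate_reflection)
  qed
  ultimately show ?thesis by (simp add: solution_def)
qed

end

section \<open>Moving spheres\<close>

lemma norm_inversion: "y \<noteq> x \<Longrightarrow> norm (inversion x l y - x) = l^2 / norm (y - x)"
  by (simp add: inversion_def dot_square_norm power2_eq_square)

lemma inversion_on_sphere: "0 < l \<Longrightarrow> norm (y - x) = l \<Longrightarrow> inversion x l y = y"
  by (simp add: inversion_def dot_square_norm)

lemma kelvin_on_sphere: "0 < l \<Longrightarrow> norm (y - x) = l \<Longrightarrow> kelvin x l \<rho> y = \<rho> y"
  by (simp add: kelvin_def inversion_on_sphere dot_square_norm)

lemma kelvin_norm: "kelvin x l \<rho> y = (norm (y - x))^2 / l^2 * \<rho> (inversion x l y)"
  by (simp add: kelvin_def dot_square_norm)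

text \<open>A ray that leaves \<open>x\<close> passes close to \<open>q\<close>, reaches the unit sphere and avoids the origin. The shift from \<open>q\<close> to \<open>q'\<close>
  along a vector orthogonal to \<open>x\<close> serves the last purpose. Contact of two solutions will be propagated along
  this ray, which replaces a discussion of the connectedness of the punctured ball minus a ball.\<close>

lemma exists_crossing_segment:
  fixes q x :: "real^'n"
  assumes n: "CARD('n) \<ge> 2" and q: "norm q < 1" "q \<noteq> x" and d: "0 < d"
  obtains q' T where "q' \<in> ball q d" "1 \<le> T" "norm (x + T *\<^sub>R (q' - x)) = 1"
    "\<And>t. 0 < t \<Longrightarrow> x + t *\<^sub>R (q' - x) \<noteq> 0"
proof -
  obtain w where w: "w \<noteq> 0" "orthogonal x w"
    using orthogonal_to_vector_exists[of x] n by auto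
  have xw: "w \<bullet> x = 0" using w(2) by (simp add: orthogonal_def inner_commute)
  define d' where "d' = min d (min (1 - norm q) (norm (q - x)))"
  have d': "0 < d'" using d q by (simp add: d'_def)
  obtain q' where q': "q' \<in> ball q d'" "w \<bullet> (q' - x) \<noteq> 0"
  proof (cases "w \<bullet> (q - x) = 0")
    case True
    define q' where "q' = q + (d' / (2 * norm w)) *\<^sub>R w"
    have "norm (q' - q) = d' / 2" using w d' by (simp add: q'_def)
    then have "q' \<in> ball q d'" using d' by (simp add: dist_norm norm_minus_commute)
    moreover have "w \<bullet> (q' - x) = (d' / (2 * norm w)) * (w \<bullet> w)"
      using True by (simp add: q'_def inner_diff_right inner_add_right)
    then have "w \<bullet> (q' - x) \<noteq> 0" using w d' by simp
    ultimately show ?thesis by (rule that)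
  next
    case False then show ?thesis using that[of q] d' by simp
  qed
  have nq': "norm q' < 1"
  proof -
    have "norm q' \<le> norm q + norm (q' - q)" by (rule norm_triangle_sub)
    moreover have "norm (q' - q) < 1 - norm q" using q'(1) by (simp add: d'_def dist_norm norm_minus_commute)
    ultimately show ?thesis by simp
  qed
  have "q' \<noteq> x" using q'(2) by auto
  then have D: "0 < norm (q' - x)" by simp
  define T0 where "T0 = 1 + (1 + norm x) / norm (q' - x)"
  have T0: "1 \<le> T0" using D by (simp add: T0_def)
  have "T0 * norm (q' - x) = norm (q' - x) + 1 + norm x" 
  proof -
    have "(1 + norm x) / norm (q' - x) * norm (q' - x) = 1 + norm x" using D by simp
    then show ?thesis by (simp only: T0_def distrib_right)
  qed
  then have "1 + norm x \<le> norm (T0 *\<^sub>R (q' - x))" using T0 D by simp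
  also have "\<dots> \<le> norm (x + T0 *\<^sub>R (q' - x)) + norm x"
    using norm_triangle_ineq4[of "x + T0 *\<^sub>R (q' - x)" x] by simp
  finally have big: "1 \<le> norm (x + T0 *\<^sub>R (q' - x))" by simp
  have "continuous_on {1..T0} (\<lambda>t. norm (x + t *\<^sub>R (q' - x)))" by (intro continuous_intros)
  then obtain T where T: "1 \<le> T" "norm (x + T *\<^sub>R (q' - x)) = 1"
    using IVT'[of "\<lambda>t. norm (x + t *\<^sub>R (q' - x))" 1 1 T0] nq' big T0 by auto
  have "x + t *\<^sub>R (q' - x) \<noteq> 0" if "0 < t" for t
  proof
    assume "x + t *\<^sub>R (q' - x) = 0"
    then have "w \<bullet> (x + t *\<^sub>R (q' - x)) = 0" by simp
    then have "t * (w \<bullet> (q' - x)) = 0" using xw by (simp only: inner_add_right inner_scaleR_right)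
    then show False using that q'(2) by simp
  qed
  then show ?thesis using that[of q' T] q'(1) T by (auto simp: d'_def)
qed

text \<open>The spheres about a fixed centre \<open>x\<close> with radius at most \<open>\<Lambda>\<close>. On the outer boundary \<open>|y| = 1\<close> the comparison is
  assumed; at the origin, where \<open>\<rho>\<close> may be singular, it has to be proved.\<close>

locale moving_sphere = conformal_equation U F
  for U :: "(real ^ 'n ^ 'n) set" and F +
  fixes \<Omega> :: "(real^'n) set" and \<rho> g H and x :: "real^'n" and \<Lambda> C :: real
  assumes r: "solution \<Omega> \<rho> g H" and \<Omega>: "cball 0 1 - {0} \<subseteq> \<Omega>"
    and \<Lambda>: "0 < \<Lambda>" "cball x \<Lambda> \<subseteq> ball 0 1 - {0}"
    and C: "\<And>y. y \<in> cball 0 1 - {0} \<Longrightarrow> \<rho> y \<le> C"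
    and strict: "\<And>l y. 0 < l \<Longrightarrow> l \<le> \<Lambda> \<Longrightarrow> norm y = 1 \<Longrightarrow> \<rho> y < kelvin x l \<rho> y"
begin

definition comparison :: "real \<Rightarrow> bool" where
  "comparison l \<longleftrightarrow> (\<forall>y. norm y \<le> 1 \<longrightarrow> y \<noteq> 0 \<longrightarrow> l \<le> norm (y - x) \<longrightarrow> \<rho> y \<le> kelvin x l \<rho> y)"

text \<open>On a ray \<open>x + t \<theta>\<close> the derivative of \<open>\<rho> / t\<close> is minus this quantity divided by \<open>t\<^sup>2\<close>.\<close>

definition radial_slack :: "real^'n \<Rightarrow> real" where
  "radial_slack y = \<rho> y - (y - x) \<bullet> g y"

lemmas jr = jet2_D[OF solution_D(1)[OF r]]

lemma \<rho>_pos: "y \<in> \<Omega> \<Longrightarrow> 0 < \<rho> y"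
  by (rule solution_D(2)[OF r])

lemma ball_sub: "cball x \<Lambda> \<subseteq> \<Omega>"
  using \<Lambda>(2) \<Omega> by force

lemma radial_slack_cont: "continuous_on \<Omega> radial_slack"
  unfolding radial_slack_def by (intro continuous_intros jr(3,4))

text \<open>With \<open>r = |y - x|\<close>, the assertion compares the values of \<open>\<rho>(x + t \<theta>) / t\<close> at \<open>t = r\<close> and at the inverted radius
  \<open>t = l\<^sup>2 / r \<le> r\<close>, and this quotient decreases in between.\<close>

lemma radial_comparison:
  assumes l: "0 < l" "l \<le> norm (y - x)"
    and radial_slack: "\<And>w. l^2 / norm (y - x) \<le> norm (w - x) \<Longrightarrow> norm (w - x) \<le> norm (y - x) \<Longrightarrow> w \<in> \<Omega> \<and> 0 < radial_slack w"
  shows "\<rho> y \<le> kelvin x l \<rho> y"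
proof -
  define r where "r = norm (y - x)"
  have r: "0 < r" "l \<le> r" using l by (auto simp: r_def)
  define s where "s = l^2 / r"
  have s: "0 < s" "s \<le> r"
    using l r mult_mono[of l r l r] by (auto simp: s_def field_simps power2_eq_square)
  define \<theta> where "\<theta> = (1 / r) *\<^sub>R (y - x)"
  have \<theta>: "norm \<theta> = 1" using r(1) by (simp add: \<theta>_def r_def)
  have "\<rho> (x + r *\<^sub>R \<theta>) / r \<le> \<rho> (x + s *\<^sub>R \<theta>) / s"
  proof (rule DERIV_nonpos_imp_nonincreasing[OF s(2), of "\<lambda>t. \<rho> (x + t *\<^sub>R \<theta>) / t"])
    fix t assume t: "s \<le> t" "t \<le> r"
    define w where "w = x + t *\<^sub>R \<theta>"
    have wx: "w - x = t *\<^sub>R \<theta>" "norm (w - x) = t" using t s \<theta> by (auto simp: w_def)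
    have w: "w \<in> \<Omega>" "0 < radial_slack w" using radial_slack[of w] wx t by (auto simp: s_def r_def)
    have "((\<lambda>t. \<rho> (x + t *\<^sub>R \<theta>)) has_real_derivative g w \<bullet> \<theta>) (at t)"
      unfolding w_def by (rule derivative_along_line) (use jr(5)[OF w(1)] in \<open>simp add: w_def\<close>)
    then have "((\<lambda>t. \<rho> (x + t *\<^sub>R \<theta>) / t) has_real_derivative ((g w \<bullet> \<theta>) * t - \<rho> w * 1) / (t * t)) (at t)"
      unfolding w_def using t s by (intro DERIV_divide DERIV_ident) auto
    moreover have "(g w \<bullet> \<theta>) * t - \<rho> w * 1 = - radial_slack w"
      by (simp add: radial_slack_def wx inner_commute)
    moreover have "- radial_slack w / (t * t) \<le> 0" using w(2) t s by (simp add: divide_nonpos_pos)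
    ultimately show "\<exists>y. ((\<lambda>t. \<rho> (x + t *\<^sub>R \<theta>) / t) has_real_derivative y) (at t) \<and> y \<le> 0" by auto
  qed
  moreover have "x + r *\<^sub>R \<theta> = y" using r(1) by (simp add: \<theta>_def)
  moreover have "x + s *\<^sub>R \<theta> = inversion x l y"
    using r(1) by (simp add: \<theta>_def s_def inversion_def dot_square_norm r_def power2_eq_square)
  ultimately have "\<rho> y / r \<le> \<rho> (inversion x l y) / s" by simp
  then have "\<rho> y \<le> r / s * \<rho> (inversion x l y)" using r s by (simp add: field_simps)
  also have "r / s = r^2 / l^2" using r l by (simp add: s_def power2_eq_square)
  finally show ?thesis by (simp add: kelvin_norm r_def)
qed

text \<open>At \<open>x\<close> the slack is \<open>\<rho>(x) > 0\<close>, so that the radial comparison applies on some ball about \<open>x\<close>. Outside this ball the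
  transform is at least of the order of \<open>1 / l\<^sup>2\<close> and exceeds the bound \<open>C\<close> of \<open>\<rho>\<close>.\<close>

lemma comparison_small: "\<exists>l1>0. \<forall>l. 0 < l \<longrightarrow> l \<le> l1 \<longrightarrow> comparison l"
proof -
  have x\<Omega>: "x \<in> \<Omega>" using ball_sub \<Lambda>(1) by auto
  have "0 < radial_slack x" using \<rho>_pos[OF x\<Omega>] by (simp add: radial_slack_def)
  moreover have "isCont radial_slack x" "isCont \<rho> x"
    using radial_slack_cont jr(1,3) x\<Omega> by (auto simp: continuous_on_eq_continuous_at)
  moreover have "\<rho> x / 2 < \<rho> x" using \<rho>_pos[OF x\<Omega>] by simp
  ultimately have "\<forall>\<^sub>F w in at x. 0 < radial_slack w" "\<forall>\<^sub>F w in at x. \<rho> x / 2 < \<rho> w"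
    unfolding isCont_def by (blast intro: order_tendstoD(1))+
  then have "\<forall>\<^sub>F w in at x. 0 < radial_slack w \<and> \<rho> x / 2 < \<rho> w" by (rule eventually_conj)
  then obtain b0 where b0: "0 < b0" "\<And>w. w \<noteq> x \<Longrightarrow> dist w x < b0 \<Longrightarrow> 0 < radial_slack w \<and> \<rho> x / 2 < \<rho> w"
    by (auto simp: eventually_at)
  define b where "b = min (b0 / 2) \<Lambda>"
  have b: "0 < b" "b \<le> \<Lambda>" "b < b0" using b0 \<Lambda> by (auto simp: b_def)
  have near: "w \<in> \<Omega> \<and> 0 < radial_slack w \<and> \<rho> x / 2 \<le> \<rho> w" if "norm (w - x) \<le> b" for w
  proof -
    have "w \<in> cball x \<Lambda>" using that b by (simp add: dist_norm norm_minus_commute)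
    moreover have "0 < radial_slack w \<and> \<rho> x / 2 \<le> \<rho> w"
    proof (cases "w = x")
      case True then show ?thesis using \<open>0 < radial_slack x\<close> \<rho>_pos[OF x\<Omega>] by simp
    next
      case False then show ?thesis using b0(2)[of w] that b by (auto simp: dist_norm)
    qed
    ultimately show ?thesis using ball_sub by blast
  qed
  define l2 where "l2 = b * sqrt (\<rho> x / (2 * (\<bar>C\<bar> + 1)))"
  have l2: "0 < l2" using b \<rho>_pos[OF x\<Omega>] by (simp add: l2_def add_nonneg_pos)
  have l2sq: "l2^2 * (\<bar>C\<bar> + 1) = b^2 * (\<rho> x / 2)"
  proof -
    have "l2^2 = b^2 * (\<rho> x / (2 * (\<bar>C\<bar> + 1)))"
      using \<rho>_pos[OF x\<Omega>] by (simp add: l2_def power_mult_distrib)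
    moreover have "\<bar>C\<bar> + 1 \<noteq> 0" by linarith
    ultimately show ?thesis by (simp add: field_simps)
  qed
  show ?thesis
  proof (intro exI conjI allI impI)
    show "0 < min b l2" using b l2 by simp
    fix l assume l: "0 < l" "l \<le> min b l2"
    show "comparison l"
      unfolding comparison_def
    proof (intro allI impI)
      fix y :: "real^'n" assume y: "norm y \<le> 1" "y \<noteq> 0" "l \<le> norm (y - x)"
      show "\<rho> y \<le> kelvin x l \<rho> y"
      proof (cases "norm (y - x) \<le> b")
        case True
        then show ?thesis using near by (intro radial_comparison l y) force
      next
        case False
        then have yb: "b < norm (y - x)" by simp
        have yx: "y \<noteq> x" using False b by auto
        have "norm (inversion x l y - x) \<le> b"
        proof -
          have "l * l \<le> b * norm (y - x)" using l yb by (intro mult_mono) auto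
          then show ?thesis using yb b yx by (simp add: norm_inversion field_simps power2_eq_square)
        qed
        from near[OF this] have J: "\<rho> x / 2 \<le> \<rho> (inversion x l y)" by simp
        have "l^2 * (\<bar>C\<bar> + 1) \<le> l2^2 * (\<bar>C\<bar> + 1)"
          using l by (intro mult_right_mono power_mono) auto
        also have "\<dots> \<le> (norm (y - x))^2 * \<rho> (inversion x l y)"
          unfolding l2sq using yb b J \<rho>_pos[OF x\<Omega>] by (intro mult_mono power_mono) auto
        finally have "\<bar>C\<bar> + 1 \<le> kelvin x l \<rho> y" using l by (simp add: kelvin_norm field_simps)
        moreover have "\<rho> y \<le> C" using y by (intro C) simp
        ultimately show ?thesis by linarith
      qed
    qed
  qed
qed

lemma inversion_in_ball:
  assumes "0 < l" "l \<le> \<Lambda>" "l \<le> norm (y - x)"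
  shows "inversion x l y \<in> cball x \<Lambda>"
proof -
  have "y \<noteq> x" using assms by auto
  moreover have "l * l \<le> \<Lambda> * norm (y - x)" using assms by (intro mult_mono) auto
  ultimately have "norm (inversion x l y - x) \<le> \<Lambda>"
    using assms by (simp add: norm_inversion field_simps power2_eq_square)
  then show ?thesis by (simp add: dist_norm norm_minus_commute)
qed

lemma kelvin_tendsto:
  assumes l: "0 < l" "l \<le> \<Lambda>" "l \<le> norm (y - x)"
    and m: "(m \<longlongrightarrow> l) Fl" and z: "(z \<longlongrightarrow> y) Fl"
  shows "((\<lambda>k. kelvin x (m k) \<rho> (z k)) \<longlongrightarrow> kelvin x l \<rho> y) Fl"
proof -
  have yx: "(y - x) \<bullet> (y - x) \<noteq> 0" using l by auto
  have "isCont \<rho> (inversion x l y)"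
    using jr(1,3) ball_sub inversion_in_ball[OF l] by (auto simp: continuous_on_eq_continuous_at)
  moreover have "((\<lambda>k. inversion x (m k) (z k)) \<longlongrightarrow> inversion x l y) Fl"
    unfolding inversion_def by (intro tendsto_intros m z yx)
  ultimately have "((\<lambda>k. \<rho> (inversion x (m k) (z k))) \<longlongrightarrow> \<rho> (inversion x l y)) Fl"
    by (rule isCont_tendsto_compose)
  then show ?thesis unfolding kelvin_def by (intro tendsto_intros m z) (use l in auto)
qed

lemma comparison_closed:
  assumes l: "0 < l" "l \<le> \<Lambda>" and lt: "\<And>m. 0 < m \<Longrightarrow> m < l \<Longrightarrow> comparison m"
  shows "comparison l"
  unfolding comparison_def
proof (intro allI impI)
  fix y :: "real^'n" assume y: "norm y \<le> 1" "y \<noteq> 0" "l \<le> norm (y - x)"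
  have "((\<lambda>m. kelvin x m \<rho> y) \<longlongrightarrow> kelvin x l \<rho> y) (at_left l)"
    by (rule kelvin_tendsto[OF l y(3)]) (auto intro: tendsto_intros)
  moreover have "\<forall>\<^sub>F m in at_left l. \<rho> y \<le> kelvin x m \<rho> y"
    unfolding eventually_at_left_field
  proof (intro exI conjI allI impI)
    show "0 < l" by (rule l)
    fix m assume m: "0 < m" "m < l"
    then show "\<rho> y \<le> kelvin x m \<rho> y" using lt[OF m] y by (auto simp: comparison_def)
  qed
  ultimately show "\<rho> y \<le> kelvin x l \<rho> y"
    by (rule tendsto_lowerbound) simp
qed

text \<open>The points whose inversion lies in the open ball of radius \<open>\<Lambda>\<close> about \<open>x\<close>, where \<open>\<rho>\<close> is a solution. For \<open>l < \<Lambda>\<close> this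
  includes a neighbourhood of the exterior of the sphere of radius \<open>l\<close>.\<close>

definition kelvin_domain :: "real \<Rightarrow> (real^'n) set" where
  "kelvin_domain l = - cball x (l^2 / \<Lambda>)"

lemma kelvin_domain_I: "0 < l \<Longrightarrow> l < \<Lambda> \<Longrightarrow> l \<le> norm (y - x) \<Longrightarrow> y \<in> kelvin_domain l"
proof -
  assume l: "0 < l" "l < \<Lambda>" "l \<le> norm (y - x)"
  then have "l^2 / \<Lambda> < l" by (simp add: field_simps power2_eq_square)
  then show ?thesis using l by (simp add: kelvin_domain_def dist_norm norm_minus_commute)
qed

lemma solution_kelvin_domain:
  assumes l: "0 < l" "l < \<Lambda>"
  shows "solution (kelvin_domain l) (kelvin x l \<rho>) (kelvin_grad x l \<rho> g) (kelvin_hess x l \<rho> g H)"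
proof (rule solution_kelvin[OF r l(1)])
  show "open (kelvin_domain l)" by (auto simp: kelvin_domain_def)
  fix y assume "y \<in> kelvin_domain l"
  then have y: "l^2 / \<Lambda> < norm (y - x)" by (simp add: kelvin_domain_def dist_norm norm_minus_commute)
  moreover have "0 < l^2 / \<Lambda>" using l by simp
  ultimately have "y \<noteq> x" by (auto simp: not_less_iff_gr_or_eq)
  moreover have "norm (inversion x l y - x) \<le> \<Lambda>"
    using y l \<open>y \<noteq> x\<close> by (simp add: norm_inversion field_simps)
  then have "inversion x l y \<in> \<Omega>" using ball_sub by (auto simp: dist_norm norm_minus_commute)
  ultimately show "y \<noteq> x \<and> inversion x l y \<in> \<Omega>" by blast
qed

context
  fixes l assumes l: "0 < l" "l < \<Lambda>" and gl: "comparison l"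
begin

text \<open>By the strong maximum principle the set of contact is open along a ray that leads to the unit
  sphere, so a contact would persist up to the unit sphere, where the inequality is strict.\<close>

lemma strict_outside:
  assumes q: "norm q \<le> 1" "q \<noteq> 0" "l < norm (q - x)"
  shows "\<rho> q < kelvin x l \<rho> q"
proof (rule ccontr)
  assume "\<not> ?thesis"
  with gl q have eq: "\<rho> q = kelvin x l \<rho> q" by (force simp: comparison_def)
  have bd: "norm y < 1" if "norm y \<le> 1" "\<rho> y = kelvin x l \<rho> y" for y
    using strict[of l y] l that by fastforce
  define V where "V = ball 0 1 - {0} - cball x l"
  have V: "open V" unfolding V_def by (intro open_Diff) auto
  have V1: "V \<subseteq> \<Omega>" using \<Omega> by (force simp: V_def)
  have V2: "V \<subseteq> kelvin_domain l" using kelvin_domain_I[OF l] by (force simp: V_def dist_norm norm_minus_commute)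
  have le: "\<rho> y \<le> kelvin x l \<rho> y" if "y \<in> V" for y
    using gl that by (auto simp: comparison_def V_def dist_norm norm_minus_commute)
  have smp: "\<exists>d>0. \<forall>y\<in>ball p d. y \<in> V \<and> \<rho> y = kelvin x l \<rho> y" if "p \<in> V" "\<rho> p = kelvin x l \<rho> p" for p
    by (rule strong_maximum_principle[OF solution_subset[OF solution_kelvin_domain[OF l] V V2] solution_subset[OF r V V1]])
       (use le that in auto)
  have inV: "y \<in> V" if "norm y \<le> 1" "y \<noteq> 0" "l < norm (y - x)" "\<rho> y = kelvin x l \<rho> y" for y
    using bd[OF that(1,4)] that by (auto simp: V_def dist_norm norm_minus_commute)
  obtain d where d: "0 < d" "\<And>y. y \<in> ball q d \<Longrightarrow> y \<in> V \<and> \<rho> y = kelvin x l \<rho> y"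
    using smp[OF inV[OF q eq] eq] by blast
  have "q \<noteq> x" using q l by auto
  then obtain q' T where q': "q' \<in> ball q d" "1 \<le> T" "norm (x + T *\<^sub>R (q' - x)) = 1"
    "\<And>t. 0 < t \<Longrightarrow> x + t *\<^sub>R (q' - x) \<noteq> 0"
    using exists_crossing_segment[of q x d] n bd[OF q(1) eq] d(1) by auto
  have q'V: "q' \<in> V" "\<rho> q' = kelvin x l \<rho> q'" using d(2)[OF q'(1)] by auto
  define \<gamma> where "\<gamma> t = x + t *\<^sub>R (q' - x)" for t
  have \<gamma>1: "norm (\<gamma> t) \<le> 1" if t: "t \<in> {1..T}" for t
  proof (cases "T = 1")
    case True then show ?thesis using that q'(3) by (simp add: \<gamma>_def)
  next
    case False
    define a where "a = (t - 1) / (T - 1)"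
    have a: "0 \<le> a" "a \<le> 1" using t q'(2) False by (auto simp: a_def)
    have "t = 1 + a * (T - 1)" using False by (simp add: a_def)
    moreover have "x + (1 + a * (T - 1)) *\<^sub>R v = (1 - a) *\<^sub>R (x + v) + a *\<^sub>R (x + T *\<^sub>R v)" for v
      by (simp add: algebra_simps)
    from this[of "q' - x"] have "x + (1 + a * (T - 1)) *\<^sub>R (q' - x) = (1 - a) *\<^sub>R q' + a *\<^sub>R (x + T *\<^sub>R (q' - x))"
      by simp
    ultimately have "\<gamma> t = (1 - a) *\<^sub>R q' + a *\<^sub>R (x + T *\<^sub>R (q' - x))"
      by (simp only: \<gamma>_def)
    also have "\<dots> \<in> cball 0 1"
      by (rule convexD_alt[OF convex_cball _ _ a]) (use q'V(1) q'(3) in \<open>auto simp: V_def\<close>)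
    finally show ?thesis by simp
  qed
  have \<gamma>2: "l < norm (\<gamma> t - x)" if t: "t \<in> {1..T}" for t
  proof -
    have "l < norm (q' - x)" using q'V(1) by (auto simp: V_def dist_norm norm_minus_commute)
    also have "\<dots> \<le> norm (\<gamma> t - x)" using t mult_right_mono[of 1 t "norm (q' - x)"] by (simp add: \<gamma>_def)
    finally show ?thesis .
  qed
  have \<gamma>0: "\<gamma> t \<noteq> 0" if t: "t \<in> {1..T}" for t using q'(4)[of t] t by (simp add: \<gamma>_def)
  have \<gamma>c: "continuous_on A \<gamma>" for A unfolding \<gamma>_def by (intro continuous_intros)
  have "continuous_on {1..T} (\<lambda>t. \<rho> (\<gamma> t) - kelvin x l \<rho> (\<gamma> t))"
  proof (intro continuous_intros)
    show "continuous_on {1..T} (\<lambda>t. \<rho> (\<gamma> t))"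
      by (rule continuous_on_compose2[OF jr(3) \<gamma>c]) (use \<gamma>1 \<gamma>0 \<Omega> in force)
    show "continuous_on {1..T} (\<lambda>t. kelvin x l \<rho> (\<gamma> t))"
      by (rule continuous_on_compose2[OF jet2_D(3)[OF solution_D(1)[OF solution_kelvin_domain[OF l]]] \<gamma>c])
         (use \<gamma>2 kelvin_domain_I[OF l] in force)
  qed
  then have cl: "closedin (top_of_set {1..T}) {t \<in> {1..T}. \<rho> (\<gamma> t) - kelvin x l \<rho> (\<gamma> t) = 0}"
    by (rule continuous_closedin_preimage_constant)
  have op: "openin (top_of_set {1..T}) {t \<in> {1..T}. \<rho> (\<gamma> t) - kelvin x l \<rho> (\<gamma> t) = 0}"
    unfolding openin_euclidean_subtopology_iff
  proof (intro conjI ballI)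
    fix t assume t: "t \<in> {t \<in> {1..T}. \<rho> (\<gamma> t) - kelvin x l \<rho> (\<gamma> t) = 0}"
    then have eqt: "\<rho> (\<gamma> t) = kelvin x l \<rho> (\<gamma> t)" and tT: "t \<in> {1..T}" by auto
    obtain e where e: "0 < e" "\<And>y. y \<in> ball (\<gamma> t) e \<Longrightarrow> \<rho> y = kelvin x l \<rho> y"
      using smp[OF inV[OF \<gamma>1[OF tT] \<gamma>0[OF tT] \<gamma>2[OF tT] eqt] eqt] by blast
    obtain e' where e': "0 < e'" "\<And>t'. t' \<in> {1..T} \<Longrightarrow> dist t' t < e' \<Longrightarrow> dist (\<gamma> t') (\<gamma> t) < e"
      using \<gamma>c[of "{1..T}"] tT e(1) unfolding continuous_on_iff by blast
    show "\<exists>e>0. \<forall>t'\<in>{1..T}. dist t' t < e \<longrightarrow> t' \<in> {t \<in> {1..T}. \<rho> (\<gamma> t) - kelvin x l \<rho> (\<gamma> t) = 0}"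
    proof (intro exI conjI ballI impI)
      fix t' assume "t' \<in> {1..T}" "dist t' t < e'"
      with e'(2) e(2)[of "\<gamma> t'"] show "t' \<in> {t \<in> {1..T}. \<rho> (\<gamma> t) - kelvin x l \<rho> (\<gamma> t) = 0}"
        by (simp add: dist_commute)
    qed (rule e')
  qed auto
  have "1 \<in> {t \<in> {1..T}. \<rho> (\<gamma> t) - kelvin x l \<rho> (\<gamma> t) = 0}" using q'V q'(2) by (simp add: \<gamma>_def)
  moreover have "connected {1..T}" by simp
  ultimately have "{t \<in> {1..T}. \<rho> (\<gamma> t) - kelvin x l \<rho> (\<gamma> t) = 0} = {1..T}"
    using cl op unfolding connected_clopen by blast
  then have "T \<in> {t \<in> {1..T}. \<rho> (\<gamma> t) - kelvin x l \<rho> (\<gamma> t) = 0}" using q'(2) by auto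
  then have "\<rho> (\<gamma> T) = kelvin x l \<rho> (\<gamma> T)" by simp
  from bd[OF _ this] show False using q'(3) by (simp add: \<gamma>_def)
qed

text \<open>The boundary point lemma in a ball that touches the sphere at \<open>p\<close> from outside. On the sphere, the inner product of \<open>p - x\<close>
  with the gradient of \<open>kelvin x l \<rho> - \<rho>\<close> is twice the slack at \<open>p\<close>.\<close>

lemma radial_slack_pos_sphere:
  assumes p: "norm (p - x) = l"
  shows "0 < radial_slack p"
proof -
  define V where "V = (ball 0 1 - {0}) \<inter> kelvin_domain l"
  have V: "open V" unfolding V_def by (intro open_Int open_Diff) (auto simp: kelvin_domain_def)
  have V1: "V \<subseteq> \<Omega>" using \<Omega> by (force simp: V_def)
  have V2: "V \<subseteq> kelvin_domain l" by (auto simp: V_def)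
  have "p \<in> cball x \<Lambda>" using p l by (simp add: dist_norm norm_minus_commute)
  then have "p \<in> ball 0 1 - {0}" using \<Lambda>(2) by blast
  then have pV: "p \<in> V" using kelvin_domain_I[OF l] p by (simp add: V_def)
  then obtain e where e: "0 < e" "ball p e \<subseteq> V" using V open_contains_ball by blast
  define t where "t = e / (4 * l)"
  have t: "0 < t" using e l by (simp add: t_def)
  have tl: "t * l = e / 4" using l by (simp add: t_def)
  define z where "z = p + t *\<^sub>R (p - x)"
  have sub: "cball z (t * l) \<subseteq> V"
  proof
    fix w assume w: "w \<in> cball z (t * l)"
    have "dist p z = t * l" using t p by (simp add: z_def dist_norm)
    then have "dist p w < e" using dist_triangle[of p w z] w tl e(1) by simp
    then show "w \<in> V" using e(2) by auto
  qed
  have below: "\<rho> w < kelvin x l \<rho> w" if w: "w \<in> cball z (t * l)" "w \<noteq> p" for w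
  proof (rule strict_outside)
    have "w \<in> V" using sub w(1) by blast
    then show "norm w \<le> 1" "w \<noteq> 0" by (auto simp: V_def)
    have zx: "z - x = (1 + t) *\<^sub>R (p - x)" by (simp add: z_def algebra_simps)
    have wz: "norm (w - z) \<le> t * l" using w(1) by (simp add: dist_norm norm_minus_commute)
    show "l < norm (w - x)"
    proof (rule ccontr)
      assume "\<not> l < norm (w - x)"
      then have le: "norm (w - x) \<le> l" by simp
      have "(norm (w - z))^2 = (norm ((w - x) - (1 + t) *\<^sub>R (p - x)))^2"
        unfolding zx[symmetric] by simp
      also have "\<dots> = (norm (w - x))^2 - 2 * (1 + t) * ((w - x) \<bullet> (p - x)) + (1 + t)^2 * l^2"
      proof -
        have "(norm (a - c *\<^sub>R b))^2 = (norm a)^2 - 2 * c * (a \<bullet> b) + c^2 * (norm b)^2" for a b :: "real^'n" and c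
          unfolding power2_norm_eq_inner
          by (simp add: inner_diff_left inner_diff_right inner_commute[of b a] power2_eq_square algebra_simps)
        then show ?thesis using p by simp
      qed
      finally have 1: "(norm (w - z))^2 = (norm (w - x))^2 - 2 * (1 + t) * ((w - x) \<bullet> (p - x)) + (1 + t)^2 * l^2" .
      have 2: "(norm (w - p))^2 = (norm (w - x))^2 - 2 * ((w - x) \<bullet> (p - x)) + l^2"
      proof -
        have "(norm (a - b))^2 = (norm a)^2 - 2 * (a \<bullet> b) + (norm b)^2" for a b :: "real^'n"
          by (simp add: power2_norm_eq_inner inner_diff_left inner_diff_right inner_commute)
        from this[of "w - x" "p - x"] show ?thesis unfolding p by simp
      qed
      have "(norm (w - z))^2 \<le> (t * l)^2" using wz by (intro power_mono) auto
      moreover have "(norm (w - x))^2 \<le> l^2" using le by (intro power_mono) auto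
      then have "t * (norm (w - x))^2 \<le> t * l^2" using t by simp
      moreover have "(1 + t) * (norm (w - p))^2 = (norm (w - z))^2 + t * (norm (w - x))^2 - t * l^2 - (t * l)^2"
        unfolding 1 2 by (simp add: power2_eq_square algebra_simps)
      ultimately have "(1 + t) * (norm (w - p))^2 \<le> 0" by linarith
      then show False using t w(2) by (simp add: mult_le_0_iff)
    qed
  qed
  have "0 < (kelvin_grad x l \<rho> g p - g p) \<bullet> (z - p)"
    by (rule hopf_boundary[OF solution_subset[OF solution_kelvin_domain[OF l] V V2] solution_subset[OF r V V1] _ sub _ _ below])
       (use t l p kelvin_on_sphere[OF l(1) p] in \<open>auto simp: z_def\<close>)
  then have "0 < t * ((kelvin_grad x l \<rho> g p - g p) \<bullet> (p - x))"
    by (simp only: z_def add_diff_cancel_left' inner_scaleR_right)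
  then have pos: "0 < (kelvin_grad x l \<rho> g p - g p) \<bullet> (p - x)" using t by (simp add: zero_less_mult_iff)
  have ll: "(p - x) \<bullet> (p - x) = l^2" using p by (simp add: dot_square_norm)
  have "(reflection (p - x) *v g p) \<bullet> (p - x) = - (g p \<bullet> (p - x))"
  proof -
    have "(reflection (p - x) *v g p) \<bullet> (p - x) = g p \<bullet> (p - x) - (2 * ((p - x) \<bullet> g p) / l^2) * l^2"
      unfolding reflection_vec ll by (simp only: inner_diff_left[of "g p"] inner_scaleR_left ll)
    then show ?thesis using l by (simp add: inner_commute[of "p - x"])
  qed
  moreover have "kelvin_grad x l \<rho> g p \<bullet> (p - x) = (2 / l^2 * \<rho> p) * l^2 + (reflection (p - x) *v g p) \<bullet> (p - x)"
    unfolding kelvin_grad_def inversion_on_sphere[OF l(1) p] by (simp only: inner_add_left inner_scaleR_left ll)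
  ultimately have "(kelvin_grad x l \<rho> g p - g p) \<bullet> (p - x) = 2 * radial_slack p"
    using l by (simp add: radial_slack_def inner_diff_left[of "kelvin_grad x l \<rho> g p"] inner_commute[of "g p"])
  then show ?thesis using pos by simp
qed

lemma radial_slack_pos_annulus: "\<exists>a>0. a < l \<and> l + a \<le> \<Lambda> \<and> (\<forall>w. l - a \<le> norm (w - x) \<longrightarrow> norm (w - x) \<le> l + a \<longrightarrow> w \<in> \<Omega> \<and> 0 < radial_slack w)"
proof -
  define B where "B = {w \<in> cball x \<Lambda>. radial_slack w \<in> {..0}}"
  have "closed B" unfolding B_def
    by (rule continuous_closed_preimage[OF continuous_on_subset[OF radial_slack_cont ball_sub], unfolded vimage_def Int_def mem_Collect_eq]) auto
  then have B: "compact B"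
    unfolding B_def by (metis (no_types, lifting) bounded_cball bounded_subset compact_eq_bounded_closed mem_Collect_eq subsetI)
  have "\<exists>m>0. \<forall>w\<in>B. m \<le> \<bar>norm (w - x) - l\<bar>"
  proof (cases "B = {}")
    case False
    have "continuous_on B (\<lambda>w. \<bar>norm (w - x) - l\<bar>)" by (intro continuous_intros)
    from continuous_attains_inf[OF B False this] obtain w where
      w: "w \<in> B" "\<And>v. v \<in> B \<Longrightarrow> \<bar>norm (w - x) - l\<bar> \<le> \<bar>norm (v - x) - l\<bar>" by blast
    have "norm (w - x) \<noteq> l" using radial_slack_pos_sphere[of w] w(1) by (auto simp: B_def)
    then show ?thesis using w by (intro exI[of _ "\<bar>norm (w - x) - l\<bar>"]) auto
  qed (auto intro: exI[of _ 1])
  then obtain m where m: "0 < m" "\<And>w. w \<in> B \<Longrightarrow> m \<le> \<bar>norm (w - x) - l\<bar>" by blast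
  define a where "a = min (m / 2) (min (\<Lambda> - l) (l / 2))"
  have a: "0 < a" "a < l" "l + a \<le> \<Lambda>" "a < m" using m l by (auto simp: a_def)
  have "w \<in> \<Omega> \<and> 0 < radial_slack w" if w: "l - a \<le> norm (w - x)" "norm (w - x) \<le> l + a" for w
  proof -
    have "w \<in> cball x \<Lambda>" using w a by (simp add: dist_norm norm_minus_commute)
    moreover have "\<bar>norm (w - x) - l\<bar> \<le> a" using w by linarith
    then have "w \<notin> B" using m(2)[of w] a(4) by linarith
    ultimately show ?thesis using ball_sub by (auto simp: B_def)
  qed
  then show ?thesis using a by blast
qed

lemma gap_at_origin: "\<exists>\<kappa>>0. \<exists>d>0. \<forall>y. 0 < norm y \<longrightarrow> norm y < d \<longrightarrow> \<rho> y \<le> kelvin x l \<rho> y - \<kappa>"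
proof -
  have "0 \<notin> cball x \<Lambda>" using \<Lambda>(2) by blast
  then have x0: "l < norm x" using l by simp
  define d where "d = min 1 (norm x - l)"
  have d: "0 < d" using x0 by (simp add: d_def)
  have V2: "ball 0 d \<subseteq> kelvin_domain l"
  proof
    fix y :: "real^'n" assume "y \<in> ball 0 d"
    then show "y \<in> kelvin_domain l" using norm_triangle_ineq2[of x y]
      by (intro kelvin_domain_I l) (simp add: d_def norm_minus_commute)
  qed
  have V1: "ball 0 d - {0} \<subseteq> \<Omega>" using \<Omega> by (force simp: d_def)
  have below: "\<rho> y < kelvin x l \<rho> y" if y: "y \<in> ball 0 d - {0}" for y
    using y norm_triangle_ineq2[of x y]
    by (intro strict_outside) (auto simp: d_def norm_minus_commute)
  have "open (ball 0 d - {0::real^'n})" by (intro open_Diff) auto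
  from isolated_contact_gap[OF solution_subset[OF solution_kelvin_domain[OF l] open_ball V2] _ solution_subset[OF r this V1] below]
  show ?thesis using d by simp
qed

text \<open>If the comparison failed for radii arbitrarily close to \<open>l\<close>, the points of failure would accumulate
  somewhere: not near the sphere, because the slack is positive in an annulus; not at 0, because of the gap there;
  and not elsewhere, because the inequality for the radius \<open>l\<close> is strict.\<close>

lemma comparison_beyond: "\<exists>e>0. \<forall>m. l < m \<longrightarrow> m < l + e \<longrightarrow> comparison m"
proof (rule ccontr)
  assume contra: "\<not> ?thesis"
  obtain a where a: "0 < a" "a < l" "l + a \<le> \<Lambda>"
    "\<And>w. l - a \<le> norm (w - x) \<Longrightarrow> norm (w - x) \<le> l + a \<Longrightarrow> w \<in> \<Omega> \<and> 0 < radial_slack w"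
    using radial_slack_pos_annulus by blast
  obtain \<kappa> d where \<kappa>: "0 < \<kappa>" "0 < d" "\<And>y. 0 < norm y \<Longrightarrow> norm y < d \<Longrightarrow> \<rho> y \<le> kelvin x l \<rho> y - \<kappa>"
    using gap_at_origin by blast
  have "\<exists>m y. l < m \<and> m < l + 1 / real (Suc k) \<and> m \<le> \<Lambda> \<and> norm y \<le> 1 \<and> y \<noteq> 0 \<and> m \<le> norm (y - x) \<and> kelvin x m \<rho> y < \<rho> y" for k
  proof -
    have "0 < min (1 / real (Suc k)) (\<Lambda> - l)" using l by simp
    then obtain m where m: "l < m" "m < l + min (1 / real (Suc k)) (\<Lambda> - l)" "\<not> comparison m"
      using contra by blast
    from m(3) obtain y where "norm y \<le> 1" "y \<noteq> 0" "m \<le> norm (y - x)" "kelvin x m \<rho> y < \<rho> y"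
      by (auto simp: comparison_def not_le)
    moreover have "m < l + 1 / real (Suc k)" "m \<le> \<Lambda>" using m(2) by linarith+
    ultimately show ?thesis using m(1) by blast
  qed
  then obtain m y where my: "\<And>k. l < m k" "\<And>k. m k < l + 1 / real (Suc k)" "\<And>k. m k \<le> \<Lambda>"
    "\<And>k. norm (y k) \<le> 1" "\<And>k. y k \<noteq> 0" "\<And>k. m k \<le> norm (y k - x)" "\<And>k. kelvin x (m k) \<rho> (y k) < \<rho> (y k)"
    by metis
  have mlim: "m \<longlonglongrightarrow> l"
  proof (rule tendsto_sandwich[where f = "\<lambda>k. l" and h = "\<lambda>k. l + 1 / real (Suc k)"])
    show "(\<lambda>k. l + 1 / real (Suc k)) \<longlonglongrightarrow> l" using tendsto_add[OF tendsto_const[of l] tendsto_inverse_Suc] by simp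
    show "(\<lambda>k. l) \<longlonglongrightarrow> l" by simp
    show "\<forall>\<^sub>F k in sequentially. l \<le> m k" using my(1) by (simp add: less_imp_le)
    show "\<forall>\<^sub>F k in sequentially. m k \<le> l + 1 / real (Suc k)"
      using my(2) by (intro always_eventually allI less_imp_le)
  qed
  have far: "l + a < norm (y k - x)" for k
  proof (rule ccontr)
    assume nfar: "\<not> l + a < norm (y k - x)"
    have "\<rho> (y k) \<le> kelvin x (m k) \<rho> (y k)"
    proof (rule radial_comparison)
      show "0 < m k" "m k \<le> norm (y k - x)" using my l by (auto intro: less_trans)
      fix w assume w: "(m k)^2 / norm (y k - x) \<le> norm (w - x)" "norm (w - x) \<le> norm (y k - x)"
      have yp: "0 < norm (y k - x)" using \<open>0 < m k\<close> my(6)[of k] by linarith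
      have "(l - a) * norm (y k - x) \<le> (l - a) * (l + a)" using nfar a by (intro mult_left_mono) auto
      also have "\<dots> \<le> l * l" by (simp add: algebra_simps)
      also have "\<dots> \<le> m k * m k" using my(1)[of k] l by (intro mult_mono) auto
      finally have "l - a \<le> (m k)^2 / norm (y k - x)" using yp by (simp add: field_simps power2_eq_square)
      then show "w \<in> \<Omega> \<and> 0 < radial_slack w" using w nfar by (intro a(4)) auto
    qed
    then show False using my(7)[of k] by simp
  qed
  have "compact (cball (0::real^'n) 1)" by simp
  moreover have "\<forall>k. y k \<in> cball 0 1" using my(4) by simp
  ultimately obtain ys \<phi> where \<phi>: "ys \<in> cball 0 1" "strict_mono \<phi>" "(y \<circ> \<phi>) \<longlonglongrightarrow> ys"
    unfolding compact_def by meson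
  have m\<phi>: "(m \<circ> \<phi>) \<longlonglongrightarrow> l" by (rule LIMSEQ_subseq_LIMSEQ[OF mlim \<phi>(2)])
  have ysx: "l + a \<le> norm (ys - x)"
  proof (rule LIMSEQ_le_const)
    show "(\<lambda>k. norm ((y \<circ> \<phi>) k - x)) \<longlonglongrightarrow> norm (ys - x)" by (intro tendsto_intros \<phi>)
  qed (use far in \<open>auto intro!: less_imp_le\<close>)
  have kl: "(\<lambda>k. kelvin x ((m \<circ> \<phi>) k) \<rho> ((y \<circ> \<phi>) k)) \<longlonglongrightarrow> kelvin x l \<rho> ys"
    using ysx a l by (intro kelvin_tendsto m\<phi> \<phi>) auto
  have kl': "(\<lambda>k. kelvin x l \<rho> ((y \<circ> \<phi>) k)) \<longlonglongrightarrow> kelvin x l \<rho> ys"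
    using ysx a l by (intro kelvin_tendsto \<phi> tendsto_const) auto
  show False
  proof (cases "ys = 0")
    case True
    from tendstoD[OF \<phi>(3) \<kappa>(2)] obtain M where M: "\<And>k. M \<le> k \<Longrightarrow> dist ((y \<circ> \<phi>) k) ys < d"
      by (auto simp: eventually_sequentially)
    have "kelvin x l \<rho> ys \<le> kelvin x l \<rho> ys - \<kappa>"
    proof (rule LIMSEQ_le[OF kl tendsto_diff[OF kl' tendsto_const]], intro exI allI impI)
      fix k assume "M \<le> k"
      then have "\<rho> ((y \<circ> \<phi>) k) \<le> kelvin x l \<rho> ((y \<circ> \<phi>) k) - \<kappa>"
        using M[of k] True my(5) by (intro \<kappa>(3)) auto
      then show "kelvin x ((m \<circ> \<phi>) k) \<rho> ((y \<circ> \<phi>) k) \<le> kelvin x l \<rho> ((y \<circ> \<phi>) k) - \<kappa>"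
        using my(7)[of "\<phi> k"] by simp
    qed
    then show False using \<kappa>(1) by simp
  next
    case False
    then have "ys \<in> \<Omega>" using \<phi>(1) \<Omega> by auto
    then have "isCont \<rho> ys" using jr(1,3) by (auto simp: continuous_on_eq_continuous_at)
    then have rl: "(\<lambda>k. \<rho> ((y \<circ> \<phi>) k)) \<longlonglongrightarrow> \<rho> ys" using \<phi>(3) by (rule isCont_tendsto_compose)
    have "kelvin x l \<rho> ys \<le> \<rho> ys"
      by (rule LIMSEQ_le[OF kl rl]) (use my(7) in \<open>auto intro!: less_imp_le\<close>)
    moreover have "\<rho> ys < kelvin x l \<rho> ys" using False \<phi>(1) ysx a by (intro strict_outside) auto
    ultimately show False by simp
  qed
qed

end

lemma comparison_all_spheres:
  assumes "0 < l" "l \<le> \<Lambda>" shows "comparison l"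
proof (rule ccontr)
  assume bad: "\<not> comparison l"
  obtain l1 where l1: "0 < l1" "\<And>m. 0 < m \<Longrightarrow> m \<le> l1 \<Longrightarrow> comparison m" using comparison_small by blast
  define B where "B = {m. 0 < m \<and> \<not> comparison m}"
  define m where "m = Inf B"
  have lB: "l \<in> B" using bad assms by (simp add: B_def)
  have bdd: "bdd_below B" by (rule bdd_belowI[of _ 0]) (simp add: B_def)
  have low: "l1 \<le> m"
    unfolding m_def
  proof (rule cInf_greatest)
    fix b assume "b \<in> B" then show "l1 \<le> b" using l1(2)[of b] by (force simp: B_def)
  qed (use lB in auto)
  then have m0: "0 < m" using l1 by simp
  have ml: "m \<le> l" unfolding m_def by (rule cInf_lower[OF lB bdd])
  have below: "comparison b" if "0 < b" "b < m" for b
    using cInf_lower[OF _ bdd, of b] that by (force simp: B_def m_def)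
  have gm: "comparison m" by (rule comparison_closed) (use m0 ml assms below in auto)
  then have "m \<noteq> l" using bad by blast
  then have "m < \<Lambda>" using ml assms by simp
  from comparison_beyond[OF m0 this gm] obtain e where e: "0 < e" "\<And>b. m < b \<Longrightarrow> b < m + e \<Longrightarrow> comparison b" by blast
  have "Inf B < m + e" using e by (simp add: m_def)
  then obtain b where b: "b \<in> B" "b < m + e" using cInf_lessD[of B "m + e"] lB by blast
  have "m \<le> b" unfolding m_def by (rule cInf_lower[OF b(1) bdd])
  then have "comparison b" using gm e(2)[OF _ b(2)] by (cases "b = m") auto
  then show False using b(1) by (simp add: B_def)
qed

end

section \<open>Blow-up at the singularity\<close>

lemma matrix_norm_le_of_entries:
  fixes A :: "real^'n^'n"
  assumes "\<And>i j. \<bar>A$i$j\<bar> \<le> K"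
  shows "norm A \<le> (real CARD('n))^2 * K"
proof -
  have row: "norm (A$i) \<le> real CARD('n) * K" for i
  proof -
    have "norm (A$i) \<le> (\<Sum>j\<in>UNIV. \<bar>A$i$j\<bar>)" by (rule norm_le_l1_cart)
    also have "\<dots> \<le> (\<Sum>j\<in>(UNIV::'n set). K)" by (intro sum_mono assms)
    finally show ?thesis by simp
  qed
  have "norm A \<le> (\<Sum>i\<in>UNIV. norm (A$i))"
    unfolding norm_vec_def[of A] by (rule L2_set_le_sum) simp
  also have "\<dots> \<le> (\<Sum>i\<in>(UNIV::'n set). real CARD('n) * K)" by (intro sum_mono row)
  finally show ?thesis by (simp add: power2_eq_square mult.assoc)
qed

text \<open>All eigenvalues are at most \<open>c\<close> and their sum is nonnegative, so they are at least \<open>- (n - 1) c\<close>. The unit vectors and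
  the vectors \<open>e\<^sub>i \<plusminus> e\<^sub>j\<close> play the part of the eigenvectors.\<close>

lemma entries_bounded_by_top_and_trace:
  fixes H :: "real^'n^'n"
  assumes H: "H \<in> sym_matrices" and up: "\<And>v. v \<bullet> (H *v v) \<le> c * (v \<bullet> v)" and tr: "0 \<le> trace H"
  shows "\<bar>H$i$j\<bar> \<le> real CARD('n) * c"
proof -
  have d: "H$i$i \<le> c" for i
    using up[of "axis i 1"] by (simp add: mult_axis[OF H] inner_axis')
  have c0: "0 \<le> c"
  proof -
    have "trace H \<le> (\<Sum>i\<in>(UNIV::'n set). c)" unfolding trace_def by (intro sum_mono d)
    then have "0 \<le> real CARD('n) * c" using tr by simp
    then show ?thesis by (simp add: zero_le_mult_iff)
  qed
  have lo: "- ((real CARD('n) - 1) * c) \<le> H$i$i" for i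
  proof -
    have "trace H = H$i$i + (\<Sum>j\<in>UNIV - {i}. H$j$j)"
      unfolding trace_def by (rule sum.remove) auto
    also have "(\<Sum>j\<in>UNIV - {i}. H$j$j) \<le> (\<Sum>j\<in>UNIV - {i}. c)" by (intro sum_mono d)
    also have "(\<Sum>j\<in>UNIV - {i}. c) = (real CARD('n) - 1) * c"
      by (simp add: card_Diff_singleton of_nat_diff)
    finally show ?thesis using tr by simp
  qed
  show ?thesis
  proof (cases "i = j")
    case True
    have "c \<le> real CARD('n) * c" using c0 mult_right_mono[of 1 "real CARD('n)" c] by simp
    then show ?thesis using d[of i] lo[of i] c0 True by (simp add: algebra_simps abs_le_iff)
  next
    case False
    have "(axis i 1 + axis j 1) \<bullet> (H *v (axis i 1 + axis j 1)) = H$i$i + H$j$j + 2 * H$i$j"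
         "(axis i 1 - axis j 1) \<bullet> (H *v (axis i 1 - axis j 1)) = H$i$i + H$j$j - 2 * H$i$j"
      using sym_matricesD[OF H, of i j]
      by (simp_all add: matrix_vector_mult_diff_distrib matrix_vector_right_distrib mult_axis[OF H]
            inner_add_left inner_diff_left inner_add_right inner_diff_right inner_axis')
    moreover have "(axis i 1 + axis j 1) \<bullet> (axis i 1 + axis j (1::real)) = 2"
        "(axis i 1 - axis j 1) \<bullet> (axis i 1 - axis j (1::real)) = 2"
      using False by (simp_all add: inner_add_left inner_diff_left inner_add_right inner_diff_right inner_axis_axis)
    ultimately have "H$i$i + H$j$j + 2 * H$i$j \<le> c * 2" "H$i$i + H$j$j - 2 * H$i$j \<le> c * 2"
      using up[of "axis i 1 + axis j 1"] up[of "axis i 1 - axis j 1"] by simp_all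
    then show ?thesis using lo[of i] lo[of j] by (simp add: algebra_simps abs_le_iff)
  qed
qed

context conformal_equation
begin

text \<open>Otherwise \<open>\<rho>\<close> minus the paraboloid \<open>4 \<eta> |y - z|\<^sup>2 / r\<close> has an interior maximum, as it is \<open>r\<close> at the centre and at
  most \<open>(1 - 3 \<eta>) r\<close> on the boundary. At the maximum the gradient is at most \<open>8 \<eta>\<close> and the Hessian at most
  \<open>(8 \<eta> / r) I\<close> with nonnegative trace; since \<open>\<rho> \<le> 2 r\<close>, the tensor is at most a constant times \<open>\<eta>\<close>.\<close>

lemma no_almost_constant_solution:
  "\<exists>\<eta>>0. \<eta> \<le> 1 \<and> (\<forall>\<Omega> \<rho> g H z r. solution \<Omega> \<rho> g H \<longrightarrow> 0 < r \<longrightarrow> cball z r \<subseteq> \<Omega> \<longrightarrow> \<rho> z = r \<longrightarrow>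
     (\<exists>y\<in>cball z r. (1 + \<eta>) * r < \<rho> y))"
proof -
  obtain \<delta> where \<delta>: "0 < \<delta>" "\<And>M. M \<in> U \<Longrightarrow> norm M < \<delta> \<Longrightarrow> F M \<noteq> 1" using F_ne_1 by blast
  define n where "n = real CARD('n)"
  have n1: "1 \<le> n" by (simp add: n_def)
  define \<eta> where "\<eta> = min 1 (\<delta> / (96 * n^3))"
  have \<eta>: "0 < \<eta>" "\<eta> \<le> 1" "48 * n^3 * \<eta> < \<delta>"
  proof -
    show "0 < \<eta>" "\<eta> \<le> 1" using \<delta>(1) n1 by (auto simp: \<eta>_def)
    have "48 * n^3 * \<eta> \<le> 48 * n^3 * (\<delta> / (96 * n^3))" using n1 by (intro mult_left_mono) (auto simp: \<eta>_def)
    also have "\<dots> = \<delta> / 2" using n1 by simp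
    finally show "48 * n^3 * \<eta> < \<delta>" using \<delta>(1) by simp
  qed
  have "\<exists>y\<in>cball z r. (1 + \<eta>) * r < \<rho> y"
    if s: "solution \<Omega> \<rho> g H" and r: "0 < r" "cball z r \<subseteq> \<Omega>" "\<rho> z = r" for \<Omega> \<rho> g H z r
  proof (rule ccontr)
    assume "\<not> ?thesis"
    then have up: "\<rho> y \<le> (1 + \<eta>) * r" if "y \<in> cball z r" for y using that by (metis not_le)
    note js = jet2_D[OF solution_D(1)[OF s]]
    define C :: "real^'n^'n" where "C = (8 * \<eta> / r) *\<^sub>R mat 1"
    have C: "C \<in> sym_matrices" unfolding C_def by (intro sym_intros)
    define h where "h y = 0 \<bullet> (y - z) + 1/2 * ((y - z) \<bullet> (C *v (y - z)))" for y
    have h_eq: "h y = 4 * \<eta> / r * (norm (y - z))^2" for y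
      by (simp add: h_def C_def scaleR_mult_vec dot_square_norm)
    have "continuous_on (cball z r) (\<lambda>y. \<rho> y - h y)"
      unfolding h_eq by (intro continuous_intros continuous_on_subset[OF js(3) r(2)])
    moreover have "z \<in> cball z r" using r by simp
    ultimately obtain y where y: "y \<in> cball z r" "\<And>w. w \<in> cball z r \<Longrightarrow> \<rho> w - h w \<le> \<rho> y - h y"
      using continuous_attains_sup[OF compact_cball] by blast
    have ry: "r \<le> \<rho> y - h y" using y(2)[of z] r by (simp add: h_eq)
    have "norm (y - z) \<noteq> r"
    proof
      assume "norm (y - z) = r"
      then have "h y = 4 * \<eta> * r" using r by (simp add: h_eq power2_eq_square)
      then have "r \<le> (1 + \<eta>) * r - 4 * \<eta> * r" using up[OF y(1)] ry by linarith
      then have "3 * (\<eta> * r) \<le> 0" by (simp add: algebra_simps)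
      moreover have "0 < \<eta> * r" using \<eta> r by simp
      ultimately show False by linarith
    qed
    then have yb: "y \<in> ball z r" using y(1) by (auto simp: dist_norm norm_minus_commute)
    have y\<Omega>: "y \<in> \<Omega>" using y(1) r(2) by auto
    have crit: "g y - (0 + C *v (y - z)) = 0 \<and> (\<forall>v. v \<bullet> ((H y - C) *v v) \<le> 0)"
    proof -
      have 1: "((\<lambda>w. \<rho> w - h w) has_derivative (\<lambda>v. (g w - (0 + C *v (w - z))) \<bullet> v)) (at w)" if "w \<in> ball z r" for w
        unfolding h_def inner_diff_left[of "g w"] using that r(2)
        by (intro has_derivative_diff js(5) quadratic_jet(1)[OF C]) auto
      have 2: "((\<lambda>w. g w - (0 + C *v (w - z))) has_derivative (\<lambda>v. (H y - C) *v v)) (at y)"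
        unfolding matrix_vector_mult_diff_rdistrib using y\<Omega>
        by (intro has_derivative_diff js(6) quadratic_jet(2)[OF C])
      have 3: "\<rho> w - h w \<le> \<rho> y - h y" if "w \<in> ball z r" for w using y(2)[of w] that by simp
      show ?thesis using local_max_jet[OF open_ball yb 1 2 3] by blast
    qed
    have yz: "norm (y - z) \<le> r" using y(1) by (simp add: dist_norm norm_minus_commute)
    have gy: "g y = (8 * \<eta> / r) *\<^sub>R (y - z)" using crit by (simp add: C_def scaleR_mult_vec)
    then have "norm (g y) \<le> 8 * \<eta>" using \<eta> r yz mult_left_mono[OF yz, of "8 * \<eta> / r"] by simp
    then have "(norm (g y))^2 \<le> (8 * \<eta>)^2" by (intro power_mono) auto
    then have g2: "g y \<bullet> g y \<le> 64 * \<eta>^2" by (simp add: dot_square_norm power_mult_distrib)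
    have "v \<bullet> (H y *v v) \<le> (8 * \<eta> / r) * (v \<bullet> v)" for v
      using crit[THEN conjunct2, rule_format, of v]
      by (simp only: C_def matrix_vector_mult_diff_rdistrib inner_diff_right scaleR_mult_vec inner_scaleR_right matrix_vector_mul_lid)
    from entries_bounded_by_top_and_trace[OF solution_D(6)[OF s y\<Omega>] this solution_D(7)[OF s y\<Omega>]]
    have Hij: "\<bar>H y $ i $ j\<bar> \<le> n * (8 * \<eta> / r)" for i j by (simp add: n_def)
    define A where "A = conf_op (\<rho> y) (g y) (H y)"
    have "\<bar>A $ i $ j\<bar> \<le> 48 * n * \<eta>" for i j
    proof -
      have "\<bar>A $ i $ j\<bar> \<le> \<bar>\<rho> y * H y $ i $ j\<bar> + \<bar>1/2 * (g y \<bullet> g y) * (mat 1 :: real^'n^'n) $ i $ j\<bar>"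
        unfolding A_def conf_op_def vector_minus_component vector_scaleR_component real_scaleR_def
        by (rule abs_triangle_ineq4)
      also have "\<bar>\<rho> y * H y $ i $ j\<bar> \<le> (2 * r) * (n * (8 * \<eta> / r))"
      proof -
        have "0 < \<rho> y" using solution_D(2)[OF s y\<Omega>] .
        moreover have "(1 + \<eta>) * r \<le> 2 * r" using \<eta> r by simp
        then have "\<rho> y \<le> 2 * r" using up[OF y(1)] by linarith
        ultimately show ?thesis unfolding abs_mult using Hij[of i j] r by (intro mult_mono) auto
      qed
      also have "(2 * r) * (n * (8 * \<eta> / r)) = 16 * n * \<eta>" using r by simp
      also have "\<bar>1/2 * (g y \<bullet> g y) * (mat 1 :: real^'n^'n) $ i $ j\<bar> \<le> 1/2 * (g y \<bullet> g y)"
        by (simp add: mat_def)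
      also have "\<dots> \<le> 32 * \<eta>^2" using g2 by simp
      also have "32 * \<eta>^2 \<le> 32 * (n * \<eta>)"
      proof -
        have "\<eta> * \<eta> \<le> n * \<eta>" using \<eta> n1 by (intro mult_right_mono) auto
        then show ?thesis by (simp add: power2_eq_square)
      qed
      finally show ?thesis by (simp add: mult_ac)
    qed
    from matrix_norm_le_of_entries[OF this] have "norm A \<le> 48 * n^3 * \<eta>"
      by (simp add: n_def power2_eq_square power3_eq_cube mult_ac)
    then have "norm A < \<delta>" using \<eta>(3) by simp
    then show False using \<delta>(2)[of A] solution_D(3,4)[OF s y\<Omega>] by (simp add: A_def)
  qed
  with \<eta>(1,2) show ?thesis by blast
qed

text \<open>The point \<open>z\<close> maximises \<open>(d - |y - \<xi>|) / \<rho>(y)\<close>, the distance to the boundary measured in units of the local scale \<open>\<rho>\<close>. On the ball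
  of half that distance about \<open>z\<close> the numerator loses at most a factor 2, so \<open>\<rho>\<close> does so as well.\<close>

lemma blow_up_point:
  fixes \<rho> :: "real^'n \<Rightarrow> real"
  assumes cont: "continuous_on (cball \<xi> d) \<rho>" and pos: "\<And>y. y \<in> cball \<xi> d \<Longrightarrow> 0 < \<rho> y"
    and d: "0 < d" and small: "\<rho> \<xi> < 2 * \<kappa> * d" and \<kappa>: "0 < \<kappa>"
  obtains z \<tau> where "\<rho> z < 4 * \<kappa> * \<tau>" "0 < \<tau>" "2 * \<tau> \<le> d" "cball z \<tau> \<subseteq> cball \<xi> d"
    "\<forall>y\<in>cball z \<tau>. \<rho> z / 2 \<le> \<rho> y"
proof -
  define f where "f y = (d - norm (y - \<xi>)) / \<rho> y" for y
  have "continuous_on (cball \<xi> d) f"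
    unfolding f_def using pos by (intro continuous_intros cont) force
  moreover have "\<xi> \<in> cball \<xi> d" using d by simp
  ultimately obtain z where z: "z \<in> cball \<xi> d" "\<And>y. y \<in> cball \<xi> d \<Longrightarrow> f y \<le> f z"
    using continuous_attains_sup[OF compact_cball] by blast
  have \<rho>\<xi>: "0 < \<rho> \<xi>" "0 < \<rho> z" using pos z(1) d by auto
  have "1 / (2 * \<kappa>) < f \<xi>" using small \<kappa> \<rho>\<xi> by (simp add: f_def field_simps)
  then have fz: "1 / (2 * \<kappa>) < f z" using z(2)[of \<xi>] d by simp
  define \<tau> where "\<tau> = (d - norm (z - \<xi>)) / 2"
  have "2 * \<tau> = d - norm (z - \<xi>)" by (simp add: \<tau>_def)
  then have fz\<tau>: "f z = 2 * \<tau> / \<rho> z" by (simp only: f_def)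
  have lt: "\<rho> z < 4 * \<kappa> * \<tau>" using fz \<kappa> \<rho>\<xi> unfolding fz\<tau> by (simp add: field_simps)
  then have "0 < 4 * \<kappa> * \<tau>" using \<rho>\<xi>(2) by linarith
  then have \<tau>: "0 < \<tau>" using \<kappa> by (simp add: zero_less_mult_iff)
  have in_ball: "norm (y - \<xi>) \<le> d - \<tau>" if "y \<in> cball z \<tau>" for y
  proof -
    have "norm (y - \<xi>) \<le> norm (y - z) + norm (z - \<xi>)" using norm_triangle_ineq[of "y - z" "z - \<xi>"] by simp
    moreover have "norm (y - z) \<le> \<tau>" using that by (simp add: dist_norm norm_minus_commute)
    moreover have "norm (z - \<xi>) = d - 2 * \<tau>" using \<open>2 * \<tau> = d - norm (z - \<xi>)\<close> by linarith
    ultimately show ?thesis by linarith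
  qed
  have sub: "cball z \<tau> \<subseteq> cball \<xi> d"
  proof
    fix y assume "y \<in> cball z \<tau>"
    from in_ball[OF this] \<tau> show "y \<in> cball \<xi> d" by (simp add: dist_norm norm_minus_commute)
  qed
  show ?thesis
  proof (rule that[OF lt \<tau> _ sub ballI])
    show "2 * \<tau> \<le> d" by (simp add: \<tau>_def)
    fix y assume y: "y \<in> cball z \<tau>"
    then have yd: "y \<in> cball \<xi> d" using sub by blast
    have "\<tau> / \<rho> y \<le> f y" using in_ball[OF y] pos[OF yd] by (simp add: f_def divide_right_mono)
    also have "\<dots> \<le> 2 * \<tau> / \<rho> z" using z(2)[OF yd] fz\<tau> by simp
    finally have "\<tau> * \<rho> z \<le> \<tau> * (2 * \<rho> y)" using pos[OF yd] \<rho>\<xi> by (simp add: field_simps)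
    then show "\<rho> z / 2 \<le> \<rho> y" using \<tau> by simp
  qed
qed

text \<open>Let \<open>z\<close> be a blow-up point, \<open>r = \<rho>(z)\<close>, and \<open>b\<close> a point at distance \<open>e \<le> r\<close> from \<open>z\<close>. Let \<open>x\<close> lie on the ray from \<open>b\<close>
  through \<open>z\<close>, at distance \<open>D r\<close> behind \<open>z\<close>. The sphere about \<open>x\<close> whose radius \<open>l\<close> is the geometric mean of
  \<open>|z - x|\<close> and \<open>|b - x|\<close> exchanges \<open>z\<close> and \<open>b\<close>, so moving spheres give
  \<open>\<rho>(b) \<le> (|b - x| / |z - x|) r \<le> (1 + 1 / D) r\<close>. The strict inequality on the unit sphere holds because the transforms
  are at least \<open>1 / (8 R\<^sup>2 r)\<close> there, which is large for small \<open>r\<close>.\<close>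

lemma linear_lower_bound_near_singularity:
  assumes s: "solution \<Omega> \<rho> g H" and \<Omega>: "cball 0 1 - {0} \<subseteq> \<Omega>"
    and C: "\<And>y. y \<in> cball 0 1 - {0} \<Longrightarrow> \<rho> y \<le> C"
  shows "\<exists>c>0. \<exists>d>0. \<forall>y. 0 < norm y \<longrightarrow> norm y < d \<longrightarrow> c * norm y \<le> \<rho> y"
proof (rule ccontr)
  assume contra: "\<not> ?thesis"
  note js = jet2_D[OF solution_D(1)[OF s]]
  obtain \<eta> where \<eta>: "0 < \<eta>" "\<eta> \<le> 1" and no: "\<forall>\<Omega> \<rho> g H z r. solution \<Omega> \<rho> g H \<longrightarrow> 0 < r \<longrightarrow> cball z r \<subseteq> \<Omega> \<longrightarrow> \<rho> z = r \<longrightarrow>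
     (\<exists>y\<in>cball z r. (1 + \<eta>) * r < \<rho> y)"
    using no_almost_constant_solution by blast
  \<comment> \<open>\<open>D r\<close> is the distance from \<open>z\<close> to the centres of the spheres; \<open>R r\<close> bounds all lengths in the construction.\<close>
  define D where "D = 1 / \<eta>"
  have D: "1 \<le> D" using \<eta> by (simp add: D_def)
  define R where "R = D + 2"
  have R: "3 \<le> R" using D by (simp add: R_def)
  define \<kappa> where "\<kappa> = min (1 / (16 * R)) (1 / (8 * R^2 * (\<bar>C\<bar> + 1)))"
  have \<kappa>: "0 < \<kappa>" "\<kappa> \<le> 1 / (16 * R)" "\<kappa> \<le> 1 / (8 * R^2 * (\<bar>C\<bar> + 1))"
    using R by (auto simp: \<kappa>_def add_nonneg_pos intro!: mult_pos_pos)
  have "1 / (16 * R) \<le> 1 / 48" using R by (intro divide_left_mono) auto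
  then have \<kappa>1: "\<kappa> \<le> 1 / 48" using \<kappa>(2) by linarith
  have "\<not> (\<forall>y. 0 < norm y \<longrightarrow> norm y < \<kappa> \<longrightarrow> \<kappa> * norm y \<le> \<rho> y)" using contra \<kappa>(1) by blast
  then obtain \<xi> where \<xi>: "0 < norm \<xi>" "norm \<xi> < \<kappa>" "\<rho> \<xi> < \<kappa> * norm \<xi>"
    by (auto simp: not_le)
  define d where "d = norm \<xi> / 2"
  have in1: "norm y < 1/2 \<and> y \<noteq> 0" if "y \<in> cball \<xi> d" for y
  proof -
    have "norm (y - \<xi>) \<le> norm \<xi> / 2" using that by (simp add: d_def dist_norm norm_minus_commute)
    moreover have "norm y \<le> norm \<xi> + norm (y - \<xi>)" by (rule norm_triangle_sub)
    moreover have "y = 0 \<Longrightarrow> norm (y - \<xi>) = norm \<xi>" by simp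
    ultimately show ?thesis using \<xi> \<kappa>1 by fastforce
  qed
  have sub\<Omega>: "cball \<xi> d \<subseteq> \<Omega>" using in1 \<Omega> by fastforce
  have small: "\<rho> \<xi> < 2 * \<kappa> * d" using \<xi>(3) by (simp add: d_def)
  have d0: "0 < d" using \<xi> by (simp add: d_def)
  have \<rho>pos: "\<And>y. y \<in> cball \<xi> d \<Longrightarrow> 0 < \<rho> y" using solution_D(2)[OF s] sub\<Omega> by blast
  obtain z \<tau> where z\<tau>: "\<rho> z < 4 * \<kappa> * \<tau>" "0 < \<tau>" "2 * \<tau> \<le> d" "cball z \<tau> \<subseteq> cball \<xi> d"
    "\<forall>y\<in>cball z \<tau>. \<rho> z / 2 \<le> \<rho> y"
    by (rule blow_up_point[OF continuous_on_subset[OF js(3) sub\<Omega>] \<rho>pos d0 small \<kappa>(1)])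
  define r where "r = \<rho> z"
  have zz: "z \<in> cball z \<tau>" using z\<tau>(2) by simp
  then have r0: "0 < r" unfolding r_def using z\<tau>(4) by (intro \<rho>pos) blast
  have r\<tau>: "4 * R * r < \<tau>"
  proof -
    have "4 * R * r < 4 * R * (4 * \<kappa> * \<tau>)" using z\<tau>(1) R by (simp add: r_def)
    also have "\<dots> = 16 * R * \<kappa> * \<tau>" by simp
    also have "\<dots> \<le> 1 * \<tau>" using \<kappa>(2) R z\<tau>(2) by (intro mult_right_mono) (auto simp: field_simps)
    finally show ?thesis by simp
  qed
  have r\<kappa>: "r < \<kappa>"
  proof -
    have "4 * \<tau> \<le> norm \<xi>" using z\<tau>(3) by (simp add: d_def)
    then have "4 * \<tau> \<le> 1" using \<xi>(2) \<kappa>1 by linarith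
    then have "\<kappa> * (4 * \<tau>) \<le> \<kappa> * 1" using \<kappa>(1) by (intro mult_left_mono) auto
    then show ?thesis using z\<tau>(1) by (simp add: r_def)
  qed
  have bigC: "C < 1 / (8 * R^2 * r)"
  proof -
    have pos: "0 < 8 * R^2 * (\<bar>C\<bar> + 1)" using R by (intro mult_pos_pos) auto
    have "r < 1 / (8 * R^2 * (\<bar>C\<bar> + 1))" using r\<kappa> \<kappa>(3) by linarith
    then have "r * (8 * R^2 * (\<bar>C\<bar> + 1)) < 1" using pos by (simp add: pos_less_divide_eq)
    then have "(\<bar>C\<bar> + 1) * (8 * R^2 * r) < 1" by (simp add: mult_ac)
    then have "\<bar>C\<bar> + 1 < 1 / (8 * R^2 * r)" using R r0 by (subst pos_less_divide_eq) auto
    then show ?thesis by linarith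
  qed
  have harnack: "\<rho> b \<le> (1 + \<eta>) * r" if b: "b \<in> cball z r" for b
  proof (cases "b = z")
    case True then show ?thesis using \<eta> r0 by (simp add: r_def[symmetric])
  next
    case False
    define e where "e = norm (z - b)"
    have e: "0 < e" "e \<le> r" using False b by (auto simp: e_def dist_norm)
    define v where "v = (1 / e) *\<^sub>R (z - b)"
    have v: "norm v = 1" "z - b = e *\<^sub>R v" using e by (auto simp: v_def e_def)
    define x where "x = z + (D * r) *\<^sub>R v"
    have Dr: "0 < D * r" using D r0 by simp
    have zx: "z - x = - ((D * r) *\<^sub>R v)" by (simp add: x_def)
    have bx: "b - x = - ((D * r + e) *\<^sub>R v)"
    proof -
      have "b - x = (z - x) - (z - b)" by simp
      then show ?thesis unfolding zx v(2) by (simp add: scaleR_add_left)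
    qed
    have nzx: "norm (z - x) = D * r" using zx v Dr by simp
    have nbx: "norm (b - x) = D * r + e" using bx v Dr e by simp
    define l where "l = sqrt (D * r * (D * r + e))"
    have l0: "0 < l" using Dr e by (simp add: l_def)
    have l2: "l^2 = D * r * (D * r + e)" using Dr e by (simp add: l_def)
    have l_le: "l \<le> norm (b - x)"
    proof (rule power2_le_imp_le)
      have "D * r * (D * r + e) \<le> (D * r + e) * (D * r + e)" using Dr e by (intro mult_right_mono) auto
      then show "l^2 \<le> (norm (b - x))^2"
        unfolding l2 nbx by (simp only: power2_eq_square)
    qed simp
    have lR: "l \<le> R * r" using l_le e unfolding nbx R_def by (simp add: algebra_simps)
    have xin: "y \<in> cball z \<tau>" if "norm (y - x) \<le> l" for y
    proof -
      have "norm (y - z) \<le> norm (y - x) + norm (x - z)" using norm_triangle_ineq[of "y - x" "x - z"] by simp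
      also have "\<dots> \<le> R * r + R * r" using that lR nzx r0 by (simp add: norm_minus_commute R_def algebra_simps)
      also have "\<dots> \<le> 4 * R * r" using R r0 by simp
      finally show ?thesis using r\<tau> by (simp add: dist_norm norm_minus_commute)
    qed
    have cb: "y \<in> cball x l \<longleftrightarrow> norm (y - x) \<le> l" for y by (simp add: dist_norm norm_minus_commute)
    have nx: "norm x < 1/2" using in1[of x] xin[of x] z\<tau>(4) l0 by auto
    interpret M: moving_sphere U F \<Omega> \<rho> g H x l C
    proof unfold_locales
      show "cball x l \<subseteq> ball 0 1 - {0}"
      proof
        fix y assume "y \<in> cball x l"
        then have "y \<in> cball \<xi> d" using xin z\<tau>(4) cb by blast
        from in1[OF this] show "y \<in> ball 0 1 - {0}" by simp
      qed
      fix m y assume m: "0 < m" "m \<le> l" and y: "norm (y::real^'n) = 1"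
      have y12: "1/2 \<le> norm (y - x)" using norm_triangle_ineq2[of y x] y nx by linarith
      have "R * r \<le> 1/2" 
      proof -
        have "\<tau> \<le> 1/2" using z\<tau>(2,3) \<xi>(2) \<kappa>1 by (simp add: d_def)
        moreover have "R * r \<le> 4 * R * r" using R r0 by simp
        ultimately show ?thesis using r\<tau> by linarith
      qed
      then have m_le: "m \<le> norm (y - x)" using m lR y12 by linarith
      have yx: "y \<noteq> x" using y12 by auto
      have "m * m \<le> l * norm (y - x)" using m m_le by (intro mult_mono) auto
      then have "norm (inversion x m y - x) \<le> l"
        unfolding norm_inversion[OF yx] using yx by (simp add: field_simps power2_eq_square)
      from bspec[OF z\<tau>(5) xin[OF this]] have J: "r / 2 \<le> \<rho> (inversion x m y)" by (simp add: r_def)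
      have "m^2 \<le> (R * r)^2" using m lR by (intro power_mono) auto
      moreover have "(1/2)^2 \<le> (norm (y - x))^2" using y12 by (intro power_mono) auto
      ultimately have "(1/2)^2 / (R * r)^2 \<le> (norm (y - x))^2 / m^2"
        using m by (intro frac_le) auto
      then have "(1/2)^2 / (R * r)^2 * (r / 2) \<le> (norm (y - x))^2 / m^2 * \<rho> (inversion x m y)"
        using J r0 by (intro mult_mono) auto
      moreover have "(1/2)^2 / (R * r)^2 * (r / 2) = 1 / (8 * R^2 * r)"
        using r0 R by (simp add: power2_eq_square)
      ultimately have "1 / (8 * R^2 * r) \<le> kelvin x m \<rho> y" by (simp add: kelvin_norm)
      moreover have "\<rho> y \<le> C" using y by (intro C) auto
      ultimately show "\<rho> y < kelvin x m \<rho> y" using bigC by linarith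
    qed (use s \<Omega> l0 C in auto)
    have "b \<in> cball z \<tau>"
    proof -
      have "r \<le> 4 * R * r" using R r0 by simp
      then show ?thesis using b r\<tau> by simp
    qed
    then have "b \<in> cball \<xi> d" using z\<tau>(4) by blast
    from in1[OF this] have b1: "norm b \<le> 1" "b \<noteq> 0" by auto
    have "inversion x l b = z"
    proof -
      have "l^2 / ((b - x) \<bullet> (b - x)) = D * r / (D * r + e)"
        unfolding dot_square_norm nbx l2 using Dr e by (simp add: power2_eq_square)
      moreover have "(D * r / (D * r + e)) *\<^sub>R (b - x) = z - x"
        unfolding bx zx using Dr e by simp
      ultimately show ?thesis by (simp add: inversion_def)
    qed
    then have kel_b: "kelvin x l \<rho> b = (norm (b - x))^2 / l^2 * r" by (simp add: kelvin_norm r_def)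
    have "\<rho> b \<le> kelvin x l \<rho> b"
      using M.comparison_all_spheres[OF l0 order.refl] b1 l_le unfolding M.comparison_def by blast
    also note kel_b
    also have "(norm (b - x))^2 / l^2 = 1 + e / (D * r)"
    proof -
      have "(k + e)^2 / (k * (k + e)) = 1 + e / k" if "0 < k" for k
        using that e(1) by (simp add: power2_eq_square add_divide_distrib)
      from this[OF Dr] show ?thesis unfolding nbx l2 .
    qed
    also have "(1 + e / (D * r)) * r \<le> (1 + \<eta>) * r"
    proof -
      have "e / (D * r) \<le> r / (D * r)" using e Dr by (intro divide_right_mono) auto
      also have "\<dots> = \<eta>" using r0 \<eta> by (simp add: D_def)
      finally show ?thesis using r0 by simp
    qed
    finally show ?thesis .
  qed
  have "1 * r \<le> 4 * R * r" using R r0 by (intro mult_right_mono) auto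
  then have "r \<le> \<tau>" using r\<tau> by linarith
  then have "cball z r \<subseteq> cball z \<tau>" by (rule subset_cball)
  then have "cball z r \<subseteq> \<Omega>" using z\<tau>(4) sub\<Omega> by blast
  with no s r0 r_def obtain b where "b \<in> cball z r" "(1 + \<eta>) * r < \<rho> b" by blast
  with harnack[of b] show False by simp
qed

end

section \<open>From the exterior domain to the punctured ball\<close>

lemma jet2_of_C2_on:
  fixes u :: "real^'n \<Rightarrow> real"
  assumes u: "C2_on S u" and W: "open W" "W \<subseteq> S"
  shows "jet2 W u (gradient S u) (hessian S u)"
  unfolding jet2_def
proof (intro conjI ballI)
  show "open W" by (rule W)
  show "continuous_on W (hessian S u)" using u W(2) by (auto simp: C2_on_def intro: continuous_on_subset)
  fix x assume x: "x \<in> W"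
  then have at: "at x within S = at x" using W by (metis at_within_interior interior_maximal subsetD)
  have expand: "D h = (\<Sum>j\<in>UNIV. h$j *\<^sub>R D (axis j 1))" if "linear D" for D :: "real^'n \<Rightarrow> 'b::real_vector" and h
  proof -
    have "h = (\<Sum>j\<in>UNIV. h$j *\<^sub>R axis j 1)" by (simp add: basis_expansion flip: scalar_mult_eq_scaleR)
    then have "D h = D (\<Sum>j\<in>UNIV. h$j *\<^sub>R axis j 1)" by simp
    then show ?thesis using that by (simp add: linear_sum linear_cmul)
  qed
  have "u differentiable (at x)" using u x W(2) by (auto simp: C2_on_def differentiable_on_def at[symmetric])
  then have Du: "(u has_derivative frechet_derivative u (at x)) (at x)" by (simp add: frechet_derivative_works)
  have "frechet_derivative u (at x) h = gradient S u x \<bullet> h" for h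
    using expand[OF has_derivative_linear[OF Du], of h]
    by (simp add: gradient_def at inner_vec_def mult.commute)
  then show "(u has_derivative (\<lambda>h. gradient S u x \<bullet> h)) (at x)" using Du by presburger
  have "gradient S u differentiable (at x)" using u x W(2) by (auto simp: C2_on_def differentiable_on_def at[symmetric])
  then obtain G where G: "(gradient S u has_derivative G) (at x)" by (auto simp: differentiable_def)
  have comp: "frechet_derivative (\<lambda>y. gradient S u y $ i) (at x) = (\<lambda>h. G h $ i)" for i
    by (rule frechet_derivative_at[symmetric]) (rule bounded_linear.has_derivative[OF bounded_linear_vec_nth G])
  have "G h = hessian S u x *v h" for h
    using expand[OF has_derivative_linear[OF G], of h]
    by (simp add: vec_eq_iff hessian_def at comp matrix_vector_mult_def mult.commute)
  then show "(gradient S u has_derivative (\<lambda>h. hessian S u x *v h)) (at x)" using G by presburger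
qed

lemma powr_jet:
  assumes j: "jet2 \<Omega> u g H" and pos: "\<And>x. x \<in> \<Omega> \<Longrightarrow> 0 < u x"
  shows "jet2 \<Omega> (\<lambda>x. u x powr a) (\<lambda>x. (a * u x powr (a - 1)) *\<^sub>R g x)
    (\<lambda>x. (a * u x powr (a - 1)) *\<^sub>R H x + (a * (a - 1) * u x powr (a - 2)) *\<^sub>R outer (g x) (g x))"
proof -
  note J = jet2_D[OF j]
  have pw: "((\<lambda>x. u x powr b) has_derivative (\<lambda>h. b * u x powr (b - 1) * (g x \<bullet> h))) (at x)" if x: "x \<in> \<Omega>" for b x
  proof -
    have "((\<lambda>t. t powr b) has_derivative (\<lambda>h. b * u x powr (b - 1) * h)) (at (u x))"
      using has_real_derivative_powr[OF pos[OF x], of b] by (simp add: has_field_derivative_def)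
    from has_derivative_compose[OF J(5)[OF x] this] show ?thesis .
  qed
  show ?thesis
    unfolding jet2_def
  proof (intro conjI ballI J(1))
    show "continuous_on \<Omega> (\<lambda>x. (a * u x powr (a - 1)) *\<^sub>R H x + (a * (a - 1) * u x powr (a - 2)) *\<^sub>R outer (g x) (g x))"
      using pos by (intro continuous_intros continuous_on_outer J(2,3,4)) force+
    fix x assume x: "x \<in> \<Omega>"
    show "((\<lambda>x. u x powr a) has_derivative (\<lambda>h. ((a * u x powr (a - 1)) *\<^sub>R g x) \<bullet> h)) (at x)"
      using pw[OF x, of a] by simp
    have "((\<lambda>x. (a * u x powr (a - 1)) *\<^sub>R g x) has_derivative
      (\<lambda>h. (a * u x powr (a - 1)) *\<^sub>R (H x *v h) + (a * ((a - 1) * u x powr (a - 1 - 1) * (g x \<bullet> h))) *\<^sub>R g x)) (at x)"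
      by (intro has_derivative_scaleR has_derivative_mult_right pw x J(6))
    then show "((\<lambda>x. (a * u x powr (a - 1)) *\<^sub>R g x) has_derivative
      (\<lambda>h. ((a * u x powr (a - 1)) *\<^sub>R H x + (a * (a - 1) * u x powr (a - 2)) *\<^sub>R outer (g x) (g x)) *v h)) (at x)"
      by (simp add: matrix_vector_mult_add_rdistrib scaleR_mult_vec outer_mult_vec mult.assoc)
  qed
qed

lemma conf_op_powr_eq_A_conf:
  fixes u :: "real^'n \<Rightarrow> real"
  assumes n: "CARD('n) \<ge> 3" and pos: "0 < u x"
  defines "a \<equiv> - (2 / (real CARD('n) - 2))"
  shows "conf_op (u x powr a) ((a * u x powr (a - 1)) *\<^sub>R gradient S u x)
     ((a * u x powr (a - 1)) *\<^sub>R hessian S u x + (a * (a - 1) * u x powr (a - 2)) *\<^sub>R outer (gradient S u x) (gradient S u x))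
    = A_conf S u x"
proof -
  define m where "m = real CARD('n)"
  have m: "m - 2 \<noteq> 0" "m - 2 > 0" using n by (auto simp: m_def)
  define k where "k = m - 2"
  have k: "0 < k" "m = k + 2" using m by (simp_all add: k_def)
  have a: "a = - (2 / (m - 2))" by (simp add: a_def m_def)
  have e1: "a + (a - 1) = - ((m + 2) / (m - 2))" and e2: "a + (a - 2) = - (2 * m / (m - 2))"
    and e3: "a * (a - 1) = 2 * m / (m - 2)^2" and e4: "a^2 / 2 = 2 / (m - 2)^2"
    unfolding a k(2) using k(1) by (simp_all add: field_simps power2_eq_square)
  have "(a - 1) + (a - 1) = a + (a - 2)" by simp
  then have p3: "u x powr (a - 1) * u x powr (a - 1) = u x powr (- (2 * m / (m - 2)))"
    unfolding e2[symmetric] by (simp only: powr_add[symmetric])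
  have p1: "u x powr a * u x powr (a - 1) = u x powr (- ((m + 2) / (m - 2)))"
    and p2: "u x powr a * u x powr (a - 2) = u x powr (- (2 * m / (m - 2)))"
    unfolding e1[symmetric] e2[symmetric] by (simp_all only: powr_add)
  let ?g = "gradient S u x"
  have "conf_op (u x powr a) ((a * u x powr (a - 1)) *\<^sub>R ?g)
     ((a * u x powr (a - 1)) *\<^sub>R hessian S u x + (a * (a - 1) * u x powr (a - 2)) *\<^sub>R outer ?g ?g)
    = (a * (u x powr a * u x powr (a - 1))) *\<^sub>R hessian S u x + (a * (a - 1) * (u x powr a * u x powr (a - 2))) *\<^sub>R outer ?g ?g
     - (a^2 / 2 * (u x powr (a - 1) * u x powr (a - 1)) * (norm ?g)^2) *\<^sub>R mat 1"
    unfolding conf_op_def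
    by (simp add: scaleR_add_right dot_square_norm power2_eq_square mult_ac)
  also have "\<dots> = A_conf S u x"
    unfolding p1 p2 p3 e3 e4 A_conf_def Let_def m_def[symmetric] by (simp add: a)
  finally show ?thesis .
qed

text \<open>Comparison with \<open>h = c (|y| powr (2 - n) + |y| powr (1 - n))\<close>. The first power is harmonic and the second one
  strictly subharmonic, so \<open>h - u\<close> has no interior maximum. It is nonpositive on the unit sphere by the choice of \<open>c\<close>, and
  at infinity because \<open>h\<close> tends to 0 and \<open>u\<close> is positive.\<close>

lemma superharmonic_lower_bound_at_infinity:
  fixes u :: "real^'n \<Rightarrow> real"
  assumes n: "CARD('n) \<ge> 3" and j: "jet2 \<Omega> u g H" and \<Omega>: "- ball 0 1 \<subseteq> \<Omega>"
    and pos: "\<And>y. 1 \<le> norm y \<Longrightarrow> 0 < u y" and tr: "\<And>y. 1 \<le> norm y \<Longrightarrow> trace (H y) \<le> 0"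
  shows "\<exists>c>0. \<forall>y. 1 \<le> norm y \<longrightarrow> c * norm y powr (2 - real CARD('n)) \<le> u y"
proof -
  note J = jet2_D[OF j]
  define m where "m = real CARD('n)"
  have m: "3 \<le> m" using n by (simp add: m_def)
  have "continuous_on (sphere 0 1) u" by (rule continuous_on_subset[OF J(3)]) (use \<Omega> in auto)
  then obtain y0 where y0: "y0 \<in> sphere 0 1" "\<And>y. y \<in> sphere 0 1 \<Longrightarrow> u y0 \<le> u y"
    using continuous_attains_inf[OF compact_sphere, of 0 1 u] by auto
  define c where "c = u y0 / 2"
  have c: "0 < c" using pos[of y0] y0(1) by (simp add: c_def)
  define q1 q2 where "q1 = (2 - m) / 2" and "q2 = (1 - m) / 2"
  define s where "s y = (y - 0) \<bullet> (y - 0 :: real^'n)" for y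
  have s_eq: "s y powr q = norm y powr (2 * q)" if "y \<noteq> 0" for y q
  proof -
    have "s y = norm y powr 2" using that by (simp add: s_def dot_square_norm powr_numeral)
    then show ?thesis by (simp only: powr_powr)
  qed
  define h where "h y = c * s y powr q1 + c * s y powr q2" for y
  have h_small: "h y \<le> 2 * c / norm y" if "1 \<le> norm y" for y
  proof -
    have y: "y \<noteq> 0" using that by auto
    have "2 * q1 \<le> - 1" "2 * q2 \<le> - 1" using m by (simp_all add: q1_def q2_def)
    then have "s y powr q1 \<le> norm y powr (-1)" "s y powr q2 \<le> norm y powr (-1)"
      unfolding s_eq[OF y] using that by (intro powr_mono; simp)+
    moreover have "norm y powr (-1) = 1 / norm y" using y by (simp add: powr_minus inverse_eq_divide)
    ultimately have "c * (s y powr q1 + s y powr q2) \<le> c * (2 / norm y)"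
      using c by (intro mult_left_mono) auto
    then show ?thesis unfolding h_def by (simp add: distrib_left mult.commute)
  qed
  have h_le: "h y \<le> u y" if y: "1 \<le> norm y" for y
  proof (rule ccontr)
    assume neg: "\<not> h y \<le> u y"
    define e where "e = h y - u y"
    have e: "0 < e" using neg by (simp add: e_def)
    define R where "R = 2 * c / e"
    have R: "0 < R" using c e by (simp add: R_def)
    have far: "h w - u w < e" if w: "1 \<le> norm w" "R \<le> norm w" for w
    proof -
      have "2 * c / norm w \<le> 2 * c / R" using w R c by (intro divide_left_mono mult_pos_pos) auto
      also have "\<dots> = e" using c e by (simp add: R_def)
      finally show ?thesis using h_small[OF w(1)] pos[OF w(1)] by linarith
    qed
    define K where "K = cball 0 R - ball (0::real^'n) 1"
    have K: "compact K" unfolding K_def by (intro compact_diff) auto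
    have yK: "y \<in> K" using far[OF y] y unfolding K_def e_def by force
    have sc: "continuous_on A s" for A unfolding s_def by (intro continuous_intros)
    have "continuous_on K (\<lambda>w. h w - u w)"
      unfolding h_def using \<Omega>
      by (intro continuous_intros sc continuous_on_subset[OF J(3)]) (auto simp: K_def s_def)
    then obtain z where z: "z \<in> K" "\<And>w. w \<in> K \<Longrightarrow> h w - u w \<le> h z - u z"
      using continuous_attains_sup[OF K] yK by blast
    have ez: "e \<le> h z - u z" using z(2)[OF yK] by (simp add: e_def)
    have z1: "1 \<le> norm z" using z(1) by (simp add: K_def)
    have "norm z \<noteq> 1"
    proof
      assume z1: "norm z = 1"
      then have "z \<noteq> 0" by auto
      then have "h z = u y0" using z1 by (simp add: h_def s_eq c_def)
      then show False using y0(2)[of z] z1 ez e by simp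
    qed
    moreover have "norm z < R" using far[OF z1] ez by force
    ultimately have zW: "z \<in> ball 0 R - cball 0 1" using z1 by simp
    define g1 where "g1 q w = (2 * q * s w powr (q - 1)) *\<^sub>R (w - 0)" for q and w :: "real^'n"
    define H1 where "H1 q w = (2 * q * s w powr (q - 1)) *\<^sub>R mat 1 + (4 * q * (q - 1) * s w powr (q - 2)) *\<^sub>R outer (w - 0) (w - 0)" for q and w :: "real^'n"
    have d1: "((\<lambda>w. s w powr q) has_derivative (\<lambda>v. g1 q w \<bullet> v)) (at w)"
      and d2: "(g1 q has_derivative (\<lambda>v. H1 q w *v v)) (at w)"
      and t1: "trace (H1 q w) = 2 * q * s w powr (q - 1) * (m + 2 * (q - 1))" if "w \<noteq> 0" for q w
      using radial_power_jet[OF that, of q] unfolding s_def g1_def[abs_def] H1_def m_def by auto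
    define Hz where "Hz = c *\<^sub>R H1 q1 z + c *\<^sub>R H1 q2 z - H z"
    have "v \<bullet> (Hz *v v) \<le> 0" for v
    proof (rule local_max_jet(2)[of "ball 0 R - cball 0 1" z "\<lambda>w. h w - u w" "\<lambda>w. c *\<^sub>R g1 q1 w + c *\<^sub>R g1 q2 w - g w"])
      show "open (ball 0 R - cball (0::real^'n) 1)" by (intro open_Diff) auto
      show "z \<in> ball 0 R - cball 0 1" by (rule zW)
      fix w :: "real^'n" assume w: "w \<in> ball 0 R - cball 0 1"
      then have w': "w \<noteq> 0" "w \<in> \<Omega>" using \<Omega> by auto
      show "h w - u w \<le> h z - u z" using w by (intro z(2)) (auto simp: K_def)
      have "((\<lambda>w. h w - u w) has_derivative (\<lambda>v. c * (g1 q1 w \<bullet> v) + c * (g1 q2 w \<bullet> v) - g w \<bullet> v)) (at w)"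
        unfolding h_def by (intro has_derivative_diff has_derivative_add has_derivative_mult_right d1 w' J(5))
      then show "((\<lambda>w. h w - u w) has_derivative (\<lambda>v. (c *\<^sub>R g1 q1 w + c *\<^sub>R g1 q2 w - g w) \<bullet> v)) (at w)"
        by (simp add: inner_add_left inner_diff_left)
    next
      have z': "z \<noteq> 0" "z \<in> \<Omega>" using zW \<Omega> by auto
      have "((\<lambda>w. c *\<^sub>R g1 q1 w + c *\<^sub>R g1 q2 w - g w) has_derivative
          (\<lambda>v. c *\<^sub>R (H1 q1 z *v v) + c *\<^sub>R (H1 q2 z *v v) - H z *v v)) (at z)"
        by (intro has_derivative_diff has_derivative_add has_derivative_scaleR_right d2 z' J(6))
      then show "((\<lambda>w. c *\<^sub>R g1 q1 w + c *\<^sub>R g1 q2 w - g w) has_derivative (\<lambda>v. Hz *v v)) (at z)"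
        by (simp add: Hz_def matrix_vector_mult_add_rdistrib matrix_vector_mult_diff_rdistrib scaleR_mult_vec)
    qed
    then have "trace Hz \<le> 0" unfolding trace_eq_sum_axis by (intro sum_nonpos)
    moreover have "trace Hz = c * trace (H1 q1 z) + c * trace (H1 q2 z) - trace (H z)"
      by (simp add: Hz_def trace_def sum.distrib sum_subtractf sum_distrib_left)
    moreover have z0: "z \<noteq> 0" using z1 by auto
    have "m + 2 * (q1 - 1) = 0" by (simp add: q1_def field_simps)
    then have "c * trace (H1 q1 z) = 0" unfolding t1[OF z0] by simp
    moreover have "0 < trace (H1 q2 z)"
    proof -
      have "trace (H1 q2 z) = (m - 1) * s z powr (q2 - 1)" unfolding t1[OF z0] by (simp add: q2_def field_simps)
      moreover have "0 < s z powr (q2 - 1)" using z0 by (simp add: s_def)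
      ultimately show ?thesis using m by simp
    qed
    then have "0 < c * trace (H1 q2 z)" using c by simp
    ultimately show False using tr[OF z1] by linarith
  qed
  have "c * norm y powr (2 - m) \<le> u y" if y: "1 \<le> norm y" for y
  proof -
    have "y \<noteq> 0" using y by auto
    have "2 - m = 2 * q1" by (simp add: q1_def)
    then have "c * norm y powr (2 - m) = c * s y powr q1" by (simp only: s_eq[OF \<open>y \<noteq> 0\<close>])
    also have "\<dots> \<le> h y" using c by (simp add: h_def)
    also have "\<dots> \<le> u y" by (rule h_le[OF y])
    finally show ?thesis .
  qed
  then show ?thesis using c unfolding m_def by blast
qed

text \<open>The Kelvin transform of \<open>\<rho>\<close> about 0 with radius 1 is a solution on the punctured ball of radius 2. The bound
  \<open>u \<ge> c |x| powr (2 - n)\<close> says that it is bounded near 0, and its lower bound \<open>k |y|\<close> says \<open>\<rho>(x) \<ge> k |x|\<close>, that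
  is \<open>|x| powr ((n - 2) / 2) * u x \<le> k powr (- (n - 2) / 2)\<close>.\<close>

theorem theorem1p1:
  fixes U :: "(real ^ 'n ^ 'n) set"
    and F :: "real ^ 'n ^ 'n \<Rightarrow> real"
    and u :: "real ^ 'n \<Rightarrow> real"
    and S :: "(real ^ 'n) set"
  defines "S \<equiv> UNIV - ball 0 (1/2)"
  assumes n: "CARD('n) \<ge> 3"
    and U_open: "openin (top_of_set sym_matrices) U"
    and U_inv: "\<And>Q. orthogonal_matrix Q \<Longrightarrow> (\<lambda>M. matrix_inv Q ** M ** Q) ` U = U"
    and U_convex: "\<And>M N. M \<in> sym_matrices \<Longrightarrow> pos_def N \<Longrightarrow>
                     convex (U \<inter> {M + t *\<^sub>R N | t. 0 < t})"
    and F_C1: "C1_on_sym U F"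
    and F_inv: "\<And>M Q. M \<in> U \<Longrightarrow> orthogonal_matrix Q \<Longrightarrow> F (matrix_inv Q ** M ** Q) = F M"
    and F_elliptic: "\<And>M. M \<in> U \<Longrightarrow> pos_def (matrix_grad F M)"
    and F_ne_1: "\<exists>\<delta>>0. \<forall>M\<in>U. norm M < \<delta> \<longrightarrow> F M \<noteq> 1"
    and u_C2: "C2_on S u"
    and u_pos: "\<And>x. x \<in> S \<Longrightarrow> u x > 0"
    and u_superharmonic: "\<And>x. x \<in> S \<Longrightarrow> laplacian S u x \<le> 0"
    and A_in_U: "\<And>x. x \<in> S \<Longrightarrow> A_conf S u x \<in> U"
    and equation: "\<And>x. x \<in> S \<Longrightarrow> F (A_conf S u x) = 1"
  shows "Limsup at_infinity (\<lambda>x. ereal (norm x powr ((real CARD('n) - 2) / 2) * u x)) < \<infinity>"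
proof -
  interpret conformal_equation U F
    by unfold_locales (fact n U_open U_inv U_convex F_C1 F_inv F_elliptic F_ne_1)+
  define m where "m = real CARD('n)"
  have m: "3 \<le> m" using n by (simp add: m_def)
  define a where "a = - (2 / (m - 2))"
  define W where "W = - cball (0::real^'n) (1/2)"
  have W: "open W" "W \<subseteq> S" by (auto simp: W_def S_def)
  have ju: "jet2 W u (gradient S u) (hessian S u)" by (rule jet2_of_C2_on[OF u_C2 W])
  have posW: "0 < u x" if "x \<in> W" for x using u_pos W that by blast
  define \<rho>0 where "\<rho>0 x = u x powr a" for x
  define g0 where "g0 x = (a * u x powr (a - 1)) *\<^sub>R gradient S u x" for x
  define H0 where "H0 x = (a * u x powr (a - 1)) *\<^sub>R hessian S u x + (a * (a - 1) * u x powr (a - 2)) *\<^sub>R outer (gradient S u x) (gradient S u x)" for x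
  have A0: "conf_op (\<rho>0 x) (g0 x) (H0 x) = A_conf S u x" if "x \<in> W" for x
    unfolding \<rho>0_def g0_def H0_def a_def m_def by (rule conf_op_powr_eq_A_conf[where u = u and x = x, OF n posW[OF that]])
  have tr0: "0 \<le> trace (A_conf S u x)" if x: "x \<in> W" for x
  proof -
    let ?p = "u x powr (- ((m + 2) / (m - 2)))" and ?q = "u x powr (- (2 * m / (m - 2)))" and ?g = "gradient S u x"
    have tro: "trace (outer ?g ?g) = (norm ?g)^2"
      by (simp add: trace_def outer_def power2_norm_eq_inner inner_vec_def)
    have "trace (A_conf S u x) = - (2 / (m - 2)) * ?p * trace (hessian S u x)
        + (2 * m / (m - 2)^2 * ?q) * trace (outer ?g ?g) - (2 / (m - 2)^2 * ?q * (norm ?g)^2) * trace (mat 1 :: real^'n^'n)"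
      unfolding A_conf_def Let_def m_def[symmetric] by (simp only: trace_add trace_sub trace_scaleR)
    also have "\<dots> = (2 / (m - 2)) * ?p * (- laplacian S u x)"
      unfolding tro trace_mat_1 m_def[symmetric] laplacian_def by simp
    also have "0 \<le> \<dots>" using u_superharmonic[of x] W x m by (intro mult_nonneg_nonneg) auto
    finally show ?thesis .
  qed
  have sol0: "solution W \<rho>0 g0 H0"
    unfolding solution_def
  proof (intro conjI ballI)
    show "jet2 W \<rho>0 g0 H0" unfolding \<rho>0_def[abs_def] g0_def[abs_def] H0_def[abs_def] by (rule powr_jet[OF ju posW])
    fix x assume x: "x \<in> W"
    show "0 < \<rho>0 x" using posW[OF x] by (simp add: \<rho>0_def)
    show "conf_op (\<rho>0 x) (g0 x) (H0 x) \<in> U" "F (conf_op (\<rho>0 x) (g0 x) (H0 x)) = 1"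
      "0 \<le> trace (conf_op (\<rho>0 x) (g0 x) (H0 x))"
      unfolding A0[OF x] using A_in_U equation tr0 x W(2) by blast+
  qed
  obtain c where c: "0 < c" "\<And>y. 1 \<le> norm y \<Longrightarrow> c * norm y powr (2 - m) \<le> u y"
  proof -
    have "- ball 0 1 \<subseteq> W" by (auto simp: W_def)
    moreover have "y \<in> W" if "1 \<le> norm y" for y using that by (simp add: W_def)
    moreover have "trace (hessian S u y) \<le> 0" if "1 \<le> norm y" for y
      using u_superharmonic[of y] that by (simp add: S_def laplacian_def)
    ultimately show ?thesis
      using superharmonic_lower_bound_at_infinity[OF n ju] posW that unfolding m_def by blast
  qed
  define V where "V = ball (0::real^'n) 2 - {0}"
  have norm_inv: "norm (inversion 0 1 y) = 1 / norm y" if "y \<noteq> 0" for y :: "real^'n"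
    using norm_inversion[of y 0 1] that by simp
  have solV: "solution V (kelvin 0 1 \<rho>0) (kelvin_grad 0 1 \<rho>0 g0) (kelvin_hess 0 1 \<rho>0 g0 H0)"
  proof (rule solution_kelvin[OF sol0 zero_less_one])
    show "open V" unfolding V_def by (intro open_Diff) auto
    fix y assume "y \<in> V"
    then have y: "y \<noteq> 0" "norm y < 2" by (auto simp: V_def)
    then have "1/2 < norm (inversion 0 1 y)" unfolding norm_inv[OF y(1)] by (simp add: field_simps)
    then show "y \<noteq> 0 \<and> inversion 0 1 y \<in> W" using y by (simp add: W_def)
  qed
  have bounded: "kelvin 0 1 \<rho>0 y \<le> c powr a" if y: "y \<in> cball 0 1 - {0}" for y
  proof -
    define Y where "Y = inversion 0 1 y"
    have ny: "0 < norm y" "norm y \<le> 1" using y by auto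
    have nY: "norm Y = 1 / norm y" using norm_inv y by (simp add: Y_def)
    have "c * norm Y powr (2 - m) \<le> u Y" using ny by (intro c(2)) (simp add: nY)
    then have "u Y powr a \<le> (c * norm Y powr (2 - m)) powr a"
      using c(1) ny m by (intro powr_mono2') (auto simp: a_def nY)
    also have "\<dots> = c powr a * norm Y powr ((2 - m) * a)"
      using c(1) by (simp add: powr_mult powr_powr)
    also have "(2 - m) * a = 2" using m by (simp add: a_def field_simps)
    also have "norm Y powr 2 = (1 / norm y)^2" using ny by (simp add: nY powr_numeral)
    finally have "(norm y)^2 * u Y powr a \<le> (norm y)^2 * (c powr a * (1 / norm y)^2)"
      by (intro mult_left_mono) auto
    also have "\<dots> = c powr a" using ny by (simp add: power_divide)
    finally show ?thesis by (simp add: kelvin_norm \<rho>0_def Y_def)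
  qed
  have "cball 0 1 - {0} \<subseteq> V" by (auto simp: V_def)
  from linear_lower_bound_near_singularity[OF solV this bounded]
  obtain k d where k: "0 < k" "0 < d" "\<And>y. 0 < norm y \<Longrightarrow> norm y < d \<Longrightarrow> k * norm y \<le> kelvin 0 1 \<rho>0 y" by blast
  have main: "norm x powr ((m - 2) / 2) * u x \<le> k powr (- ((m - 2) / 2))" if x: "1 < norm x" "1 / d < norm x" for x
  proof -
    define y where "y = inversion 0 1 x"
    have x0: "x \<noteq> 0" using x by auto
    have ny: "norm y = 1 / norm x" using norm_inv[OF x0] by (simp add: y_def)
    have invy: "inversion 0 1 y = x"
      using x0 by (simp add: y_def inversion_def dot_square_norm power2_eq_square)
    have "norm y < d" using x k(2) x0 by (simp add: ny field_simps)
    then have "k * norm y \<le> kelvin 0 1 \<rho>0 y" using x0 by (intro k(3)) (simp_all add: ny)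
    then have "k * norm y \<le> norm y * norm y * \<rho>0 x" by (simp add: kelvin_norm invy power2_eq_square)
    then have "k * norm x \<le> \<rho>0 x" using x0 by (simp add: ny field_simps)
    moreover have "0 < k * norm x" using k(1) x0 by simp
    ultimately have "\<rho>0 x powr (- ((m - 2) / 2)) \<le> (k * norm x) powr (- ((m - 2) / 2))"
      using m by (intro powr_mono2') auto
    moreover have "\<rho>0 x powr (- ((m - 2) / 2)) = u x"
    proof -
      have "0 < u x" using x by (intro posW) (simp add: W_def)
      moreover have "a * (- ((m - 2) / 2)) = 1" using m by (simp add: a_def field_simps)
      ultimately show ?thesis by (simp only: \<rho>0_def powr_powr powr_one)
    qed
    ultimately have "u x \<le> k powr (- ((m - 2) / 2)) * norm x powr (- ((m - 2) / 2))"
      using k(1) by (simp add: powr_mult)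
    then have "norm x powr ((m - 2) / 2) * u x \<le> norm x powr ((m - 2) / 2) * (k powr (- ((m - 2) / 2)) * norm x powr (- ((m - 2) / 2)))"
      by (intro mult_left_mono) auto
    also have "\<dots> = k powr (- ((m - 2) / 2)) * (norm x powr ((m - 2) / 2) * norm x powr (- ((m - 2) / 2)))" by simp
    also have "norm x powr ((m - 2) / 2) * norm x powr (- ((m - 2) / 2)) = 1"
      unfolding powr_add[symmetric] using x0 by simp
    finally show ?thesis by simp
  qed
  have "\<forall>\<^sub>F x in at_infinity. ereal (norm x powr ((real CARD('n) - 2) / 2) * u x) \<le> ereal (k powr (- ((m - 2) / 2)))"
    unfolding eventually_at_infinity
  proof (intro exI allI impI)
    fix x :: "real^'n" assume "max 1 (1 / d) + 1 \<le> norm x"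
    then have "1 < norm x" "1 / d < norm x" by linarith+
    then show "ereal (norm x powr ((real CARD('n) - 2) / 2) * u x) \<le> ereal (k powr (- ((m - 2) / 2)))"
      using main by (simp add: m_def)
  qed
  then have "Limsup at_infinity (\<lambda>x. ereal (norm x powr ((real CARD('n) - 2) / 2) * u x)) \<le> ereal (k powr (- ((m - 2) / 2)))"
    by (rule Limsup_bounded)
  also have "\<dots> < \<infinity>" by simp
  finally show ?thesis .
qed

end
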